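(* Let $n\ge 2$, $2\le k\le n$, $b\in(-1,1)$, $b_*=\sqrt{(1+b)/2}$, and $$\Omega_b=\{\eta\in S^n:\ \eta_{n+1}>b\},\qquad \tilde\Omega_b=\{\tau\in\mathcal T:\ |\tau|>b_*\}.$$ Suppose that $f$ is a function on $S^n$ satisfying $$\int_{\{\eta\in S^n:\ \eta_{n+1}>1-\varepsilon\}}\frac{|f(\eta)|}{(1-\eta_{n+1})^{(n+1-k)/2}}\,dS(\eta)<\infty\qquad\text{for all } 0<\varepsilon\le 2 .$$ (i) If $f(\eta)=0$ for almost all $\eta\in\Omega_b$, then $(\mathfrak S f)(\tau\cap S^n)=0$ for almost all $\tau\in\tilde\Omega_b$. (ii) Conversely, suppose additionally that $f$ is continuous on $S^n\setminus\{N\}$ and $$(\mathrm{A})\qquad \sup_{\eta\in S^n}(1-\eta_{n+1})^{k-1-m/2}|f(\eta)|<\infty\quad\text{for all } m>0 .$$ Then the following implication holds: $$(\mathrm{B})\qquad (\mathfrak S f)(\tau\cap S^n)=0\ \ \forall\,\tau\in\tilde\Omega_b\ \Longrightarrow\ f(\eta)=0\ \ \forall\,\eta\in\Omega_b.$$ If $k<n$, then (B) holds with assumption (A) replaced by the less restrictive assumption $$\sup_{\eta\in S^n}(1-\eta_{n+1})^{\mu}|f(\eta)|<\infty\quad\text{for some}\quad\mu<\frac{k-1}{2},$$ which is sharp.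
   Context: $S^n$ is the unit sphere in $\mathbb R^{n+1}$, $dS$ is its surface area measure, $e_1,\dots,e_{n+1}$ are the coordinate unit vectors, $N=e_{n+1}$ is the north pole, $\eta_{n+1}$ is the last coordinate of $\eta$, and $\mathbb R^n=\mathbb R e_1\oplus\cdots\oplus\mathbb R e_n\subset\mathbb R^{n+1}$. $\mathcal T$ is the manifold of all $k$-dimensional affine planes $\tau$ in $\mathbb R^{n+1}$ passing through $N$ and intersecting $\mathbb R^n$; "almost all $\tau$" refers to the standard measure on this manifold. $|\tau|$ denotes the Euclidean distance from the origin to $\tau$. The spherical slice transform of $f$ is $(\mathfrak S f)(\tau\cap S^n)=\int_{\tau\cap S^n} f(\eta)\,dS_\tau(\eta)$, $\tau\in\mathcal T$, where $dS_\tau$ is the standard surface area measure on the subsphere $\tau\cap S^n$.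
   Formalization: The north pole N is left out of the suprema and of the conclusion of (B), since f(N) is unconstrained (f nonzero only at N refutes (B) when 0<μ<(k-1)/2); "sharp" is read as: at μ=(k-1)/2 the slice transform may diverge. *)

theory Defs
  imports "HOL-Analysis.Analysis"
begin

text \<open>
  \<open>\<real>\<^sup>n\<^sup>+\<^sup>1\<close> is rendered as \<open>(real^'n) \<times> real\<close> with \<open>n = CARD('n)\<close>: the last coordinate
  \<open>\<eta>\<^sub>n\<^sub>+\<^sub>1\<close> is \<open>snd \<eta>\<close>, the coordinate hyperplane \<open>\<real>\<^sup>n\<close> is \<open>{x. snd x = 0}\<close>, and \<open>S\<^sup>n\<close> is
  \<open>sphere 0 1\<close>.
\<close>

definition north_pole :: "(real^'n) \<times> real" where
  "north_pole = (0, 1)"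

text \<open>
  Lebesgue measure on a linear subspace, as a Borel measure on the ambient space; by rotation
  invariance it does not depend on the chosen orthonormal basis.
\<close>

definition orthonormal_basis_of :: "'a::euclidean_space set \<Rightarrow> 'a set" where
  "orthonormal_basis_of V = (SOME B. pairwise orthogonal B \<and> (\<forall>v\<in>B. norm v = 1) \<and> span B = V)"

definition subspace_lborel :: "'a::euclidean_space set \<Rightarrow> 'a measure" where
  "subspace_lborel V =
     distr (PiM (orthonormal_basis_of V) (\<lambda>_. lborel :: real measure)) borel
       (\<lambda>x. \<Sum>v\<in>orthonormal_basis_of V. x v *\<^sub>R v)"

text \<open>
  Surface area measure of the sphere \<open>\<tau> \<inter> sphere 0 1\<close>, for an affine subspace \<open>\<tau>\<close> of positive
  dimension that meets the open unit ball.  This sphere has the foot \<open>c\<close> of the perpendicular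
  from the origin as its centre and \<open>\<rho> = sqrt (1 - |c|\<^sup>2)\<close> as its radius.  The area of a subset
  \<open>A\<close> is given by the cone formula: the cone over \<open>A\<close> with apex \<open>c\<close> has
  (dim \<open>\<tau>\<close>)-dimensional volume \<open>(\<rho> / dim \<tau>) * area A\<close>.
  Hence \<open>surface_measure UNIV\<close> is the surface area measure \<open>dS\<close> of the whole unit sphere.
\<close>

definition surface_measure :: "'a::euclidean_space set \<Rightarrow> 'a measure" where
  "surface_measure \<tau> =
     (let c = closest_point \<tau> 0;
          \<rho> = sqrt (1 - (norm c)\<^sup>2);
          V = (\<lambda>x. x - c) ` \<tau>
      in scale_measure (ennreal (real (dim V) / \<rho>))
           (distr (restrict_space (subspace_lborel V) (ball 0 \<rho>)) borel
              (\<lambda>x. c + (\<rho> / norm x) *\<^sub>R x)))"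

definition slice_planes :: "nat \<Rightarrow> ((real^'n) \<times> real) set set" where
  "slice_planes k =
     {\<tau>. affine \<tau> \<and> aff_dim \<tau> = int k \<and> north_pole \<in> \<tau> \<and> \<tau> \<inter> {x. snd x = 0} \<noteq> {}}"

text \<open>
  The standard measure on \<open>slice_planes k\<close>, an open dense subset of the Grassmannian of
  \<open>k\<close>-dimensional planes through the north pole.  Up to normalisation it is the rotation
  invariant measure: the law of \<open>north_pole + span {v\<^sub>0, \<dots>, v\<^sub>k\<^sub>-\<^sub>1}\<close> with independent \<open>v\<^sub>i\<close>
  uniform on the sphere, on the largest sigma-algebra for which this random plane is measurable.
  The motion invariant measure on the affine planes \<open>\<tau> \<inter> \<real>\<^sup>n\<close> has the same null sets.
\<close>

definition spanned_plane :: "nat \<Rightarrow> (nat \<Rightarrow> (real^'n) \<times> real) \<Rightarrow> ((real^'n) \<times> real) set" where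
  "spanned_plane k v = (+) north_pole ` span (v ` {..<k})"

definition slice_planes_measure :: "nat \<Rightarrow> ((real^'n) \<times> real) set measure" where
  "slice_planes_measure k =
     (let P = PiM {..<k} (\<lambda>_. surface_measure (UNIV :: ((real^'n) \<times> real) set))
      in restrict_space
           (distr P (sigma UNIV {\<A>. spanned_plane k -` \<A> \<inter> space P \<in> sets P}) (spanned_plane k))
           (slice_planes k))"

text \<open>
  Completed measures are used so that Lebesgue measurable functions are admitted.
  \<open>slice_transform\<close> is meaningful only where \<open>slice_converges\<close> holds.
\<close>

definition slice_converges :: "((real^'n) \<times> real \<Rightarrow> complex) \<Rightarrow> ((real^'n) \<times> real) set \<Rightarrow> bool" where
  "slice_converges f \<tau> \<longleftrightarrow> integrable (completion (surface_measure \<tau>)) f"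

definition slice_transform ::
    "((real^'n) \<times> real \<Rightarrow> complex) \<Rightarrow> ((real^'n) \<times> real) set \<Rightarrow> complex" where
  "slice_transform f \<tau> = (LINT \<eta>|completion (surface_measure \<tau>). f \<eta>)"

definition cap :: "real \<Rightarrow> ((real^'n) \<times> real) set" where
  "cap b = {\<eta> \<in> sphere 0 1. snd \<eta> > b}"

definition far_planes :: "nat \<Rightarrow> real \<Rightarrow> ((real^'n) \<times> real) set set" where
  "far_planes k b = {\<tau> \<in> slice_planes k. infdist 0 \<tau> > sqrt ((1 + b) / 2)}"

definition slice_integrability :: "nat \<Rightarrow> ((real^'n) \<times> real \<Rightarrow> complex) \<Rightarrow> bool" where
  "slice_integrability k f \<longleftrightarrow>
     f \<in> borel_measurable (completion (surface_measure UNIV)) \<and>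
     (\<forall>\<epsilon>. 0 < \<epsilon> \<and> \<epsilon> \<le> 2 \<longrightarrow>
        set_integrable (completion (surface_measure UNIV)) {\<eta> \<in> sphere 0 1. snd \<eta> > 1 - \<epsilon>}
          (\<lambda>\<eta>. norm (f \<eta>) / (1 - snd \<eta>) powr ((real CARD('n) + 1 - real k) / 2)))"

text \<open>
  The pole is left out of the supremum: the weight is singular there for \<open>\<mu> < 0\<close>, and \<open>f\<close> is
  only of interest on \<open>S\<^sup>n - {N}\<close>.
\<close>

definition weighted_bounded :: "real \<Rightarrow> ((real^'n) \<times> real \<Rightarrow> complex) \<Rightarrow> bool" where
  "weighted_bounded \<mu> f \<longleftrightarrow>
     bdd_above ((\<lambda>\<eta>. (1 - snd \<eta>) powr \<mu> * norm (f \<eta>)) ` (sphere 0 1 - {north_pole}))"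

text \<open>
  The cap contains the pole, a null set of every slice at which \<open>f\<close> is unconstrained; so the
  conclusion of the support property concerns the cap without the pole.
\<close>

definition support_property :: "nat \<Rightarrow> real \<Rightarrow> ((real^'n) \<times> real \<Rightarrow> complex) \<Rightarrow> bool" where
  "support_property k b f \<longleftrightarrow>
     ((\<forall>\<tau>\<in>far_planes k b. slice_transform f \<tau> = 0) \<longrightarrow> (\<forall>\<eta>\<in>cap b - {north_pole}. f \<eta> = 0))"

text \<open>
  Sharpness of the range \<open>\<mu> < (k - 1) / 2\<close>.  For \<open>\<mu> = (k - 1) / 2\<close> the slice transform, and with
  it the support property, loses its meaning: the transform may diverge on every plane, and even
  under the integrability assumption it may diverge on a plane in \<open>far_planes k b\<close>.
\<close>

definition decay_sharp :: "'n::finite itself \<Rightarrow> nat \<Rightarrow> real \<Rightarrow> bool" where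
  "decay_sharp _ k b \<longleftrightarrow>
     (\<exists>f :: (real^'n) \<times> real \<Rightarrow> complex.
        continuous_on (sphere 0 1 - {north_pole}) f \<and> weighted_bounded ((real k - 1) / 2) f \<and>
        (\<forall>\<tau>\<in>slice_planes k. \<not> slice_converges f \<tau>)) \<and>
     (\<exists>f :: (real^'n) \<times> real \<Rightarrow> complex.
        slice_integrability k f \<and>
        continuous_on (sphere 0 1 - {north_pole}) f \<and> weighted_bounded ((real k - 1) / 2) f \<and>
        (\<exists>\<tau>\<in>far_planes k b. \<not> slice_converges f \<tau>))"

end

theory Submission
  imports Defs "HOL-Probability.Distributions"
begin

text \<open>
  Stereographic projection from the pole \<open>N\<close> maps the slice \<open>\<tau> \<inter> S\<^sup>n\<close> onto the affine
  \<open>(k - 1)\<close>-plane \<open>\<tau> \<inter> \<real>\<^sup>n\<close>.  It is conformal with factor \<open>2 / (1 + |x|\<^sup>2) = 1 - \<eta>\<^sub>n\<^sub>+\<^sub>1\<close>, so the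
  slice transform of \<open>f\<close> at \<open>\<tau>\<close> is the integral over \<open>\<tau> \<inter> \<real>\<^sup>n\<close> of the function \<open>F\<close> on
  \<open>\<real>\<^sup>n\<close> that takes \<open>x\<close> to \<open>(2 / (1 + |x|\<^sup>2))\<^sup>k\<^sup>-\<^sup>1\<close> times the value of \<open>f\<close> at the point
  over \<open>x\<close> (\<open>surface_measure_pole_plane\<close>, \<open>slice_integral\<close>).  The cap \<open>\<eta>\<^sub>n\<^sub>+\<^sub>1 > b\<close> corresponds to
  the exterior of the ball of radius \<open>R = sqrt ((1 + b) / (1 - b))\<close>, and the planes of
  distance greater than \<open>sqrt ((1 + b) / 2)\<close> from the origin are those whose trace in
  \<open>\<real>\<^sup>n\<close> misses the closed ball (\<open>cap_threshold\<close>, \<open>distance_threshold\<close>).  Everything is thus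
  reduced to the plane transform on \<open>\<real>\<^sup>n\<close>.

  Part (i).  The slice of a distant plane lies in the cap.  A null set \<open>Z\<close> of the sphere
  spans with \<open>N\<close> a null cone \<open>C\<close> of directions, and a slice meets \<open>Z\<close> in a null set if the
  direction space of its plane meets \<open>C\<close> in a null set (\<open>cone_null_iff\<close>).  By Fubini
  almost every random combination \<open>\<Sum> t\<^sub>i v\<^sub>i\<close> avoids \<open>C\<close>, hence almost every span of
  \<open>v\<^sub>0, \<dots>, v\<^sub>k\<^sub>-\<^sub>1\<close> meets \<open>C\<close> in a null set (\<open>AE_slice_planes\<close>).

  Part (ii), \<open>k < n\<close>.  Let \<open>|x| > R\<close> and let \<open>H\<close> be a \<open>k\<close>-dimensional subspace orthogonal
  to \<open>x\<close>.  No hyperplane of \<open>x + H\<close> meets the ball, so all hyperplane integrals of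
  \<open>G(y) = F(x + y)\<close> on \<open>H\<close> vanish.  Then \<open>G\<close> is orthogonal to every ridge function of
  \<open>y \<bullet> w\<close>, and the average of \<open>exp (- (y \<bullet> w)\<^sup>2)\<close> over \<open>w\<close> with the weight
  \<open>exp (- t |w|\<^sup>2)\<close> is a multiple of \<open>(t + |y|\<^sup>2) powr (- 1/2)\<close>, which decays just fast enough
  for the assumption \<open>\<mu> < (k - 1) / 2\<close>.  Differentiation in \<open>t\<close> produces higher powers,
  which form an approximate identity as \<open>t\<close> tends to 0; so \<open>G(0) = 0\<close>
  (\<open>hyperplane_transform_injective\<close>).

  Part (ii), \<open>k = n\<close>.  Now \<open>F\<close> decreases rapidly and its integrals over the hyperplanes that
  miss the ball vanish.  Hence \<open>F\<close> is orthogonal to \<open>max 0 (y \<bullet> w - t)\<^sup>l\<close> whenever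
  \<open>R |w| < t\<close>.  This condition is open in \<open>w\<close>; differentiation in \<open>w\<close> shows that the same
  holds for \<open>q F\<close> with any polynomial \<open>q\<close> (\<open>annihilated_polynomial\<close>).  A weighted average
  over the unit ball of all \<open>w\<close> turns the ridge functions into truncated powers of
  \<open>|y|\<^sup>2 - \<tau>\<close>, and differentiation in \<open>\<tau>\<close> lowers the power to 1
  (\<open>truncated_power_zero\<close>).  Second differences in \<open>\<tau>\<close> localise to a spherical shell,
  where the polynomials are dense, and so \<open>F\<close> vanishes on the shell
  (\<open>vanishes_outside_ball\<close>).

  Sharpness.  For \<open>f(\<eta>) = (1 - \<eta>\<^sub>n\<^sub>+\<^sub>1) powr (- (k - 1) / 2)\<close> the function \<open>F\<close> is a multiple
  of \<open>(1 + |x|\<^sup>2) powr (- (k - 1) / 2)\<close>, whose integral over every \<open>(k - 1)\<close>-plane diverges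
  logarithmically.  Multiplication by a Gaussian in the distance from one fixed plane
  keeps the divergence on that plane and makes the function integrable.
\<close>

section \<open>Lebesgue measure on linear subspaces\<close>

text \<open>
  The vectors \<open>v\<^sub>i\<close> are arbitrary: orthonormal frames give the measure on a subspace, and
  random tuples describe the random planes of the measure on planes.
\<close>

definition combination_lborel :: "'i set \<Rightarrow> ('i \<Rightarrow> 'a::euclidean_space) \<Rightarrow> 'a measure" where
  "combination_lborel I v = distr (PiM I (\<lambda>_. lborel :: real measure)) borel (\<lambda>x. \<Sum>i\<in>I. x i *\<^sub>R v i)"

definition orthonormal_basis :: "'a::euclidean_space set \<Rightarrow> 'a set \<Rightarrow> bool" where
  "orthonormal_basis B V \<longleftrightarrow> pairwise orthogonal B \<and> (\<forall>v\<in>B. norm v = 1) \<and> span B = V"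

lemma lborel_product_sigma_finite: "product_sigma_finite (\<lambda>_::'i. lborel :: real measure)"
  by standard

lemma measurable_combination [measurable]:
  fixes v :: "'i \<Rightarrow> 'a::euclidean_space"
  shows "(\<lambda>x. \<Sum>i\<in>I. x i *\<^sub>R v i) \<in> borel_measurable (PiM I (\<lambda>_. lborel :: real measure))"
  by measurable

lemma sets_combination_lborel [simp, measurable_cong]: "sets (combination_lborel I v) = sets borel"
  by (simp add: combination_lborel_def)

lemma space_combination_lborel [simp]: "space (combination_lborel I v) = UNIV"
  by (simp add: combination_lborel_def)

lemma sets_subspace_lborel [simp, measurable_cong]: "sets (subspace_lborel V) = sets borel"
  by (simp add: subspace_lborel_def)

lemma space_subspace_lborel [simp]: "space (subspace_lborel V) = UNIV"
  by (simp add: subspace_lborel_def)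

lemma orthonormal_basis_exists: "subspace V \<Longrightarrow> \<exists>B. orthonormal_basis B V"
  unfolding orthonormal_basis_def by (metis orthonormal_basis_subspace)

lemma orthonormal_basis_span: "orthonormal_basis B V \<Longrightarrow> span B = V"
  by (simp add: orthonormal_basis_def)

lemma orthonormal_basis_independent:
  assumes "orthonormal_basis B V" shows "independent B" "finite B" "card B = dim V"
proof -
  show i: "independent B"
    using assms unfolding orthonormal_basis_def by (metis norm_zero pairwise_orthogonal_independent zero_neq_one)
  then show "finite B" by (rule independent_imp_finite)
  show "card B = dim V" using i assms by (metis dim_span_eq_card_independent orthonormal_basis_span)
qed

lemma norm_orthonormal_sum:
  assumes "pairwise orthogonal B" "\<forall>v\<in>B. norm v = 1" "finite B"
  shows "(norm (\<Sum>v\<in>B. x v *\<^sub>R v))\<^sup>2 = (\<Sum>v\<in>B. (x v)\<^sup>2)"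
proof -
  have "(norm (\<Sum>v\<in>B. x v *\<^sub>R v))\<^sup>2 = (\<Sum>v\<in>B. (norm (x v *\<^sub>R v))\<^sup>2)"
    by (rule norm_sum_Pythagorean[OF assms(3)])
       (use assms(1) in \<open>auto simp: pairwise_def orthogonal_def\<close>)
  also have "\<dots> = (\<Sum>v\<in>B. (x v)\<^sup>2)" using assms(2) by (intro sum.cong) auto
  finally show ?thesis .
qed

lemma vimage_plus_sets_lborel: "A \<in> sets lborel \<Longrightarrow> (\<lambda>y. (c::real) + y) -` A \<in> sets lborel"
  using measurable_sets[of "\<lambda>y. c + y" lborel lborel A] by simp

lemma PiM_lborel_translate:
  fixes c :: "'i \<Rightarrow> real"
  assumes "finite I"
  shows "distr (PiM I (\<lambda>_. lborel)) (PiM I (\<lambda>_. lborel)) (\<lambda>x. \<lambda>i\<in>I. c i + x i) = PiM I (\<lambda>_. lborel :: real measure)"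
proof -
  interpret product_sigma_finite "\<lambda>_::'i. lborel :: real measure"
    by (rule lborel_product_sigma_finite)
  show ?thesis
  proof (rule PiM_eqI[OF assms])
    fix A :: "'i \<Rightarrow> real set" assume A: "\<And>i. i \<in> I \<Longrightarrow> A i \<in> sets lborel"
    have "(\<lambda>x. \<lambda>i\<in>I. c i + x i) -` Pi\<^sub>E I A \<inter> space (PiM I (\<lambda>_. lborel))
        = Pi\<^sub>E I (\<lambda>i. (\<lambda>y. c i + y) -` A i)"
      by (auto simp: space_PiM PiE_def Pi_def)
    moreover have "(\<lambda>x. \<lambda>i\<in>I. c i + x i) \<in> PiM I (\<lambda>_. lborel) \<rightarrow>\<^sub>M PiM I (\<lambda>_. lborel :: real measure)"
      by measurable
    moreover have "Pi\<^sub>E I A \<in> sets (PiM I (\<lambda>_. lborel :: real measure))"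
      using A assms by (intro sets_PiM_I_finite) auto
    ultimately have "emeasure (distr (PiM I (\<lambda>_. lborel)) (PiM I (\<lambda>_. lborel)) (\<lambda>x. \<lambda>i\<in>I. c i + x i)) (Pi\<^sub>E I A)
       = emeasure (PiM I (\<lambda>_. lborel)) (Pi\<^sub>E I (\<lambda>i. (\<lambda>y. c i + y) -` A i))"
      by (simp add: emeasure_distr)
    also have "\<dots> = (\<Prod>i\<in>I. emeasure lborel ((\<lambda>y. c i + y) -` A i))"
      using A by (intro emeasure_PiM[OF assms] vimage_plus_sets_lborel) auto
    also have "\<dots> = (\<Prod>i\<in>I. emeasure lborel (A i))"
    proof (intro prod.cong refl)
      fix i assume "i \<in> I"
      have "emeasure lborel (A i) = emeasure (distr lborel borel ((+) (c i))) (A i)"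
        by (simp add: lborel_distr_plus)
      also have "\<dots> = emeasure lborel ((\<lambda>y. c i + y) -` A i)"
        using A[OF \<open>i \<in> I\<close>] by (subst emeasure_distr) auto
      finally show "emeasure lborel ((\<lambda>y. c i + y) -` A i) = emeasure lborel (A i)" by simp
    qed
    finally show "emeasure (distr (PiM I (\<lambda>_. lborel)) (PiM I (\<lambda>_. lborel)) (\<lambda>x. \<lambda>i\<in>I. c i + x i)) (Pi\<^sub>E I A)
       = (\<Prod>i\<in>I. emeasure lborel (A i))" .
  qed simp
qed

lemma span_image_combination:
  fixes v :: "'i \<Rightarrow> 'a::real_vector"
  assumes "finite I" "a \<in> span (v ` I)"
  shows "\<exists>c. a = (\<Sum>i\<in>I. c i *\<^sub>R v i)"
proof -
  have "a \<in> range (\<lambda>c. \<Sum>i\<in>I. c i *\<^sub>R v i)"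
  proof (rule span_induct_alt[OF assms(2)])
    show "0 \<in> range (\<lambda>c. \<Sum>i\<in>I. c i *\<^sub>R v i)"
      by (rule image_eqI[of _ _ "\<lambda>_. 0"]) auto
    fix r x y assume "x \<in> v ` I" "y \<in> range (\<lambda>c. \<Sum>i\<in>I. c i *\<^sub>R v i)"
    then obtain j c where j: "j \<in> I" "x = v j" "y = (\<Sum>i\<in>I. c i *\<^sub>R v i)" by auto
    have "r *\<^sub>R x + y = (\<Sum>i\<in>I. (if i = j then r else 0) *\<^sub>R v i) + (\<Sum>i\<in>I. c i *\<^sub>R v i)"
      using j assms(1) by (simp add: if_distrib[of "\<lambda>t. t *\<^sub>R _"] sum.delta cong: if_cong)
    also have "\<dots> = (\<Sum>i\<in>I. ((if i = j then r else 0) + c i) *\<^sub>R v i)"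
      by (simp add: sum.distrib scaleR_add_left)
    finally show "r *\<^sub>R x + y \<in> range (\<lambda>c. \<Sum>i\<in>I. c i *\<^sub>R v i)"
      by (rule image_eqI[of _ _ "\<lambda>i. (if i = j then r else 0) + c i"]) auto
  qed
  then show ?thesis by auto
qed

lemma combination_lborel_translate:
  fixes v :: "'i \<Rightarrow> 'a::euclidean_space"
  assumes "finite I" "a \<in> span (v ` I)"
  shows "distr (combination_lborel I v) borel (\<lambda>x. a + x) = combination_lborel I v"
proof -
  let ?P = "PiM I (\<lambda>_. lborel :: real measure)"
  obtain c where c: "a = (\<Sum>i\<in>I. c i *\<^sub>R v i)"
    using span_image_combination[OF assms] by blast
  have "distr (combination_lborel I v) borel (\<lambda>x. a + x) = distr ?P borel (\<lambda>x. a + (\<Sum>i\<in>I. x i *\<^sub>R v i))"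
    unfolding combination_lborel_def by (subst distr_distr) (auto simp: comp_def)
  also have "(\<lambda>x. a + (\<Sum>i\<in>I. x i *\<^sub>R v i)) = (\<lambda>x. \<Sum>i\<in>I. x i *\<^sub>R v i) \<circ> (\<lambda>x. \<lambda>i\<in>I. c i + x i)"
    by (auto simp: c scaleR_add_left sum.distrib fun_eq_iff)
  also have "distr ?P borel \<dots> = distr (distr ?P ?P (\<lambda>x. \<lambda>i\<in>I. c i + x i)) borel (\<lambda>x. \<Sum>i\<in>I. x i *\<^sub>R v i)"
    by (rule distr_distr[symmetric]) auto
  also have "\<dots> = combination_lborel I v"
    by (simp add: PiM_lborel_translate[OF assms(1)] combination_lborel_def)
  finally show ?thesis .
qed

text \<open>
  This is the uniqueness of Haar measure in integrated form.  Both measures are invariant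
  under translation by the common span.  In the double integral of \<open>g S * f T\<close> the variable
  \<open>T\<close> is first replaced by \<open>S + T\<close> and then \<open>S\<close> by \<open>S - T\<close>; after a last shift \<open>f\<close> and \<open>g\<close>
  have changed places.  Taking a Gaussian for \<open>g\<close> determines the constant of proportionality
  of two invariant measures.
\<close>

lemma invariant_measures_exchange:
  fixes v :: "'i \<Rightarrow> 'a::euclidean_space" and w :: "'j \<Rightarrow> 'a"
  assumes fin: "finite I" "finite J" and sp: "span (v ` I) = span (w ` J)"
    and [measurable]: "f \<in> borel_measurable borel" "g \<in> borel_measurable borel"
  shows "(\<integral>\<^sup>+x. f x \<partial>combination_lborel I v) * (\<integral>\<^sup>+x. g x \<partial>combination_lborel J w)
       = (\<integral>\<^sup>+x. f x \<partial>combination_lborel J w) * (\<integral>\<^sup>+x. g (- x) \<partial>combination_lborel I v)"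
proof -
  let ?M = "PiM I (\<lambda>_. lborel :: real measure)" and ?L = "PiM J (\<lambda>_. lborel :: real measure)"
  interpret A: product_sigma_finite "\<lambda>_::'i. lborel :: real measure"
    by (rule lborel_product_sigma_finite)
  interpret B: product_sigma_finite "\<lambda>_::'j. lborel :: real measure"
    by (rule lborel_product_sigma_finite)
  interpret M: sigma_finite_measure "?M" by (rule A.sigma_finite[OF fin(1)])
  interpret L: sigma_finite_measure "?L" by (rule B.sigma_finite[OF fin(2)])
  interpret PQ: pair_sigma_finite "?M" "?L" by standard
  define T where "T = (\<lambda>x. \<Sum>i\<in>I. x i *\<^sub>R v i)"
  define S where "S = (\<lambda>x. \<Sum>i\<in>J. x i *\<^sub>R w i)"
  have [measurable]: "T \<in> borel_measurable ?M" "S \<in> borel_measurable ?L"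
    by (auto simp: T_def S_def)
  have T: "T x \<in> span (v ` I)" for x unfolding T_def by (intro span_sum span_mul span_base) auto
  have S: "S x \<in> span (v ` I)" for x unfolding S_def sp by (intro span_sum span_mul span_base) auto
  have cT: "nn_integral (combination_lborel I v) h = (\<integral>\<^sup>+x. h (T x) \<partial>?M)" if "h \<in> borel_measurable borel" for h
    using that unfolding combination_lborel_def T_def by (subst nn_integral_distr) auto
  have cS: "nn_integral (combination_lborel J w) h = (\<integral>\<^sup>+x. h (S x) \<partial>?L)" if "h \<in> borel_measurable borel" for h
    using that unfolding combination_lborel_def S_def by (subst nn_integral_distr) auto
  have sT: "(\<integral>\<^sup>+x. h (T x) \<partial>?M) = (\<integral>\<^sup>+x. h (a + T x) \<partial>?M)" if [measurable]: "h \<in> borel_measurable borel" and "a \<in> span (v ` I)" for h a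
  proof -
    have "(\<integral>\<^sup>+x. h (T x) \<partial>?M) = (\<integral>\<^sup>+x. h x \<partial>distr (combination_lborel I v) borel (\<lambda>x. a + x))"
      by (simp add: combination_lborel_translate[OF fin(1)] that cT)
    also have "\<dots> = (\<integral>\<^sup>+x. h (a + T x) \<partial>?M)"
      by (subst nn_integral_distr) (auto simp: cT)
    finally show ?thesis .
  qed
  have sS: "(\<integral>\<^sup>+x. h (S x) \<partial>?L) = (\<integral>\<^sup>+x. h (a + S x) \<partial>?L)" if [measurable]: "h \<in> borel_measurable borel" and "a \<in> span (v ` I)" for h a
  proof -
    have "(\<integral>\<^sup>+x. h (S x) \<partial>?L) = (\<integral>\<^sup>+x. h x \<partial>distr (combination_lborel J w) borel (\<lambda>x. a + x))"
      using that by (subst combination_lborel_translate[OF fin(2)]) (auto simp: sp cS)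
    also have "\<dots> = (\<integral>\<^sup>+x. h (a + S x) \<partial>?L)"
      by (subst nn_integral_distr) (auto simp: cS)
    finally show ?thesis .
  qed
  have "(\<integral>\<^sup>+x. f x \<partial>combination_lborel I v) * (\<integral>\<^sup>+x. g x \<partial>combination_lborel J w)
      = (\<integral>\<^sup>+y. g (S y) * (\<integral>\<^sup>+x. f (T x) \<partial>?M) \<partial>?L)"
    by (simp add: cT cS nn_integral_multc mult.commute)
  also have "\<dots> = (\<integral>\<^sup>+y. \<integral>\<^sup>+x. g (S y) * f (S y + T x) \<partial>?M \<partial>?L)"
  proof (rule nn_integral_cong)
    fix y
    have "(\<integral>\<^sup>+x. f (T x) \<partial>?M) = (\<integral>\<^sup>+x. f (S y + T x) \<partial>?M)"
      by (rule sT[OF _ S]) simp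
    then show "g (S y) * (\<integral>\<^sup>+x. f (T x) \<partial>?M) = (\<integral>\<^sup>+x. g (S y) * f (S y + T x) \<partial>?M)"
      by (simp add: nn_integral_cmult)
  qed
  also have "\<dots> = (\<integral>\<^sup>+x. \<integral>\<^sup>+y. g (S y) * f (S y + T x) \<partial>?L \<partial>?M)"
    by (rule PQ.Fubini') measurable
  also have "\<dots> = (\<integral>\<^sup>+x. \<integral>\<^sup>+y. g (- T x + S y) * f (S y) \<partial>?L \<partial>?M)"
  proof (rule nn_integral_cong)
    fix x
    show "(\<integral>\<^sup>+y. g (S y) * f (S y + T x) \<partial>?L) = (\<integral>\<^sup>+y. g (- T x + S y) * f (S y) \<partial>?L)"
      using sS[of "\<lambda>z. g z * f (z + T x)" "- T x"] T[of x] by (simp add: span_neg)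
  qed
  also have "\<dots> = (\<integral>\<^sup>+y. \<integral>\<^sup>+x. g (- T x + S y) * f (S y) \<partial>?M \<partial>?L)"
    by (rule PQ.Fubini'[symmetric]) measurable
  also have "\<dots> = (\<integral>\<^sup>+y. \<integral>\<^sup>+x. g (- T x) * f (S y) \<partial>?M \<partial>?L)"
  proof (rule nn_integral_cong)
    fix y
    show "(\<integral>\<^sup>+x. g (- T x + S y) * f (S y) \<partial>?M) = (\<integral>\<^sup>+x. g (- T x) * f (S y) \<partial>?M)"
      using sT[of "\<lambda>z. g (- z + S y) * f (S y)" "S y"] S[of y] by simp
  qed
  also have "\<dots> = (\<integral>\<^sup>+x. f x \<partial>combination_lborel J w) * (\<integral>\<^sup>+x. g (- x) \<partial>combination_lborel I v)"
    by (simp add: cT cS nn_integral_multc nn_integral_cmult mult.commute)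
  finally show ?thesis .
qed

lemma nn_integral_gaussian_line:
  assumes "a > 0"
  shows "(\<integral>\<^sup>+s. ennreal (exp (- a * s\<^sup>2)) \<partial>lborel) = ennreal (sqrt (pi / a))"
proof -
  define \<sigma> where "\<sigma> = sqrt (1 / (2 * a))"
  have s: "\<sigma> > 0" "\<sigma>\<^sup>2 = 1 / (2 * a)" using assms by (auto simp: \<sigma>_def)
  have "exp (- a * x\<^sup>2) = sqrt (pi / a) * normal_density 0 \<sigma> x" for x
  proof -
    have "2 * pi * \<sigma>\<^sup>2 = pi / a" "(x - 0)\<^sup>2 / (2 * \<sigma>\<^sup>2) = a * x\<^sup>2" using assms by (auto simp: s)
    then show ?thesis using assms by (simp add: normal_density_def)
  qed
  then have "(\<integral>\<^sup>+s. ennreal (exp (- a * s\<^sup>2)) \<partial>lborel) = (\<integral>\<^sup>+s. ennreal (sqrt (pi / a)) * ennreal (normal_density 0 \<sigma> s) \<partial>lborel)"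
    using assms by (intro nn_integral_cong) (simp add: ennreal_mult)
  also have "\<dots> = ennreal (sqrt (pi / a)) * (\<integral>\<^sup>+s. ennreal (normal_density 0 \<sigma> s) \<partial>lborel)"
    by (rule nn_integral_cmult) simp
  also have "(\<integral>\<^sup>+s. ennreal (normal_density 0 \<sigma> s) \<partial>lborel) = 1"
    using s by (subst nn_integral_eq_integral) auto
  finally show ?thesis by simp
qed

lemma nn_integral_gaussian_combination:
  assumes "orthonormal_basis B V" "a > 0"
  shows "(\<integral>\<^sup>+x. ennreal (exp (- a * (norm x)\<^sup>2)) \<partial>combination_lborel B (\<lambda>v. v)) = ennreal (sqrt (pi / a) ^ dim V)"
proof -
  interpret product_sigma_finite "\<lambda>_::'a. lborel :: real measure"
    by (rule lborel_product_sigma_finite)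
  have B: "pairwise orthogonal B" "\<forall>v\<in>B. norm v = 1" "finite B" "card B = dim V"
    using assms orthonormal_basis_independent[OF assms(1)] by (auto simp: orthonormal_basis_def)
  have "(\<integral>\<^sup>+x. ennreal (exp (- a * (norm x)\<^sup>2)) \<partial>combination_lborel B (\<lambda>v. v))
      = (\<integral>\<^sup>+x. (\<Prod>v\<in>B. ennreal (exp (- a * (x v)\<^sup>2))) \<partial>PiM B (\<lambda>_. lborel))"
    unfolding combination_lborel_def using B
    by (subst nn_integral_distr)
       (auto intro!: nn_integral_cong simp: norm_orthonormal_sum sum_distrib_left exp_sum prod_ennreal simp flip: sum_negf)
  also have "\<dots> = (\<Prod>v\<in>B. ennreal (sqrt (pi / a)))"
    using B assms(2) nn_integral_gaussian_line[of a] by (subst product_nn_integral_prod) auto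
  also have "\<dots> = ennreal (sqrt (pi / a) ^ dim V)"
    using B assms(2) by (simp add: ennreal_power)
  finally show ?thesis .
qed

text \<open>
  Two orthonormal bases of a subspace give proportional measures, and the constant is 1
  because a Gaussian has the same integral with respect to both.
\<close>

lemma subspace_lborel_eq_combination:
  assumes "orthonormal_basis B V"
  shows "subspace_lborel V = combination_lborel B (\<lambda>v. v)"
proof -
  define B' where "B' = orthonormal_basis_of V"
  have B': "orthonormal_basis B' V"
    unfolding B'_def orthonormal_basis_of_def orthonormal_basis_def
    by (rule someI_ex) (use assms in \<open>auto simp: orthonormal_basis_def\<close>)
  have eq: "subspace_lborel V = combination_lborel B' (\<lambda>v. v)"
    by (simp add: subspace_lborel_def combination_lborel_def B'_def)
  show ?thesis unfolding eq
  proof (rule measure_eqI)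
    fix A assume "A \<in> sets (combination_lborel B' (\<lambda>v. v))"
    then have [measurable]: "A \<in> sets borel" by simp
    let ?g = "\<lambda>x::'a. ennreal (exp (- 1 * (norm x)\<^sup>2))"
    have "emeasure (combination_lborel B' (\<lambda>v. v)) A * ennreal (sqrt (pi / 1) ^ dim V)
        = emeasure (combination_lborel B (\<lambda>v. v)) A * ennreal (sqrt (pi / 1) ^ dim V)"
      using invariant_measures_exchange[of B' B "\<lambda>v. v" "\<lambda>v. v" "indicator A" ?g]
        orthonormal_basis_independent[OF B'] orthonormal_basis_independent[OF assms] orthonormal_basis_span[OF B'] orthonormal_basis_span[OF assms]
        nn_integral_gaussian_combination[OF B', of 1] nn_integral_gaussian_combination[OF assms, of 1]
      by simp
    then show "emeasure (combination_lborel B' (\<lambda>v. v)) A = emeasure (combination_lborel B (\<lambda>v. v)) A"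
      unfolding mult_right_ennreal_cancel by (auto dest: leD[rotated])
  qed simp
qed

lemma nn_integral_combination_lborel:
  fixes v :: "'i \<Rightarrow> 'a::euclidean_space"
  assumes [measurable]: "f \<in> borel_measurable borel"
  shows "(\<integral>\<^sup>+x. f x \<partial>combination_lborel I v) = (\<integral>\<^sup>+t. f (\<Sum>i\<in>I. t i *\<^sub>R v i) \<partial>PiM I (\<lambda>_. lborel))"
  unfolding combination_lborel_def by (subst nn_integral_distr) auto

lemma nn_integral_gaussian_subspace:
  assumes "subspace V" "a > 0"
  shows "(\<integral>\<^sup>+x. ennreal (exp (- a * (norm x)\<^sup>2)) \<partial>subspace_lborel V) = ennreal (sqrt (pi / a) ^ dim V)"
proof -
  obtain B where B: "orthonormal_basis B V" using orthonormal_basis_exists[OF assms(1)] by blast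
  show ?thesis
    unfolding subspace_lborel_eq_combination[OF B] by (rule nn_integral_gaussian_combination[OF B assms(2)])
qed

lemma subspace_lborel_UNIV: "subspace_lborel UNIV = (lborel :: 'a::euclidean_space measure)"
proof -
  have "orthonormal_basis Basis (UNIV :: 'a set)"
    by (simp add: orthonormal_basis_def pairwise_def orthogonal_def inner_not_same_Basis)
  then have "subspace_lborel UNIV = combination_lborel (Basis :: 'a set) (\<lambda>v. v)" by (rule subspace_lborel_eq_combination)
  then show ?thesis unfolding combination_lborel_def by (simp only: lborel_eq[where 'a='a])
qed

lemma subspace_in_borel: "subspace V \<Longrightarrow> V \<in> sets (borel :: 'a::euclidean_space measure)"
  by (intro borel_closed closed_subspace)

lemma AE_subspace_lborel_in:
  assumes "subspace V"
  shows "AE x in subspace_lborel V. x \<in> V"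
proof -
  obtain B where B: "orthonormal_basis B V" using orthonormal_basis_exists[OF assms] by blast
  have "(\<Sum>v\<in>B. x v *\<^sub>R v) \<in> V" for x
    using orthonormal_basis_span[OF B] by (intro subspace_sum[OF assms] subspace_scale[OF assms]) (auto intro: span_base)
  moreover have [measurable]: "V \<in> sets borel" using assms by (rule subspace_in_borel)
  ultimately show ?thesis
    unfolding subspace_lborel_eq_combination[OF B] combination_lborel_def by (subst AE_distr_iff) auto
qed

lemma subspace_lborel_translate:
  assumes "subspace V" "a \<in> V"
  shows "distr (subspace_lborel V) borel (\<lambda>x. a + x) = subspace_lborel V"
proof -
  obtain B where B: "orthonormal_basis B V" using orthonormal_basis_exists[OF assms(1)] by blast
  show ?thesis
    unfolding subspace_lborel_eq_combination[OF B]
    using orthonormal_basis_independent[OF B] orthonormal_basis_span[OF B] assms(2) by (intro combination_lborel_translate) auto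
qed

text \<open>
  A Gaussian has a finite integral and is bounded below on every ball.
\<close>

lemma sigma_finite_subspace_lborel:
  fixes V :: "'a::euclidean_space set"
  assumes "subspace V"
  shows "sigma_finite_measure (subspace_lborel V)"
proof
  let ?A = "range (\<lambda>n::nat. cball (0::'a) (real n))"
  have "emeasure (subspace_lborel V) (cball 0 (real n)) \<noteq> \<infinity>" for n
  proof -
    have "emeasure (subspace_lborel V) (cball 0 (real n)) = (\<integral>\<^sup>+x. indicator (cball 0 (real n)) x \<partial>subspace_lborel V)"
      by simp
    also have "\<dots> \<le> (\<integral>\<^sup>+x. ennreal (exp ((real n)\<^sup>2)) * ennreal (exp (- 1 * (norm x)\<^sup>2)) \<partial>subspace_lborel V)"
      by (intro nn_integral_mono)
         (auto simp: indicator_def simp flip: ennreal_mult exp_add intro!: power_mono)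
    also have "\<dots> = ennreal (exp ((real n)\<^sup>2)) * ennreal (sqrt (pi / 1) ^ dim V)"
      by (subst nn_integral_cmult) (use nn_integral_gaussian_subspace[OF assms, of 1] in auto)
    also have "\<dots> < \<infinity>" by (simp add: ennreal_mult_less_top)
    finally show ?thesis by simp
  qed
  moreover have "\<Union>?A = UNIV" by (auto intro: real_arch_simple)
  ultimately show "\<exists>A. countable A \<and> A \<subseteq> sets (subspace_lborel V) \<and> \<Union> A = space (subspace_lborel V) \<and> (\<forall>a\<in>A. emeasure (subspace_lborel V) a \<noteq> \<infinity>)"
  proof (intro exI[of _ ?A] conjI ballI)
    show "countable ?A" by (rule countable_image) simp
    show "?A \<subseteq> sets (subspace_lborel V)" by (intro image_subsetI) simp
  qed auto
qed

lemma emeasure_ball_subspace_finite: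
  fixes V :: "'a::euclidean_space set"
  assumes "subspace V"
  shows "emeasure (subspace_lborel V) (ball x r) < \<infinity>"
proof -
  obtain R where "\<forall>y\<in>ball x r. norm y \<le> R" using bounded_ball[of x r] unfolding bounded_iff by blast
  then have R: "ball x r \<subseteq> cball 0 R" by auto
  have "emeasure (subspace_lborel V) (ball x r) \<le> (\<integral>\<^sup>+x. indicator (cball 0 R) x \<partial>subspace_lborel V)"
    using R by (subst nn_integral_indicator) (auto intro!: emeasure_mono)
  also have "\<dots> \<le> (\<integral>\<^sup>+x. ennreal (exp (R\<^sup>2)) * ennreal (exp (- 1 * (norm x)\<^sup>2)) \<partial>subspace_lborel V)"
    by (intro nn_integral_mono)
       (auto simp: indicator_def simp flip: ennreal_mult exp_add intro!: power_mono)
  also have "\<dots> = ennreal (exp (R\<^sup>2)) * ennreal (sqrt (pi / 1) ^ dim V)"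
    by (subst nn_integral_cmult) (use nn_integral_gaussian_subspace[OF assms, of 1] in auto)
  also have "\<dots> < \<infinity>" by (simp add: ennreal_mult_less_top)
  finally show ?thesis .
qed

lemma orthonormal_basis_union:
  assumes B1: "orthonormal_basis B1 V1" and B2: "orthonormal_basis B2 V2"
    and orth: "\<And>x y. x \<in> V1 \<Longrightarrow> y \<in> V2 \<Longrightarrow> x \<bullet> y = 0"
  shows "orthonormal_basis (B1 \<union> B2) {x + y |x y. x \<in> V1 \<and> y \<in> V2}" "B1 \<inter> B2 = {}"
proof -
  have sub: "B1 \<subseteq> V1" "B2 \<subseteq> V2" using orthonormal_basis_span[OF B1] orthonormal_basis_span[OF B2] span_superset by auto
  have o: "x \<bullet> y = 0" "y \<bullet> x = 0" if "x \<in> B1" "y \<in> B2" for x y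
    using orth[of x y] sub that by (auto simp: inner_commute)
  have "span (B1 \<union> B2) = {x + y |x y. x \<in> V1 \<and> y \<in> V2}"
    unfolding span_Un using orthonormal_basis_span[OF B1] orthonormal_basis_span[OF B2] by auto
  then show "orthonormal_basis (B1 \<union> B2) {x + y |x y. x \<in> V1 \<and> y \<in> V2}"
    using B1 B2 o unfolding orthonormal_basis_def pairwise_def orthogonal_def by auto
  show "B1 \<inter> B2 = {}"
  proof -
    have "x \<notin> B2" if "x \<in> B1" for x
      using o(1)[OF that] B1 that unfolding orthonormal_basis_def by (metis inner_eq_zero_iff norm_zero zero_neq_one)
    then show ?thesis by blast
  qed
qed

text \<open>
  The union of orthonormal bases of two orthogonal subspaces is one of their sum, so this is
  Fubini's theorem in coordinates.
\<close>

lemma nn_integral_subspace_split: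
  fixes V1 V2 :: "'a::euclidean_space set"
  assumes V: "subspace V1" "subspace V2"
    and orth: "\<And>x y. x \<in> V1 \<Longrightarrow> y \<in> V2 \<Longrightarrow> x \<bullet> y = 0"
    and [measurable]: "f \<in> borel_measurable borel"
  shows "(\<integral>\<^sup>+x. f x \<partial>subspace_lborel {x + y |x y. x \<in> V1 \<and> y \<in> V2})
       = (\<integral>\<^sup>+x. \<integral>\<^sup>+y. f (x + y) \<partial>subspace_lborel V2 \<partial>subspace_lborel V1)"
proof -
  obtain B1 B2 where B: "orthonormal_basis B1 V1" "orthonormal_basis B2 V2" using orthonormal_basis_exists V by blast
  note U = orthonormal_basis_union[OF B orth, simplified]
  have fin: "finite B1" "finite B2" using orthonormal_basis_independent B by auto
  interpret product_sigma_finite "\<lambda>_::'a. lborel :: real measure"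
    by (rule lborel_product_sigma_finite)
  interpret F2: sigma_finite_measure "PiM B2 (\<lambda>_. lborel :: real measure)"
    by (rule sigma_finite[OF fin(2)])
  have "(\<integral>\<^sup>+x. f x \<partial>subspace_lborel {x + y |x y. x \<in> V1 \<and> y \<in> V2})
      = (\<integral>\<^sup>+t. f (\<Sum>v\<in>B1 \<union> B2. t v *\<^sub>R v) \<partial>PiM (B1 \<union> B2) (\<lambda>_. lborel))"
    using U by (simp add: subspace_lborel_eq_combination nn_integral_combination_lborel)
  also have "\<dots> = (\<integral>\<^sup>+s. \<integral>\<^sup>+t. f (\<Sum>v\<in>B1 \<union> B2. merge B1 B2 (s, t) v *\<^sub>R v) \<partial>PiM B2 (\<lambda>_. lborel) \<partial>PiM B1 (\<lambda>_. lborel))"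
    using U fin by (subst product_nn_integral_fold) auto
  also have "\<dots> = (\<integral>\<^sup>+s. \<integral>\<^sup>+t. f ((\<Sum>v\<in>B1. s v *\<^sub>R v) + (\<Sum>v\<in>B2. t v *\<^sub>R v)) \<partial>PiM B2 (\<lambda>_. lborel) \<partial>PiM B1 (\<lambda>_. lborel))"
  proof (intro nn_integral_cong)
    fix s t
    have "(\<Sum>v\<in>B1 \<union> B2. merge B1 B2 (s, t) v *\<^sub>R v) = (\<Sum>v\<in>B1. merge B1 B2 (s, t) v *\<^sub>R v) + (\<Sum>v\<in>B2. merge B1 B2 (s, t) v *\<^sub>R v)"
      using U fin by (intro sum.union_disjoint) auto
    also have "\<dots> = (\<Sum>v\<in>B1. s v *\<^sub>R v) + (\<Sum>v\<in>B2. t v *\<^sub>R v)"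
      using U by (intro arg_cong2[of _ _ _ _ "(+)"] sum.cong) (auto simp: merge_def)
    finally show "f (\<Sum>v\<in>B1 \<union> B2. merge B1 B2 (s, t) v *\<^sub>R v) = f ((\<Sum>v\<in>B1. s v *\<^sub>R v) + (\<Sum>v\<in>B2. t v *\<^sub>R v))" by simp
  qed
  also have "\<dots> = (\<integral>\<^sup>+s. (\<integral>\<^sup>+y. f ((\<Sum>v\<in>B1. s v *\<^sub>R v) + y) \<partial>subspace_lborel V2) \<partial>PiM B1 (\<lambda>_. lborel))"
    by (simp add: subspace_lborel_eq_combination[OF B(2)] nn_integral_combination_lborel)
  also have "\<dots> = (\<integral>\<^sup>+x. \<integral>\<^sup>+y. f (x + y) \<partial>subspace_lborel V2 \<partial>subspace_lborel V1)"
  proof -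
    interpret S: sigma_finite_measure "subspace_lborel V2" by (rule sigma_finite_subspace_lborel[OF V(2)])
    have "(\<lambda>x. \<integral>\<^sup>+y. f (x + y) \<partial>subspace_lborel V2) \<in> borel_measurable borel"
      by measurable
    then show ?thesis by (simp add: subspace_lborel_eq_combination[OF B(1)] nn_integral_combination_lborel)
  qed
  finally show ?thesis .
qed

lemma subspace_lborel_line:
  fixes u :: "'a::euclidean_space"
  assumes "norm u = 1"
  shows "subspace_lborel (span {u}) = distr lborel borel (\<lambda>s. s *\<^sub>R u)"
proof -
  interpret product_sigma_finite "\<lambda>_::'a. lborel :: real measure"
    by (rule lborel_product_sigma_finite)
  have "orthonormal_basis {u} (span {u})" using assms by (auto simp: orthonormal_basis_def)
  then have "subspace_lborel (span {u}) = combination_lborel {u} (\<lambda>v. v)" by (rule subspace_lborel_eq_combination)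
  also have "\<dots> = distr lborel borel (\<lambda>s. s *\<^sub>R u)"
  proof (rule measure_eqI)
    fix A assume "A \<in> sets (combination_lborel {u} (\<lambda>v. v))"
    then have [measurable]: "A \<in> sets borel" by simp
    have "emeasure (combination_lborel {u} (\<lambda>v. v)) A = (\<integral>\<^sup>+x. indicator A x \<partial>combination_lborel {u} (\<lambda>v. v))"
      by simp
    also have "\<dots> = (\<integral>\<^sup>+t. indicator A (t u *\<^sub>R u) \<partial>PiM {u} (\<lambda>_. lborel))"
      by (subst nn_integral_combination_lborel) auto
    also have "\<dots> = (\<integral>\<^sup>+t. indicator A (t *\<^sub>R u) \<partial>lborel)"
      by (rule product_nn_integral_singleton) measurable
    also have "\<dots> = emeasure (distr lborel borel (\<lambda>s. s *\<^sub>R u)) A"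
      by (subst nn_integral_distr[symmetric, where M'=borel and f="indicator A"]) auto
    finally show "emeasure (combination_lborel {u} (\<lambda>v. v)) A = emeasure (distr lborel borel (\<lambda>s. s *\<^sub>R u)) A" .
  qed simp
  finally show ?thesis .
qed

lemma subspace_orthogonal_line:
  assumes "subspace V" "norm u = 1" "u \<in> V"
  shows "V = {x + y |x y. x \<in> span {u} \<and> y \<in> {y\<in>V. y \<bullet> u = 0}}"
proof (intro set_eqI iffI)
  fix x assume "x \<in> V"
  have uu: "u \<bullet> u = 1" using assms(2) by (simp add: dot_square_norm)
  have "x - (x \<bullet> u) *\<^sub>R u \<in> {y\<in>V. y \<bullet> u = 0}"
    using \<open>x \<in> V\<close> assms uu by (auto simp: inner_diff_left subspace_diff subspace_scale)
  moreover have "(x \<bullet> u) *\<^sub>R u \<in> span {u}" by (auto simp: span_singleton)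
  ultimately show "x \<in> {x + y |x y. x \<in> span {u} \<and> y \<in> {y\<in>V. y \<bullet> u = 0}}"
    by (smt (verit) add.commute diff_add_cancel mem_Collect_eq)
qed (use assms in \<open>auto simp: span_singleton subspace_add subspace_scale\<close>)

lemma subspace_orthogonal_part:
  "subspace V \<Longrightarrow> subspace {y\<in>V. y \<bullet> u = 0}"
  by (auto simp: subspace_def inner_add_left)

lemma subspace_lborel_split_line:
  fixes u :: "'a::euclidean_space"
  assumes "subspace V" "norm u = 1" "u \<in> V"
  shows "subspace_lborel V = distr (lborel \<Otimes>\<^sub>M subspace_lborel {y\<in>V. y \<bullet> u = 0}) borel (\<lambda>(s, y). s *\<^sub>R u + y)"
proof (rule measure_eqI)
  let ?W = "{y\<in>V. y \<bullet> u = 0}"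
  have W: "subspace ?W" by (rule subspace_orthogonal_part[OF assms(1)])
  interpret S: sigma_finite_measure "subspace_lborel ?W" by (rule sigma_finite_subspace_lborel[OF W])
  fix A assume "A \<in> sets (subspace_lborel V)"
  then have [measurable]: "A \<in> sets borel" by simp
  have "emeasure (subspace_lborel V) A = (\<integral>\<^sup>+x. indicator A x \<partial>subspace_lborel {x + y |x y. x \<in> span {u} \<and> y \<in> ?W})"
    using subspace_orthogonal_line[OF assms] by simp
  also have "\<dots> = (\<integral>\<^sup>+x. \<integral>\<^sup>+y. indicator A (x + y) \<partial>subspace_lborel ?W \<partial>subspace_lborel (span {u}))"
  proof (rule nn_integral_subspace_split)
    show "x \<bullet> y = 0" if "x \<in> span {u}" "y \<in> ?W" for x y
      using that by (auto simp: span_singleton inner_commute)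
  qed (use W in auto)
  also have "\<dots> = (\<integral>\<^sup>+s. \<integral>\<^sup>+y. indicator A (s *\<^sub>R u + y) \<partial>subspace_lborel ?W \<partial>lborel)"
    unfolding subspace_lborel_line[OF assms(2)] by (subst nn_integral_distr) measurable
  also have "\<dots> = (\<integral>\<^sup>+p. indicator A ((\<lambda>(s, y). s *\<^sub>R u + y) p) \<partial>(lborel \<Otimes>\<^sub>M subspace_lborel ?W))"
    by (subst S.nn_integral_fst[symmetric]) auto
  also have "\<dots> = emeasure (distr (lborel \<Otimes>\<^sub>M subspace_lborel ?W) borel (\<lambda>(s, y). s *\<^sub>R u + y)) A"
    by (subst nn_integral_distr[symmetric, where M'=borel and f="indicator A"]) auto
  finally show "emeasure (subspace_lborel V) A = emeasure (distr (lborel \<Otimes>\<^sub>M subspace_lborel ?W) borel (\<lambda>(s, y). s *\<^sub>R u + y)) A" .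
qed simp

lemma nn_integral_subspace_line:
  fixes u :: "'a::euclidean_space"
  assumes "subspace V" "norm u = 1" "u \<in> V" and [measurable]: "f \<in> borel_measurable borel"
  shows "(\<integral>\<^sup>+x. f x \<partial>subspace_lborel V)
    = (\<integral>\<^sup>+s. \<integral>\<^sup>+y. f (s *\<^sub>R u + y) \<partial>subspace_lborel {y\<in>V. y \<bullet> u = 0} \<partial>lborel)"
proof -
  interpret S: sigma_finite_measure "subspace_lborel {y\<in>V. y \<bullet> u = 0}"
    by (intro sigma_finite_subspace_lborel subspace_orthogonal_part assms)
  show ?thesis
    by (subst subspace_lborel_split_line[OF assms(1-3)], subst nn_integral_distr)
       (auto simp: S.nn_integral_fst[symmetric])
qed

lemma dim_subspace_orthogonal_part:
  fixes u :: "'a::euclidean_space"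
  assumes "subspace V" "norm u = 1" "u \<in> V"
  shows "dim V = Suc (dim {y\<in>V. y \<bullet> u = 0})"
proof -
  let ?W = "{y\<in>V. y \<bullet> u = 0}"
  obtain B where B: "orthonormal_basis B ?W" using orthonormal_basis_exists[OF subspace_orthogonal_part[OF assms(1)]] by blast
  have u: "orthonormal_basis {u} (span {u})" using assms by (auto simp: orthonormal_basis_def)
  have o: "x \<bullet> y = 0" if "x \<in> span {u}" "y \<in> ?W" for x y
    using that by (auto simp: span_singleton inner_commute)
  have "orthonormal_basis ({u} \<union> B) V" "{u} \<inter> B = {}"
    using orthonormal_basis_union[OF u B o] subspace_orthogonal_line[OF assms] by simp_all
  then show ?thesis using orthonormal_basis_independent(2,3) B by (metis card_insert_disjoint disjoint_insert(1) finite_insert inf_bot_left inf_commute insert_is_Un)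
qed

text \<open>
  The dilated basis spans the same subspace, so the dilated measure is proportional to the
  original one; the integrals of a Gaussian give the factor.
\<close>

lemma nn_integral_subspace_scale:
  fixes V :: "'a::euclidean_space set"
  assumes V: "subspace V" and c: "c > 0" and [measurable]: "f \<in> borel_measurable borel"
  shows "(\<integral>\<^sup>+x. f x \<partial>subspace_lborel V) = ennreal (c ^ dim V) * (\<integral>\<^sup>+x. f (c *\<^sub>R x) \<partial>subspace_lborel V)"
proof -
  obtain B where B: "orthonormal_basis B V" using orthonormal_basis_exists[OF V] by blast
  have fin: "finite B" using orthonormal_basis_independent[OF B] by auto
  let ?v = "\<lambda>v. c *\<^sub>R v"
  have sp: "span ((\<lambda>v. v) ` B) = span (?v ` B)"
    using c by (simp add: span_image_scale fin)
  have *: "(\<integral>\<^sup>+x. h x \<partial>combination_lborel B ?v) = (\<integral>\<^sup>+x. h (c *\<^sub>R x) \<partial>subspace_lborel V)"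
    if "h \<in> borel_measurable borel" for h
    using that by (simp add: subspace_lborel_eq_combination[OF B] nn_integral_combination_lborel scaleR_sum_right ac_simps)
  let ?g = "\<lambda>x::'a. ennreal (exp (- 1 * (norm x)\<^sup>2))"
  have "(\<integral>\<^sup>+x. f x \<partial>subspace_lborel V) * (\<integral>\<^sup>+x. ?g x \<partial>combination_lborel B ?v)
     = (\<integral>\<^sup>+x. f x \<partial>combination_lborel B ?v) * (\<integral>\<^sup>+x. ?g x \<partial>subspace_lborel V)"
    using invariant_measures_exchange[OF fin fin sp, of f ?g]
    by (simp add: subspace_lborel_eq_combination[OF B])
  also have "(\<integral>\<^sup>+x. ?g x \<partial>combination_lborel B ?v) = (\<integral>\<^sup>+x. ennreal (exp (- (c\<^sup>2) * (norm x)\<^sup>2)) \<partial>subspace_lborel V)"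
    by (subst *) (auto simp: power_mult_distrib)
  also have "\<dots> = ennreal (sqrt (pi / c\<^sup>2) ^ dim V)"
    by (rule nn_integral_gaussian_subspace[OF V]) (use c in auto)
  also have "(\<integral>\<^sup>+x. ?g x \<partial>subspace_lborel V) = ennreal (sqrt (pi / c\<^sup>2) ^ dim V) * ennreal (c ^ dim V)"
    using nn_integral_gaussian_subspace[OF V, of 1] c
    by (simp add: real_sqrt_divide power_divide flip: ennreal_mult)
  finally have "(\<integral>\<^sup>+x. f x \<partial>subspace_lborel V) * ennreal (sqrt (pi / c\<^sup>2) ^ dim V)
     = (ennreal (c ^ dim V) * (\<integral>\<^sup>+x. f (c *\<^sub>R x) \<partial>subspace_lborel V)) * ennreal (sqrt (pi / c\<^sup>2) ^ dim V)"
    by (simp add: * ac_simps)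
  moreover have "\<not> sqrt (pi / c\<^sup>2) ^ dim V \<le> 0" using c by (simp add: not_le)
  ultimately show ?thesis unfolding mult_right_ennreal_cancel by blast
qed

text \<open>
  Two measures on a subspace that are invariant under its translations have the same null
  sets; this replaces a linear change of variables to an orthonormal basis.
\<close>

lemma combination_null_iff:
  fixes v :: "'i \<Rightarrow> 'a::euclidean_space"
  assumes fin: "finite I" and [measurable]: "A \<in> sets borel"
  shows "emeasure (combination_lborel I v) A = 0 \<longleftrightarrow> emeasure (subspace_lborel (span (v ` I))) A = 0"
proof -
  obtain B where B: "orthonormal_basis B (span (v ` I))" using orthonormal_basis_exists[OF subspace_span] by blast
  interpret product_sigma_finite "\<lambda>_::'i. lborel :: real measure"
    by (rule lborel_product_sigma_finite)
  have finB: "finite B" using orthonormal_basis_independent[OF B] by auto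
  let ?g = "\<lambda>x::'a. ennreal (exp (- 1 * (norm x)\<^sup>2))"
  let ?c = "sqrt (pi / 1) ^ dim (span (v ` I))"
  have eq: "emeasure (combination_lborel I v) A * ennreal ?c
      = emeasure (subspace_lborel (span (v ` I))) A * (\<integral>\<^sup>+x. ?g x \<partial>combination_lborel I v)"
    using invariant_measures_exchange[OF fin finB, of v "\<lambda>v. v" "indicator A" ?g]
      orthonormal_basis_span[OF B] nn_integral_gaussian_combination[OF B, of 1]
    by (simp add: subspace_lborel_eq_combination[OF B])
  have "(\<integral>\<^sup>+x. ?g x \<partial>combination_lborel I v) \<noteq> 0"
  proof
    assume "(\<integral>\<^sup>+x. ?g x \<partial>combination_lborel I v) = 0"
    then have "AE x in combination_lborel I v. ?g x = 0" by (subst (asm) nn_integral_0_iff_AE) auto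
    then have "AE x in combination_lborel I v. False" by simp
    then have "emeasure (combination_lborel I v) UNIV = 0" by (simp add: AE_iff_null null_sets_def)
    then have "emeasure (PiM I (\<lambda>_. lborel :: real measure)) (Pi\<^sub>E I (\<lambda>_. UNIV)) = 0"
      by (simp add: combination_lborel_def emeasure_distr space_PiM)
    then show False by (subst (asm) emeasure_PiM) (auto simp: fin)
  qed
  moreover have "ennreal ?c \<noteq> 0" by simp
  ultimately show ?thesis
    using eq arg_cong[OF eq, of "\<lambda>t. t = 0"] unfolding mult_eq_0_iff by blast
qed

section \<open>Radial integrals over subspaces\<close>

lemma subspace_dim_0:
  fixes V :: "'a::euclidean_space set"
  shows "subspace V \<Longrightarrow> dim V = 0 \<Longrightarrow> V = {0}"
  using subspace_0[of V] by auto

lemma subspace_unit_exists: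
  fixes V :: "'a::euclidean_space set"
  assumes "subspace V" "dim V > 0"
  obtains u where "u \<in> V" "norm u = 1"
proof -
  have "\<not> V \<subseteq> {0}" using assms(2) dim_eq_0[of V] by linarith
  then obtain x where "x \<in> V" "x \<noteq> 0" by auto
  then have "(1 / norm x) *\<^sub>R x \<in> V" "norm ((1 / norm x) *\<^sub>R x) = 1"
    using assms(1) by (auto intro: subspace_scale)
  then show ?thesis using that by blast
qed

text \<open>
  By induction on the dimension: when a line is split off, the integrand becomes a radial
  function of the remaining variable, for each fixed coordinate on the line.
\<close>

lemma nn_integral_radial_dim:
  fixes V W :: "'a::euclidean_space set"
  assumes "subspace V" "subspace W" "dim V = dim W" and "\<phi> \<in> borel_measurable borel"
  shows "(\<integral>\<^sup>+x. \<phi> (norm x) \<partial>subspace_lborel V) = (\<integral>\<^sup>+x. \<phi> (norm x) \<partial>subspace_lborel W)"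
  using assms
proof (induction "dim V" arbitrary: V W \<phi>)
  case 0
  then have "V = W" using subspace_dim_0 by metis
  then show ?case by simp
next
  case (Suc m)
  note [measurable] = \<open>\<phi> \<in> borel_measurable borel\<close>
  obtain u where u: "u \<in> V" "norm u = 1" using subspace_unit_exists[of V] Suc by auto
  obtain v where v: "v \<in> W" "norm v = 1" using subspace_unit_exists[of W] Suc by auto
  let ?V = "{y\<in>V. y \<bullet> u = 0}" and ?W = "{y\<in>W. y \<bullet> v = 0}"
  have sub: "subspace ?V" "subspace ?W" using Suc.prems by (auto intro: subspace_orthogonal_part)
  have dims: "m = dim ?V" "dim ?V = dim ?W"
    using dim_subspace_orthogonal_part[OF Suc.prems(1) u(2,1)] dim_subspace_orthogonal_part[OF Suc.prems(2) v(2,1)]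
      Suc.hyps(2) Suc.prems(3) by auto
  have n: "norm (s *\<^sub>R w + y) = sqrt (s\<^sup>2 + (norm y)\<^sup>2)" if "norm w = 1" "y \<bullet> w = 0" for s and w y :: 'a
  proof -
    have "(norm (s *\<^sub>R w + y))\<^sup>2 = (norm (s *\<^sub>R w))\<^sup>2 + (norm y)\<^sup>2"
      by (rule norm_add_Pythagorean) (use that in \<open>auto simp: orthogonal_def inner_commute\<close>)
    then show ?thesis using that by (simp add: real_sqrt_unique)
  qed
  have *: "(\<integral>\<^sup>+x. \<phi> (norm x) \<partial>subspace_lborel X) = (\<integral>\<^sup>+s. \<integral>\<^sup>+y. \<phi> (sqrt (s\<^sup>2 + (norm y)\<^sup>2)) \<partial>subspace_lborel {y\<in>X. y \<bullet> w = 0} \<partial>lborel)"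
    if X: "subspace X" "norm w = 1" "w \<in> X" for X and w :: 'a
  proof (subst nn_integral_subspace_line[OF X])
    have "AE y in subspace_lborel {y\<in>X. y \<bullet> w = 0}. y \<in> {y\<in>X. y \<bullet> w = 0}"
      by (intro AE_subspace_lborel_in subspace_orthogonal_part X)
    then show "(\<integral>\<^sup>+s. \<integral>\<^sup>+y. \<phi> (norm (s *\<^sub>R w + y)) \<partial>subspace_lborel {y\<in>X. y \<bullet> w = 0} \<partial>lborel)
      = (\<integral>\<^sup>+s. \<integral>\<^sup>+y. \<phi> (sqrt (s\<^sup>2 + (norm y)\<^sup>2)) \<partial>subspace_lborel {y\<in>X. y \<bullet> w = 0} \<partial>lborel)"
      by (intro nn_integral_cong nn_integral_cong_AE) (auto simp: n[OF X(2)])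
  qed measurable
  show ?case unfolding *[OF Suc.prems(1) u(2,1)] *[OF Suc.prems(2) v(2,1)]
    by (intro nn_integral_cong Suc.hyps(1)[OF dims(1) sub dims(2)]) measurable
qed

lemma nn_integral_powr_exp:
  assumes "\<beta> > 0" "c > 0"
  shows "(\<integral>\<^sup>+s. indicator {0<..} s * ennreal (s powr (\<beta> - 1) * exp (- c * s)) \<partial>lborel) = ennreal (Gamma \<beta> * c powr (- \<beta>))"
proof -
  have "ennreal (Gamma \<beta>) = (\<integral>\<^sup>+t. ennreal (indicator {0..} t * t powr (\<beta> - 1) / exp t) \<partial>lborel)"
    by (rule Gamma_conv_nn_integral_real[OF assms(1)])
  also have "\<dots> = ennreal c * (\<integral>\<^sup>+s. ennreal (indicator {0..} (c * s) * (c * s) powr (\<beta> - 1) / exp (c * s)) \<partial>lborel)"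
    by (subst nn_integral_real_affine[of _ c 0]) (use assms in auto)
  also have "\<dots> = ennreal c * (\<integral>\<^sup>+s. ennreal (c powr (\<beta> - 1)) * (indicator {0<..} s * ennreal (s powr (\<beta> - 1) * exp (- c * s))) \<partial>lborel)"
  proof (rule arg_cong[of _ _ "\<lambda>t. ennreal c * t"], rule nn_integral_cong)
    fix s :: real
    show "ennreal (indicator {0..} (c * s) * (c * s) powr (\<beta> - 1) / exp (c * s))
      = ennreal (c powr (\<beta> - 1)) * (indicator {0<..} s * ennreal (s powr (\<beta> - 1) * exp (- c * s)))"
    proof (cases "s > 0")
      case True
      then show ?thesis using assms
        by (simp add: powr_mult exp_minus field_simps zero_le_mult_iff flip: ennreal_mult)
    next
      case False
      then show ?thesis using assms by (cases "s = 0") (auto simp: indicator_def zero_le_mult_iff)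
    qed
  qed
  also have "\<dots> = ennreal (c powr \<beta>) * (\<integral>\<^sup>+s. indicator {0<..} s * ennreal (s powr (\<beta> - 1) * exp (- c * s)) \<partial>lborel)"
    using assms by (subst nn_integral_cmult)
      (auto simp: mult.assoc[symmetric] powr_diff simp flip: ennreal_mult)
  finally have "ennreal (Gamma \<beta>) * ennreal (c powr (- \<beta>))
     = (ennreal (c powr (-\<beta>)) * ennreal (c powr \<beta>)) * (\<integral>\<^sup>+s. indicator {0<..} s * ennreal (s powr (\<beta> - 1) * exp (- c * s)) \<partial>lborel)"
    by (simp add: ac_simps)
  moreover have "ennreal (c powr (-\<beta>)) * ennreal (c powr \<beta>) = 1"
    using assms by (simp add: powr_minus flip: ennreal_mult)
  ultimately show ?thesis using assms by (simp add: ennreal_mult Gamma_real_nonneg)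
qed

text \<open>
  The Gamma integral represents \<open>(A + |x|\<^sup>2) powr (- \<beta>)\<close> as a mixture of the Gaussians
  \<open>exp (- s |x|\<^sup>2)\<close>, whose integrals are \<open>(pi / s) powr (dim V / 2)\<close>.  Whether the remaining
  integral over \<open>s\<close> converges at 0 is decided by comparing \<open>\<beta>\<close> with \<open>dim V / 2\<close>.
\<close>

lemma nn_integral_inverse_power_mixture:
  fixes V :: "'a::euclidean_space set"
  assumes V: "subspace V" and A: "A > 0" and b: "\<beta> > 0"
  shows "ennreal (Gamma \<beta>) * (\<integral>\<^sup>+x. ennreal ((A + (norm x)\<^sup>2) powr (- \<beta>)) \<partial>subspace_lborel V)
    = (\<integral>\<^sup>+s. indicator {0<..} s * ennreal (sqrt pi ^ dim V * (s powr (\<beta> - dim V / 2 - 1) * exp (- A * s))) \<partial>lborel)"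
proof -
  interpret S: sigma_finite_measure "subspace_lborel V" by (rule sigma_finite_subspace_lborel[OF V])
  interpret PQ: pair_sigma_finite lborel "subspace_lborel V" by standard
  have "ennreal (Gamma \<beta>) * (\<integral>\<^sup>+x. ennreal ((A + (norm x)\<^sup>2) powr (- \<beta>)) \<partial>subspace_lborel V)
     = (\<integral>\<^sup>+x. ennreal (Gamma \<beta> * (A + (norm x)\<^sup>2) powr (- \<beta>)) \<partial>subspace_lborel V)"
    by (subst nn_integral_cmult[symmetric]) (auto simp: ennreal_mult' Gamma_real_nonneg b less_imp_le)
  also have "\<dots> = (\<integral>\<^sup>+x. \<integral>\<^sup>+s. indicator {0<..} s * ennreal (s powr (\<beta> - 1) * exp (- (A + (norm x)\<^sup>2) * s)) \<partial>lborel \<partial>subspace_lborel V)"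
  proof (rule nn_integral_cong)
    fix x :: 'a
    have "A + (norm x)\<^sup>2 > 0" using A by (simp add: add_pos_nonneg)
    from nn_integral_powr_exp[OF b this]
    show "ennreal (Gamma \<beta> * (A + (norm x)\<^sup>2) powr (- \<beta>)) = (\<integral>\<^sup>+s. indicator {0<..} s * ennreal (s powr (\<beta> - 1) * exp (- (A + (norm x)\<^sup>2) * s)) \<partial>lborel)"
      by simp
  qed
  also have "\<dots> = (\<integral>\<^sup>+s. \<integral>\<^sup>+x. indicator {0<..} s * ennreal (s powr (\<beta> - 1) * exp (- (A + (norm x)\<^sup>2) * s)) \<partial>subspace_lborel V \<partial>lborel)"
    by (rule PQ.Fubini') measurable
  also have "\<dots> = (\<integral>\<^sup>+s. indicator {0<..} s * ennreal (sqrt pi ^ dim V * (s powr (\<beta> - dim V / 2 - 1) * exp (- A * s))) \<partial>lborel)"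
  proof (rule nn_integral_cong)
    fix s :: real
    show "(\<integral>\<^sup>+x. indicator {0<..} s * ennreal (s powr (\<beta> - 1) * exp (- (A + (norm x)\<^sup>2) * s)) \<partial>subspace_lborel V)
      = indicator {0<..} s * ennreal (sqrt pi ^ dim V * (s powr (\<beta> - dim V / 2 - 1) * exp (- A * s)))"
    proof (cases "s > 0")
      case True
      have "(\<integral>\<^sup>+x. indicator {0<..} s * ennreal (s powr (\<beta> - 1) * exp (- (A + (norm x)\<^sup>2) * s)) \<partial>subspace_lborel V)
        = (\<integral>\<^sup>+x. ennreal (s powr (\<beta> - 1) * exp (- A * s)) * ennreal (exp (- s * (norm x)\<^sup>2)) \<partial>subspace_lborel V)"
        using True by (intro nn_integral_cong) (simp add: algebra_simps flip: ennreal_mult exp_add)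
      also have "\<dots> = ennreal (s powr (\<beta> - 1) * exp (- A * s)) * ennreal (sqrt (pi / s) ^ dim V)"
        by (subst nn_integral_cmult) (use nn_integral_gaussian_subspace[OF V True] in auto)
      also have "\<dots> = ennreal (s powr (\<beta> - 1) * exp (- A * s) * sqrt (pi / s) ^ dim V)"
        using True by (simp add: ennreal_mult)
      also have "sqrt (pi / s) ^ dim V = sqrt pi ^ dim V * s powr (- (dim V / 2))"
      proof -
        have "sqrt s ^ dim V = s powr (dim V / 2)"
        proof -
          have "sqrt s ^ dim V = (s powr (1 / 2)) powr dim V"
            using True by (subst powr_realpow) (auto simp: powr_half_sqrt)
          then show ?thesis by (simp add: powr_powr)
        qed
        then have "sqrt (pi / s) ^ dim V = sqrt pi ^ dim V / s powr (dim V / 2)"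
          by (simp only: real_sqrt_divide power_divide)
        then show ?thesis by (simp only: powr_minus divide_inverse[of "sqrt pi ^ dim V"])
      qed
      also have "s powr (\<beta> - 1) * exp (- A * s) * (sqrt pi ^ dim V * s powr (- (dim V / 2)))
         = sqrt pi ^ dim V * ((s powr (\<beta> - 1) * s powr (- (dim V / 2))) * exp (- A * s))"
        by simp
      also have "s powr (\<beta> - 1) * s powr (- (dim V / 2)) = s powr (\<beta> - dim V / 2 - 1)"
        unfolding powr_add[symmetric] by (rule arg_cong[of _ _ "\<lambda>t. s powr t"]) simp
      finally show ?thesis using True by simp
    qed simp
  qed
  finally show ?thesis .
qed

lemma nn_integral_inverse_power_finite:
  fixes V :: "'a::euclidean_space set"
  assumes V: "subspace V" and A: "A > 0" and b: "\<beta> > dim V / 2"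
  shows "(\<integral>\<^sup>+x. ennreal ((A + (norm x)\<^sup>2) powr (- \<beta>)) \<partial>subspace_lborel V) < \<infinity>"
proof -
  have b0: "\<beta> > 0" using b by (smt (verit) divide_nonneg_nonneg of_nat_0_le_iff)
  have "ennreal (Gamma \<beta>) * (\<integral>\<^sup>+x. ennreal ((A + (norm x)\<^sup>2) powr (- \<beta>)) \<partial>subspace_lborel V)
    = (\<integral>\<^sup>+s. ennreal (sqrt pi ^ dim V) * (indicator {0<..} s * ennreal (s powr (\<beta> - dim V / 2 - 1) * exp (- A * s))) \<partial>lborel)"
    unfolding nn_integral_inverse_power_mixture[OF V A b0]
    by (intro nn_integral_cong) (simp add: ennreal_mult ac_simps)
  also have "\<dots> = ennreal (sqrt pi ^ dim V) * ennreal (Gamma (\<beta> - dim V / 2) * A powr (- (\<beta> - dim V / 2)))"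
    by (subst nn_integral_cmult) (use nn_integral_powr_exp[of "\<beta> - dim V / 2" A] b A in auto)
  also have "\<dots> < \<infinity>" by (simp add: ennreal_mult_less_top)
  finally have "ennreal (Gamma \<beta>) * (\<integral>\<^sup>+x. ennreal ((A + (norm x)\<^sup>2) powr (- \<beta>)) \<partial>subspace_lborel V) < \<infinity>" .
  then show ?thesis using Gamma_real_pos[OF b0] by (auto simp: ennreal_mult_less_top less_top[symmetric] ennreal_mult_eq_top_iff)
qed

text \<open>
  In the critical case the integrand in the mixture is \<open>1 / s\<close> near 0.
\<close>

lemma nn_integral_inverse_power_infinite:
  fixes V :: "'a::euclidean_space set"
  assumes V: "subspace V" and A: "A > 0" and d: "dim V > 0"
  shows "(\<integral>\<^sup>+x. ennreal ((A + (norm x)\<^sup>2) powr (- (dim V / 2))) \<partial>subspace_lborel V) = \<infinity>"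
proof -
  let ?b = "dim V / 2"
  let ?c = "sqrt pi ^ dim V * exp (- A)"
  have c: "?c > 0" by simp
  have b0: "?b > 0" using d by simp
  have ge: "ennreal (?c * real n) \<le> ennreal (Gamma ?b) * (\<integral>\<^sup>+x. ennreal ((A + (norm x)\<^sup>2) powr (- ?b)) \<partial>subspace_lborel V)" for n
  proof -
    let ?e = "exp (- real n)"
    have "ennreal (real n) = (\<integral>\<^sup>+s. ennreal (inverse s) * indicator {?e..1} s \<partial>lborel)"
    proof -
      have pos: "s > 0" if "s \<in> {?e..1}" for s using that exp_gt_zero[of "- real n"] by (meson atLeastAtMost_iff less_le_trans)
      have "DERIV ln s :> inverse s" if "s \<in> {?e..1}" for s using DERIV_ln[OF pos[OF that]] .
      moreover have "0 \<le> inverse s" if "s \<in> {?e..1}" for s using pos[OF that] by simp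
      ultimately show ?thesis using nn_integral_FTC_Icc[of inverse ?e 1 ln] by simp
    qed
    then have "ennreal (?c * real n) = (\<integral>\<^sup>+s. ennreal ?c * (ennreal (inverse s) * indicator {?e..1} s) \<partial>lborel)"
      using c by (subst nn_integral_cmult) (auto simp: ennreal_mult)
    also have "\<dots> \<le> (\<integral>\<^sup>+s. indicator {0<..} s * ennreal (sqrt pi ^ dim V * (s powr (?b - dim V / 2 - 1) * exp (- A * s))) \<partial>lborel)"
    proof (rule nn_integral_mono)
      fix s :: real
      show "ennreal ?c * (ennreal (inverse s) * indicator {?e..1} s) \<le> indicator {0<..} s * ennreal (sqrt pi ^ dim V * (s powr (?b - dim V / 2 - 1) * exp (- A * s)))"
      proof (cases "s \<in> {?e..1}")
        case True
        then have s: "s > 0" "s \<le> 1" using exp_gt_zero[of "- real n"] by (auto simp del: exp_gt_zero)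
        have "?c * inverse s \<le> sqrt pi ^ dim V * (inverse s * exp (- A * s))"
          using s A by (simp add: mult_left_le)
        then show ?thesis using s True by (simp add: powr_minus ennreal_mult[symmetric] ennreal_leI)
      qed simp
    qed
    finally show ?thesis unfolding nn_integral_inverse_power_mixture[OF V A b0] .
  qed
  have "ennreal (Gamma ?b) * (\<integral>\<^sup>+x. ennreal ((A + (norm x)\<^sup>2) powr (- ?b)) \<partial>subspace_lborel V) = \<infinity>"
    (is "?X = _")
  proof (rule ccontr)
    define X where "X = ?X"
    assume "?X \<noteq> \<infinity>"
    then have "X \<noteq> \<infinity>" by (simp add: X_def)
    then obtain r where r: "r \<ge> 0" "X = ennreal r" by (cases X) auto
    obtain n where "r / ?c < real n" using reals_Archimedean2 by blast
    then have "r < ?c * real n" using c by (simp add: field_simps)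
    moreover have "?c * real n \<le> r" using ge[of n] unfolding X_def[symmetric] r(2) ennreal_le_iff[OF r(1)] .
    ultimately show False by simp
  qed
  then show ?thesis unfolding infinity_ennreal_def ennreal_mult_eq_top_iff by simp
qed

lemma AE_subspace_lborel_nonzero:
  fixes U :: "'a::euclidean_space set"
  assumes U: "subspace U" and d: "dim U > 0"
  shows "AE x in subspace_lborel U. x \<noteq> 0"
proof -
  have "emeasure (subspace_lborel U) {0} = (\<integral>\<^sup>+x. indicator {0} x \<partial>subspace_lborel U)" by simp
  also have "\<dots> = ennreal (2 ^ dim U) * (\<integral>\<^sup>+x. indicator {0} (2 *\<^sub>R x :: 'a) \<partial>subspace_lborel U)"
    by (rule nn_integral_subspace_scale[OF U]) auto
  also have "(\<lambda>x::'a. indicator {0} (2 *\<^sub>R x :: 'a) :: ennreal) = indicator {0}"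
    by (auto simp: indicator_def fun_eq_iff)
  finally have e: "emeasure (subspace_lborel U) {0} = ennreal (2 ^ dim U) * emeasure (subspace_lborel U) {0}" by simp
  have "emeasure (subspace_lborel U) {0} \<le> emeasure (subspace_lborel U) (ball 0 1)"
    by (rule emeasure_mono) auto
  then have "emeasure (subspace_lborel U) {0} < \<infinity>" using emeasure_ball_subspace_finite[OF U, of 0 1] by (rule le_less_trans)
  then obtain r where r: "emeasure (subspace_lborel U) {0} = ennreal r" "r \<ge> 0" by (cases "emeasure (subspace_lborel U) {0}") auto
  have "r = 2 ^ dim U * r" using e r by (simp flip: ennreal_mult)
  moreover have "(2::real) ^ dim U > 1" using d by (simp add: one_less_power)
  ultimately have "r = 0" by (metis mult_cancel_right1 less_irrefl)
  then show ?thesis using r by (subst AE_iff_measurable[where N="{0}"]) auto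
qed

section \<open>Stereographic projection of slices\<close>

text \<open>
  The line through the unit vector \<open>N\<close> in the direction \<open>u\<close> meets the unit sphere again at
  this point, the reflection of \<open>N\<close> in the hyperplane orthogonal to \<open>u\<close>.  For \<open>x\<close>
  orthogonal to \<open>N\<close>, \<open>second_point N (x - N)\<close> is the inverse stereographic image of \<open>x\<close>.
  Since only the line of \<open>u\<close> matters, the same formula serves to describe cones.
\<close>

definition second_point :: "'a::euclidean_space \<Rightarrow> 'a \<Rightarrow> 'a" where
  "second_point N u = N - (2 * (N \<bullet> u) / (u \<bullet> u)) *\<^sub>R u"

lemma second_point_measurable [measurable]:
  assumes [measurable]: "f \<in> borel_measurable M"
  shows "(\<lambda>x. second_point N (f x)) \<in> borel_measurable M"
  unfolding second_point_def by measurable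

text \<open>
  In the situation of \<open>pole_slice\<close> below, the plane meets the hyperplane orthogonal to \<open>N\<close> in
  \<open>p + U\<close>, and \<open>p\<close> is the point of \<open>p + U\<close> nearest to the origin.
\<close>

definition pole_plane :: "'a::euclidean_space \<Rightarrow> 'a set \<Rightarrow> 'a \<Rightarrow> 'a set" where
  "pole_plane N U p = (+) N ` span (insert (N - p) U)"

text \<open>
  The map \<open>l \<mapsto> a / l - l\<close> is a decreasing bijection from the positive half-line onto the
  line with derivative \<open>- (1 + a / l\<^sup>2)\<close>.
\<close>

lemma nn_integral_reciprocal_substitution:
  assumes a: "a > 0" and [measurable]: "f \<in> borel_measurable borel"
  shows "(\<integral>\<^sup>+s. f s \<partial>lborel) = (\<integral>\<^sup>+l. indicator {0<..} l * (ennreal (1 + a / l\<^sup>2) * f (a / l - l)) \<partial>lborel)"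
proof -
  let ?w = "\<lambda>l. indicator {0<..} l * ennreal (1 + a / l\<^sup>2)"
  let ?M = "distr (density lborel ?w) borel (\<lambda>l. a / l - l)"
  have "lborel = ?M"
  proof (rule lborel_eqI)
    fix s1 s2 :: real assume "\<And>b. b \<in> Basis \<Longrightarrow> s1 \<bullet> b \<le> s2 \<bullet> b"
    then have le: "s1 \<le> s2" by simp
    \<comment> \<open>the positive root \<open>l\<close> of \<open>a / l - l = s\<close>\<close>
    define r where "r s = (sqrt (s\<^sup>2 + 4 * a) - s) / 2" for s
    have r: "r s > 0" "a / r s - r s = s" for s
    proof -
      have "\<bar>s\<bar> < sqrt (s\<^sup>2 + 4 * a)" using a by (intro real_less_rsqrt) simp
      then show p: "r s > 0" by (simp add: r_def)
      have "r s * r s + s * r s = a"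
        using a by (simp add: r_def field_simps power2_eq_square[symmetric] add_nonneg_nonneg)
           (simp add: power2_eq_square algebra_simps)
      then show "a / r s - r s = s" using p by (simp add: field_simps)
    qed
    have mono: "a / l - l < a / m - m \<longleftrightarrow> m < l" if "l > 0" "m > 0" for l m
    proof -
      have *: "a / l - l < a / m - m" if "m < l" "m > 0" for l m
        using that a by (intro diff_strict_mono divide_strict_left_mono) auto
      show ?thesis using *[of m l] *[of l m] that by (metis linorder_neqE_linordered_idom order_less_asym)
    qed
    have rle: "r s2 \<le> r s1" using mono[OF r(1)[of s1] r(1)[of s2]] mono[OF r(1)[of s2] r(1)[of s1]] r(2) le by (smt (verit))
    have "emeasure ?M (box s1 s2) = (\<integral>\<^sup>+l. ?w l * indicator (box s1 s2) (a / l - l) \<partial>lborel)"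
      by (subst nn_integral_indicator[symmetric], simp, subst nn_integral_distr, simp, simp, subst nn_integral_density) auto
    also have "\<dots> = (\<integral>\<^sup>+l. ennreal (1 + a / l\<^sup>2) * indicator {r s2..r s1} l \<partial>lborel)"
    proof (rule nn_integral_cong_AE)
      have "AE l in lborel. l \<noteq> r s1 \<and> l \<noteq> r s2"
        by (intro AE_conjI AE_lborel_singleton)
      then show "AE l in lborel. ?w l * indicator (box s1 s2) (a / l - l) = ennreal (1 + a / l\<^sup>2) * indicator {r s2..r s1} l"
      proof eventually_elim
        case (elim l)
        show ?case
        proof (cases "l > 0")
          case True
          have "s1 < a / l - l \<longleftrightarrow> l < r s1" using mono[OF r(1)[of s1] True] r(2)[of s1] by simp
          moreover have "a / l - l < s2 \<longleftrightarrow> r s2 < l" using mono[OF True r(1)[of s2]] r(2)[of s2] by simp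
          ultimately show ?thesis using True elim by (auto simp: indicator_def box_real)
        next
          case False
          then show ?thesis using r(1)[of s2] by (auto simp: indicator_def)
        qed
      qed
    qed
    also have "\<dots> = ennreal ((r s1 - a / r s1) - (r s2 - a / r s2))"
    proof (rule nn_integral_FTC_Icc)
      fix l assume "l \<in> {r s2..r s1}"
      then have l: "l > 0" using r(1)[of s2] by auto
      show "((\<lambda>l. l - a / l) has_real_derivative 1 + a / l\<^sup>2) (at l)"
        using l by (auto intro!: derivative_eq_intros simp: field_simps power2_eq_square)
      show "0 \<le> 1 + a / l\<^sup>2" using a by simp
    qed (use rle in auto)
    also have "(r s1 - a / r s1) - (r s2 - a / r s2) = s2 - s1" using r(2)[of s1] r(2)[of s2] by linarith
    finally show "emeasure ?M (box s1 s2) = (\<Prod>b\<in>Basis. (s2 - s1) \<bullet> b)" by simp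
  qed simp
  then have "(\<integral>\<^sup>+s. f s \<partial>lborel) = (\<integral>\<^sup>+s. f s \<partial>?M)" by simp
  also have "\<dots> = (\<integral>\<^sup>+l. ?w l * f (a / l - l) \<partial>lborel)"
    by (subst nn_integral_distr, simp, simp, subst nn_integral_density) auto
  also have "\<dots> = (\<integral>\<^sup>+l. indicator {0<..} l * (ennreal (1 + a / l\<^sup>2) * f (a / l - l)) \<partial>lborel)"
    by (simp add: ac_simps)
  finally show ?thesis .
qed

text \<open>
  The slice of \<open>pole_plane N U p\<close> is a sphere with centre \<open>c\<close> and radius \<open>\<rho>\<close>; the plane has
  the direction space \<open>V\<close>, and \<open>\<nu>\<close> is the unit vector from the centre to the pole.
\<close>

locale pole_slice =
  fixes N :: "'a::euclidean_space" and U :: "'a set" and p :: 'a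
  assumes norm_N: "norm N = 1" and subU: "subspace U" and U_N: "\<And>x. x \<in> U \<Longrightarrow> x \<bullet> N = 0"
    and p_N: "p \<bullet> N = 0" and p_U: "\<And>x. x \<in> U \<Longrightarrow> x \<bullet> p = 0"
begin

definition \<rho> :: real where "\<rho> = 1 / sqrt (1 + (norm p)\<^sup>2)"
definition \<nu> :: 'a where "\<nu> = \<rho> *\<^sub>R (N - p)"
definition V :: "'a set" where "V = span (insert (N - p) U)"
definition c :: 'a where "c = N - \<rho> *\<^sub>R \<nu>"

lemma N_N: "N \<bullet> N = 1" using norm_N by (simp add: dot_square_norm)

lemma rho: "\<rho> > 0" "\<rho>\<^sup>2 = 1 / (1 + (norm p)\<^sup>2)" "\<rho>\<^sup>2 * (1 + p \<bullet> p) = 1" "\<rho> \<noteq> 0"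
proof -
  have *: "1 + (norm p)\<^sup>2 > 0" by (simp add: add_pos_nonneg)
  show "\<rho> > 0" using * by (simp add: \<rho>_def)
  then show "\<rho> \<noteq> 0" by simp
  show r: "\<rho>\<^sup>2 = 1 / (1 + (norm p)\<^sup>2)" using * by (simp add: \<rho>_def power_divide)
  show "\<rho>\<^sup>2 * (1 + p \<bullet> p) = 1" using * by (simp add: r power2_norm_eq_inner[symmetric])
qed

lemma Np_Np: "(N - p) \<bullet> (N - p) = 1 + p \<bullet> p"
  using N_N p_N by (simp add: inner_diff inner_commute)

lemma nu_nu: "\<nu> \<bullet> \<nu> = 1" using rho(3) Np_Np by (simp add: \<nu>_def power2_eq_square mult.assoc)
lemma norm_nu: "norm \<nu> = 1" using nu_nu by (simp add: norm_eq_sqrt_inner)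
lemma N_nu: "N \<bullet> \<nu> = \<rho>" using N_N p_N by (simp add: \<nu>_def inner_diff inner_commute)
lemma nu_V: "\<nu> \<in> V" by (simp add: \<nu>_def V_def span_base span_mul)
lemma subV: "subspace V" by (simp add: V_def)
lemma nu_U: "x \<in> U \<Longrightarrow> x \<bullet> \<nu> = 0" using U_N p_U by (simp add: \<nu>_def inner_diff_right)

lemma V_orth_nu: "{y\<in>V. y \<bullet> \<nu> = 0} = U"
proof (intro set_eqI iffI)
  fix y assume y: "y \<in> {y\<in>V. y \<bullet> \<nu> = 0}"
  then obtain k where "y - k *\<^sub>R (N - p) \<in> span U" unfolding V_def span_insert by auto
  then have k: "y - k *\<^sub>R (N - p) \<in> U" using subU by (simp add: span_eq_iff[THEN iffD2])
  have "(y - k *\<^sub>R (N - p)) \<bullet> (N - p) = 0" using U_N[OF k] p_U[OF k] by (simp add: inner_diff_right)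
  moreover have "y \<bullet> (N - p) = 0" using y rho(4) by (auto simp: \<nu>_def)
  ultimately have "k * (1 + p \<bullet> p) = 0" using Np_Np by (simp add: inner_diff_left[of y])
  moreover have "1 + p \<bullet> p > 0" by (simp add: add_pos_nonneg)
  ultimately have "k = 0" by auto
  then show "y \<in> U" using k by simp
next
  fix y assume "y \<in> U"
  then show "y \<in> {y\<in>V. y \<bullet> \<nu> = 0}" using nu_U by (auto simp: V_def span_base)
qed

lemma dim_V: "dim V = Suc (dim U)"
  using dim_subspace_orthogonal_part[OF subV norm_nu nu_V] V_orth_nu by simp

lemma c_nu: "c \<bullet> \<nu> = 0" using nu_nu N_nu by (simp add: c_def inner_diff_left)

lemma c_V: "x \<in> V \<Longrightarrow> c \<bullet> x = 0"
proof -
  assume "x \<in> V"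
  then obtain s y where "x = s *\<^sub>R \<nu> + y" "y \<in> U"
    using subspace_orthogonal_line[OF subV norm_nu nu_V] V_orth_nu by (auto simp: span_singleton)
  moreover have "c \<bullet> y = 0" if "y \<in> U" for y
    using U_N[OF that] nu_U[OF that] by (simp add: c_def inner_diff_left inner_commute[of _ y] inner_diff_right)
  ultimately show "c \<bullet> x = 0" using c_nu by (simp add: inner_add_right)
qed

lemma c_plane: "pole_plane N U p = (+) c ` V"
proof -
  have *: "N + x = c + (\<rho> *\<^sub>R \<nu> + x)" for x by (simp add: c_def)
  have "x - \<rho> *\<^sub>R \<nu> \<in> V" if "x \<in> V" for x using that subV nu_V by (auto intro: subspace_diff subspace_scale)
  moreover have "x + \<rho> *\<^sub>R \<nu> \<in> V" if "x \<in> V" for x using that subV nu_V by (auto intro: subspace_add subspace_scale)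
  ultimately have "(\<lambda>x. \<rho> *\<^sub>R \<nu> + x) ` V = V"
    by (intro equalityI subsetI image_eqI[of _ "\<lambda>x. \<rho> *\<^sub>R \<nu> + x" "_ - \<rho> *\<^sub>R \<nu>"]) (auto simp: add.commute)
  then have "(\<lambda>x. c + (\<rho> *\<^sub>R \<nu> + x)) ` V = (+) c ` V" by (metis image_image)
  then show ?thesis unfolding pole_plane_def V_def[symmetric] * .
qed

lemma closest: "closest_point (pole_plane N U p) 0 = c"
proof (rule closest_point_unique[symmetric])
  show "convex (pole_plane N U p)" unfolding c_plane using subV by (intro convex_translation subspace_imp_convex)
  show "closed (pole_plane N U p)" unfolding c_plane using subV by (intro closed_translation closed_subspace)
  show "c \<in> pole_plane N U p" unfolding c_plane using subspace_0[OF subV] by (auto simp: image_iff)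
  show "\<forall>z\<in>pole_plane N U p. dist 0 c \<le> dist 0 z"
  proof
    fix z assume "z \<in> pole_plane N U p"
    then obtain x where x: "x \<in> V" "z = c + x" unfolding c_plane by auto
    have "(norm z)\<^sup>2 = (norm c)\<^sup>2 + (norm x)\<^sup>2"
      unfolding x by (rule norm_add_Pythagorean) (use c_V[OF x(1)] in \<open>simp add: orthogonal_def\<close>)
    then have "(norm c)\<^sup>2 \<le> (norm z)\<^sup>2" by simp
    then have "norm c \<le> norm z" by (rule power2_le_imp_le) simp
    then show "dist 0 c \<le> dist 0 z" by simp
  qed
qed

lemma norm_c: "(norm c)\<^sup>2 = 1 - \<rho>\<^sup>2"
proof -
  have "c \<bullet> c = 1 - \<rho>\<^sup>2"
    using N_N N_nu nu_nu by (simp add: c_def inner_diff inner_commute power2_eq_square)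
  then show ?thesis by (simp add: power2_norm_eq_inner)
qed

lemma infdist_plane: "infdist 0 (pole_plane N U p) = norm p / sqrt (1 + (norm p)\<^sup>2)"
proof -
  have "closed (pole_plane N U p)" unfolding c_plane using subV by (intro closed_translation closed_subspace)
  moreover have "pole_plane N U p \<noteq> {}" unfolding c_plane using nu_V by auto
  ultimately have "infdist 0 (pole_plane N U p) = norm c"
    using setdist_closest_point[of "pole_plane N U p" 0] by (simp add: infdist_eq_setdist closest)
  also have "\<dots> = norm p / sqrt (1 + (norm p)\<^sup>2)"
  proof (rule power2_eq_imp_eq)
    have "1 + (norm p)\<^sup>2 > 0" by (simp add: add_pos_nonneg)
    then show "(norm c)\<^sup>2 = (norm p / sqrt (1 + (norm p)\<^sup>2))\<^sup>2"
      by (simp add: norm_c rho power_divide field_simps)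
  qed auto
  finally show ?thesis .
qed

text \<open>
  The points \<open>x = l ((\<rho>\<^sup>2 |z|\<^sup>2 - 1) \<nu> + 2 \<rho> z)\<close> with \<open>l > 0\<close> form the ray from the centre
  through the slice point over \<open>p + z\<close>.  In this parametrisation the norm of \<open>x\<close> has no
  square root.
\<close>

lemma point_identity:
  assumes z: "z \<in> U" and l: "l > 0"
  defines "D \<equiv> 1 + \<rho>\<^sup>2 * (norm z)\<^sup>2"
  shows "norm ((\<rho>\<^sup>2 * (norm z)\<^sup>2 * l - l) *\<^sub>R \<nu> + (2 * l * \<rho>) *\<^sub>R z) = l * D"
    and "c + (\<rho> / (l * D)) *\<^sub>R ((\<rho>\<^sup>2 * (norm z)\<^sup>2 * l - l) *\<^sub>R \<nu> + (2 * l * \<rho>) *\<^sub>R z) = second_point N (p + z - N)"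
    and "1 + (norm (p + z))\<^sup>2 = D / \<rho>\<^sup>2"
proof -
  have D: "D > 0" by (simp add: D_def add_pos_nonneg)
  let ?x = "(\<rho>\<^sup>2 * (norm z)\<^sup>2 * l - l) *\<^sub>R \<nu> + (2 * l * \<rho>) *\<^sub>R z"
  have zn: "z \<bullet> \<nu> = 0" "z \<bullet> N = 0" "z \<bullet> p = 0" using z nu_U U_N p_U by auto
  have zz: "z \<bullet> z = (norm z)\<^sup>2" by (simp add: power2_norm_eq_inner)
  have "?x \<bullet> ?x = (\<rho>\<^sup>2 * (norm z)\<^sup>2 * l - l)\<^sup>2 + (2 * l * \<rho>)\<^sup>2 * (norm z)\<^sup>2"
    using nu_nu zn zz by (simp add: inner_add_left inner_add_right inner_commute power2_eq_square)
  also have "\<dots> = (l * D)\<^sup>2" by (simp add: D_def power2_eq_square algebra_simps)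
  finally have "(norm ?x)\<^sup>2 = (l * D)\<^sup>2" by (simp add: power2_norm_eq_inner)
  then show "norm ?x = l * D" using l D by (subst (asm) power2_eq_iff_nonneg) auto
  show pz: "1 + (norm (p + z))\<^sup>2 = D / \<rho>\<^sup>2"
  proof -
    have "(norm (p + z))\<^sup>2 = p \<bullet> p + z \<bullet> z" using zn by (simp add: power2_norm_eq_inner inner_add inner_commute)
    then have "\<rho>\<^sup>2 * (1 + (norm (p + z))\<^sup>2) = \<rho>\<^sup>2 * (1 + p \<bullet> p) + \<rho>\<^sup>2 * (z \<bullet> z)" by (simp add: algebra_simps)
    also have "\<dots> = D" by (simp add: rho(3) D_def zz)
    finally show ?thesis using rho(4) by (simp add: field_simps)
  qed
  let ?u = "p + z - N"
  have u: "?u \<bullet> ?u = D / \<rho>\<^sup>2"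
  proof -
    have "?u \<bullet> ?u = 1 + (norm (p + z))\<^sup>2"
      using N_N zn p_N by (simp add: power2_norm_eq_inner inner_add inner_diff inner_commute algebra_simps)
    then show ?thesis by (simp add: pz)
  qed
  have Nu: "N \<bullet> ?u = - 1" using N_N zn p_N by (simp add: inner_add inner_diff inner_commute)
  have pN: "p - N = - (1 / \<rho>) *\<^sub>R \<nu>" using rho(4) by (simp add: \<nu>_def scaleR_diff_right)
  have sp: "second_point N ?u = N + (2 * \<rho>\<^sup>2 / D) *\<^sub>R (z - (1 / \<rho>) *\<^sub>R \<nu>)"
  proof -
    have "?u = z - (1 / \<rho>) *\<^sub>R \<nu>" using pN by (simp add: algebra_simps)
    moreover have "2 * (N \<bullet> ?u) / (?u \<bullet> ?u) = - (2 * \<rho>\<^sup>2 / D)" using D rho(4) by (simp add: u Nu)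
    ultimately show ?thesis unfolding second_point_def by simp
  qed
  have "(\<rho> / (l * D)) *\<^sub>R ?x = ((\<rho> / (l * D)) * (l * (D - 2))) *\<^sub>R \<nu> + ((\<rho> / (l * D)) * (2 * l * \<rho>)) *\<^sub>R z"
  proof -
    have "\<rho>\<^sup>2 * (norm z)\<^sup>2 * l - l = l * (D - 2)" by (simp add: D_def algebra_simps)
    then show ?thesis by (simp only: scaleR_add_right scaleR_scaleR)
  qed
  also have "(\<rho> / (l * D)) * (l * (D - 2)) = \<rho> - 2 * \<rho> / D" using l D by (simp add: field_simps)
  also have "(\<rho> / (l * D)) * (2 * l * \<rho>) = 2 * \<rho>\<^sup>2 / D" using l D by (simp add: field_simps power2_eq_square)
  finally have "c + (\<rho> / (l * D)) *\<^sub>R ?x = N + ((- (2 * \<rho> / D)) *\<^sub>R \<nu> + (2 * \<rho>\<^sup>2 / D) *\<^sub>R z)"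
    by (simp add: c_def scaleR_diff_left algebra_simps)
  also have "\<dots> = second_point N ?u"
    using rho(4) by (simp add: sp scaleR_diff_right power2_eq_square algebra_simps)
  finally show "c + (\<rho> / (l * D)) *\<^sub>R ?x = second_point N ?u" .
qed

text \<open>
  The cone formula is evaluated in the coordinates \<open>(l, z)\<close> of \<open>point_identity\<close>.  For a fixed
  component \<open>w = 2 l \<rho> z\<close> in \<open>U\<close>, the component along \<open>\<nu>\<close> is \<open>|w|\<^sup>2 / (4 l) - l\<close>, which is
  the substitution \<open>nn_integral_reciprocal_substitution\<close>; for fixed \<open>l\<close>, the map
  \<open>z \<mapsto> w\<close> is a dilation.  So no Jacobian in several variables is needed.  The ball of radius
  \<open>\<rho>\<close> is \<open>l < \<rho> / (1 + \<rho>\<^sup>2 |z|\<^sup>2)\<close>, and the integral over \<open>l\<close> leaves the conformal factor.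
\<close>

lemma surface_measure_pole_plane:
  assumes d: "dim U > 0"
  shows "surface_measure (pole_plane N U p) =
    distr (density (subspace_lborel U) (\<lambda>z. ennreal ((2 / (1 + (norm (p + z))\<^sup>2)) ^ dim U))) borel
      (\<lambda>z. second_point N (p + z - N))"
proof (rule measure_eqI)
  show "sets (surface_measure (pole_plane N U p)) = sets (distr (density (subspace_lborel U) (\<lambda>z. ennreal ((2 / (1 + (norm (p + z))\<^sup>2)) ^ dim U))) borel
      (\<lambda>z. second_point N (p + z - N)))"
    by (simp add: surface_measure_def Let_def)
  fix A assume "A \<in> sets (surface_measure (pole_plane N U p))"
  then have [measurable]: "A \<in> sets borel" by (simp add: surface_measure_def Let_def)
  interpret S: sigma_finite_measure "subspace_lborel U" by (rule sigma_finite_subspace_lborel[OF subU])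
  interpret PQ: pair_sigma_finite lborel "subspace_lborel U" by standard
  define D where "D z = 1 + \<rho>\<^sup>2 * (norm z)\<^sup>2" for z :: 'a
  have D: "D z > 0" for z by (simp add: D_def add_pos_nonneg)
  have [measurable]: "D \<in> borel_measurable borel" unfolding D_def by measurable
  define G :: "'a \<Rightarrow> ennreal" where "G x = indicator (ball 0 \<rho>) x * indicator A (c + (\<rho> / norm x) *\<^sub>R x)" for x
  have [measurable]: "ball (0::'a) \<rho> \<in> sets borel" by simp
  have [measurable]: "G \<in> borel_measurable borel" unfolding G_def by measurable
  define q :: "'a \<Rightarrow> ennreal" where "q z = indicator A (second_point N (p + z - N))" for z
  have [measurable]: "q \<in> borel_measurable borel" unfolding q_def by measurable
  let ?L = "subspace_lborel U"
  have r: "sqrt (1 - (norm c)\<^sup>2) = \<rho>" using rho(1) by (simp add: norm_c)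
  have im: "(\<lambda>x. x - c) ` pole_plane N U p = V" unfolding c_plane by (simp add: image_image)
  have [measurable]: "(\<lambda>x. c + (\<rho> / norm x) *\<^sub>R x) \<in> borel_measurable (restrict_space (subspace_lborel V) (ball 0 \<rho>))"
    by (rule measurable_restrict_space1) measurable
  have "emeasure (surface_measure (pole_plane N U p)) A
      = ennreal (dim V / \<rho>) * emeasure (subspace_lborel V) ((\<lambda>x. c + (\<rho> / norm x) *\<^sub>R x) -` A \<inter> ball 0 \<rho>)"
    unfolding surface_measure_def Let_def closest r im
    by (simp add: emeasure_distr space_restrict_space emeasure_restrict_space)
  also have "emeasure (subspace_lborel V) ((\<lambda>x. c + (\<rho> / norm x) *\<^sub>R x) -` A \<inter> ball 0 \<rho>) = (\<integral>\<^sup>+x. G x \<partial>subspace_lborel V)"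
  proof -
    have [measurable]: "(\<lambda>x. c + (\<rho> / norm x) *\<^sub>R x) -` A \<in> sets borel"
      using measurable_sets[of "\<lambda>x. c + (\<rho> / norm x) *\<^sub>R x" borel borel A] by simp
    have "G = indicator ((\<lambda>x. c + (\<rho> / norm x) *\<^sub>R x) -` A \<inter> ball 0 \<rho>)"
      by (auto simp: G_def fun_eq_iff indicator_def)
    then show ?thesis by simp
  qed
  also have "(\<integral>\<^sup>+x. G x \<partial>subspace_lborel V) = (\<integral>\<^sup>+s. \<integral>\<^sup>+w. G (s *\<^sub>R \<nu> + w) \<partial>?L \<partial>lborel)"
    using nn_integral_subspace_line[OF subV norm_nu nu_V] V_orth_nu by simp
  also have "\<dots> = (\<integral>\<^sup>+w. \<integral>\<^sup>+s. G (s *\<^sub>R \<nu> + w) \<partial>lborel \<partial>?L)"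
    by (rule PQ.Fubini'[symmetric]) measurable
  also have "\<dots> = (\<integral>\<^sup>+w. \<integral>\<^sup>+l. indicator {0<..} l * (ennreal (1 + ((norm w)\<^sup>2 / 4) / l\<^sup>2) * G ((((norm w)\<^sup>2 / 4) / l - l) *\<^sub>R \<nu> + w)) \<partial>lborel \<partial>?L)"
  proof (rule nn_integral_cong_AE)
    \<comment> \<open>the substitution degenerates at \<open>w = 0\<close>, a null set because \<open>dim U > 0\<close>\<close>
    show "AE w in ?L. (\<integral>\<^sup>+s. G (s *\<^sub>R \<nu> + w) \<partial>lborel) = (\<integral>\<^sup>+l. indicator {0<..} l * (ennreal (1 + ((norm w)\<^sup>2 / 4) / l\<^sup>2) * G ((((norm w)\<^sup>2 / 4) / l - l) *\<^sub>R \<nu> + w)) \<partial>lborel)"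
      using AE_subspace_lborel_nonzero[OF subU d]
    proof eventually_elim
      case (elim w)
      then have "(norm w)\<^sup>2 / 4 > 0" by simp
      then show ?case by (rule nn_integral_reciprocal_substitution) measurable
    qed
  qed
  also have "\<dots> = (\<integral>\<^sup>+l. \<integral>\<^sup>+w. indicator {0<..} l * (ennreal (1 + ((norm w)\<^sup>2 / 4) / l\<^sup>2) * G ((((norm w)\<^sup>2 / 4) / l - l) *\<^sub>R \<nu> + w)) \<partial>?L \<partial>lborel)"
    by (rule PQ.Fubini') measurable
  also have "\<dots> = (\<integral>\<^sup>+l. \<integral>\<^sup>+z. ennreal (D z) * (ennreal ((2 * \<rho>) ^ dim U) * (ennreal (l ^ dim U) * indicator {0<..<\<rho> / D z} l)) * q z \<partial>?L \<partial>lborel)"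
  proof (rule nn_integral_cong)
    fix l :: real
    show "(\<integral>\<^sup>+w. indicator {0<..} l * (ennreal (1 + ((norm w)\<^sup>2 / 4) / l\<^sup>2) * G ((((norm w)\<^sup>2 / 4) / l - l) *\<^sub>R \<nu> + w)) \<partial>?L)
      = (\<integral>\<^sup>+z. ennreal (D z) * (ennreal ((2 * \<rho>) ^ dim U) * (ennreal (l ^ dim U) * indicator {0<..<\<rho> / D z} l)) * q z \<partial>?L)"
    proof (cases "l > 0")
      case l: True
      let ?k = "2 * l * \<rho>"
      have k: "?k > 0" using l rho by simp
      have "(\<integral>\<^sup>+w. indicator {0<..} l * (ennreal (1 + ((norm w)\<^sup>2 / 4) / l\<^sup>2) * G ((((norm w)\<^sup>2 / 4) / l - l) *\<^sub>R \<nu> + w)) \<partial>?L)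
        = ennreal (?k ^ dim U) * (\<integral>\<^sup>+z. ennreal (1 + ((norm (?k *\<^sub>R z))\<^sup>2 / 4) / l\<^sup>2) * G ((((norm (?k *\<^sub>R z))\<^sup>2 / 4) / l - l) *\<^sub>R \<nu> + ?k *\<^sub>R z) \<partial>?L)"
        using l by (subst nn_integral_subspace_scale[OF subU k]) auto
      also have "\<dots> = (\<integral>\<^sup>+z. ennreal (?k ^ dim U) * (ennreal (1 + ((norm (?k *\<^sub>R z))\<^sup>2 / 4) / l\<^sup>2) * G ((((norm (?k *\<^sub>R z))\<^sup>2 / 4) / l - l) *\<^sub>R \<nu> + ?k *\<^sub>R z)) \<partial>?L)"
        by (subst nn_integral_cmult) auto
      also have "\<dots> = (\<integral>\<^sup>+z. ennreal (D z) * (ennreal ((2 * \<rho>) ^ dim U) * (ennreal (l ^ dim U) * indicator {0<..<\<rho> / D z} l)) * q z \<partial>?L)"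
      proof (rule nn_integral_cong_AE)
        show "AE z in ?L. ennreal (?k ^ dim U) * (ennreal (1 + ((norm (?k *\<^sub>R z))\<^sup>2 / 4) / l\<^sup>2) * G ((((norm (?k *\<^sub>R z))\<^sup>2 / 4) / l - l) *\<^sub>R \<nu> + ?k *\<^sub>R z))
          = ennreal (D z) * (ennreal ((2 * \<rho>) ^ dim U) * (ennreal (l ^ dim U) * indicator {0<..<\<rho> / D z} l)) * q z"
          using AE_subspace_lborel_in[OF subU]
        proof eventually_elim
          case (elim z)
          have n2: "(norm (?k *\<^sub>R z))\<^sup>2 = ?k\<^sup>2 * (norm z)\<^sup>2" by (simp add: power_mult_distrib)
          have e1: "((norm (?k *\<^sub>R z))\<^sup>2 / 4) / l - l = \<rho>\<^sup>2 * (norm z)\<^sup>2 * l - l"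
            unfolding n2 using l by (simp add: power2_eq_square)
          have e2: "1 + ((norm (?k *\<^sub>R z))\<^sup>2 / 4) / l\<^sup>2 = D z"
            unfolding n2 using l by (simp add: power2_eq_square D_def)
          note P = point_identity[OF elim l, folded D_def]
          let ?x = "(\<rho>\<^sup>2 * (norm z)\<^sup>2 * l - l) *\<^sub>R \<nu> + ?k *\<^sub>R z"
          have G: "G ?x = indicator {0<..<\<rho> / D z} l * q z"
          proof -
            have "?x \<in> ball 0 \<rho> \<longleftrightarrow> l \<in> {0<..<\<rho> / D z}"
            proof -
              have "?x \<in> ball 0 \<rho> \<longleftrightarrow> norm ?x < \<rho>" by (simp only: mem_ball dist_0_norm)
              also have "\<dots> \<longleftrightarrow> l \<in> {0<..<\<rho> / D z}" unfolding P(1) using l D[of z] by (simp add: field_simps)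
              finally show ?thesis .
            qed
            then show ?thesis unfolding G_def q_def P(1) P(2) by (simp add: indicator_def)
          qed
          have "ennreal (?k ^ dim U) = ennreal ((2 * \<rho>) ^ dim U) * ennreal (l ^ dim U)"
            using l rho by (simp add: power_mult_distrib ac_simps flip: ennreal_mult)
          then show ?case unfolding e1 e2 G by (simp add: ac_simps)
        qed
      qed
      finally show ?thesis .
    qed auto
  qed
  also have "\<dots> = (\<integral>\<^sup>+z. \<integral>\<^sup>+l. ennreal (D z) * (ennreal ((2 * \<rho>) ^ dim U) * (ennreal (l ^ dim U) * indicator {0<..<\<rho> / D z} l)) * q z \<partial>lborel \<partial>?L)"
  proof (rule PQ.Fubini'[symmetric])
    have [measurable]: "Measurable.pred (borel \<Otimes>\<^sub>M borel) (\<lambda>x :: real \<times> 'a. fst x \<in> {0<..<\<rho> / D (snd x)})"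
      unfolding greaterThanLessThan_iff by measurable
    have [measurable]: "(\<lambda>x. q (snd x)) \<in> borel_measurable (lborel \<Otimes>\<^sub>M ?L)"
      by (rule measurable_compose[OF measurable_snd]) simp
    show "(\<lambda>(l, z). ennreal (D z) * (ennreal ((2 * \<rho>) ^ dim U) * (ennreal (l ^ dim U) * indicator {0<..<\<rho> / D z} l)) * q z)
      \<in> borel_measurable (lborel \<Otimes>\<^sub>M ?L)"
      by measurable
  qed
  also have "\<dots> = (\<integral>\<^sup>+z. ennreal (D z * ((2 * \<rho>) ^ dim U * ((\<rho> / D z) ^ Suc (dim U) / Suc (dim U)))) * q z \<partial>?L)"
  proof (rule nn_integral_cong)
    fix z :: 'a
    have "(\<integral>\<^sup>+l. ennreal (l ^ dim U) * indicator {0<..<\<rho> / D z} l \<partial>lborel)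
       = (\<integral>\<^sup>+l. ennreal (l ^ dim U) * indicator {0..\<rho> / D z} l \<partial>lborel)"
    proof (rule nn_integral_cong_AE)
      have "AE l in lborel. l \<noteq> (0::real) \<and> l \<noteq> \<rho> / D z" by (intro AE_conjI AE_lborel_singleton)
      then show "AE l in lborel. ennreal (l ^ dim U) * indicator {0<..<\<rho> / D z} l = ennreal (l ^ dim U) * indicator {0..\<rho> / D z} l"
        by eventually_elim (auto simp: indicator_def)
    qed
    also have "\<dots> = ennreal ((\<rho> / D z) ^ Suc (dim U) / Suc (dim U) - 0 ^ Suc (dim U) / Suc (dim U))"
    proof (rule nn_integral_FTC_Icc)
      fix l :: real
      show "((\<lambda>l. l ^ Suc (dim U) / Suc (dim U)) has_real_derivative l ^ dim U) (at l)"
        by (rule DERIV_cdivide[OF DERIV_pow, THEN DERIV_cong]) simp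
    qed (use rho D[of z] in auto)
    finally have i: "(\<integral>\<^sup>+l. ennreal (l ^ dim U) * indicator {0<..<\<rho> / D z} l \<partial>lborel) = ennreal ((\<rho> / D z) ^ Suc (dim U) / Suc (dim U))"
      by simp
    have "(\<integral>\<^sup>+l. ennreal (D z) * (ennreal ((2 * \<rho>) ^ dim U) * (ennreal (l ^ dim U) * indicator {0<..<\<rho> / D z} l)) * q z \<partial>lborel)
      = ennreal (D z) * (ennreal ((2 * \<rho>) ^ dim U) * ennreal ((\<rho> / D z) ^ Suc (dim U) / Suc (dim U))) * q z"
      unfolding i[symmetric] by (subst nn_integral_multc, simp, subst nn_integral_cmult, simp, subst nn_integral_cmult) auto
    also have "\<dots> = ennreal (D z * ((2 * \<rho>) ^ dim U * ((\<rho> / D z) ^ Suc (dim U) / Suc (dim U)))) * q z"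
    proof -
      have "0 \<le> D z" "0 \<le> (2 * \<rho>) ^ dim U" "0 \<le> (\<rho> / D z) ^ Suc (dim U) / Suc (dim U)"
        using D[of z] rho(1) by simp_all
      then show ?thesis by (simp only: ennreal_mult mult_nonneg_nonneg)
    qed
    finally show "(\<integral>\<^sup>+l. ennreal (D z) * (ennreal ((2 * \<rho>) ^ dim U) * (ennreal (l ^ dim U) * indicator {0<..<\<rho> / D z} l)) * q z \<partial>lborel)
      = ennreal (D z * ((2 * \<rho>) ^ dim U * ((\<rho> / D z) ^ Suc (dim U) / Suc (dim U)))) * q z" .
  qed
  also have "ennreal (dim V / \<rho>) * \<dots> = (\<integral>\<^sup>+z. ennreal ((2 / (1 + (norm (p + z))\<^sup>2)) ^ dim U) * q z \<partial>?L)"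
  proof (subst nn_integral_cmult[symmetric], measurable, rule nn_integral_cong_AE)
    show "AE z in ?L. ennreal (dim V / \<rho>) * (ennreal (D z * ((2 * \<rho>) ^ dim U * ((\<rho> / D z) ^ Suc (dim U) / Suc (dim U)))) * q z)
      = ennreal ((2 / (1 + (norm (p + z))\<^sup>2)) ^ dim U) * q z"
      using AE_subspace_lborel_in[OF subU]
    proof eventually_elim
      case (elim z)
      have "dim V / \<rho> * (D z * ((2 * \<rho>) ^ dim U * ((\<rho> / D z) ^ Suc (dim U) / Suc (dim U))))
        = ((2 * \<rho>) * (\<rho> / D z)) ^ dim U"
      proof -
        have "real (Suc n) / r * (x * ((2 * r) ^ n * ((r / x) ^ Suc n / real (Suc n)))) = ((2 * r) * (r / x)) ^ n"
          if "x > 0" "r > 0" for x r :: real and n :: nat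
        proof -
          have "s / r * (x * (X * (r / x * Y / s))) = X * Y" if "s > 0" for s X Y
            using that \<open>x > 0\<close> \<open>r > 0\<close> by simp
          from this[of "real (Suc n)"] show ?thesis by (simp only: power_mult_distrib power_Suc of_nat_0_less_iff zero_less_Suc)
        qed
        then show ?thesis unfolding dim_V using D[of z] rho(1) .
      qed
      also have "(2 * \<rho>) * (\<rho> / D z) = 2 / (1 + (norm (p + z))\<^sup>2)"
        using point_identity(3)[OF elim, of 1, folded D_def] rho(4) D[of z] by (simp add: power2_eq_square)
      finally have e: "dim V / \<rho> * (D z * ((2 * \<rho>) ^ dim U * ((\<rho> / D z) ^ Suc (dim U) / Suc (dim U)))) = (2 / (1 + (norm (p + z))\<^sup>2)) ^ dim U" .
      show ?case unfolding e[symmetric] mult.assoc[symmetric]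
        by (subst ennreal_mult[symmetric]) (use D[of z] rho(1) in auto)
    qed
  qed
  also have "\<dots> = emeasure (distr (density ?L (\<lambda>z. ennreal ((2 / (1 + (norm (p + z))\<^sup>2)) ^ dim U))) borel
      (\<lambda>z. second_point N (p + z - N))) A"
    by (subst nn_integral_indicator[symmetric], simp, subst nn_integral_distr, simp, simp, subst nn_integral_density) (auto simp: q_def)
  finally show "emeasure (surface_measure (pole_plane N U p)) A = emeasure (distr (density ?L (\<lambda>z. ennreal ((2 / (1 + (norm (p + z))\<^sup>2)) ^ dim U))) borel
      (\<lambda>z. second_point N (p + z - N))) A" .
qed

end

section \<open>Functions all of whose hyperplane integrals vanish\<close>

lemma subspace_lborel_not_null:
  fixes V :: "'a::euclidean_space set"
  assumes "subspace V" shows "\<not> (AE x in subspace_lborel V. False)"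
proof
  assume "AE x in subspace_lborel V. False"
  then have "(\<integral>\<^sup>+x. ennreal (exp (- 1 * (norm x)\<^sup>2)) \<partial>subspace_lborel V) = (\<integral>\<^sup>+x. 0 \<partial>subspace_lborel V)"
    by (intro nn_integral_cong_AE) auto
  then show False using nn_integral_gaussian_subspace[OF assms, of 1] by simp
qed

lemma subspace_lborel_scale:
  fixes V :: "'a::euclidean_space set"
  assumes V: "subspace V" and c: "c > 0"
  shows "subspace_lborel V = distr (density (subspace_lborel V) (\<lambda>_. ennreal (c ^ dim V))) borel (\<lambda>x. c *\<^sub>R x)"
proof (rule measure_eqI)
  fix A assume "A \<in> sets (subspace_lborel V)"
  then have [measurable]: "A \<in> sets borel" by simp
  have "emeasure (subspace_lborel V) A = (\<integral>\<^sup>+x. indicator A x \<partial>subspace_lborel V)" by simp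
  also have "\<dots> = ennreal (c ^ dim V) * (\<integral>\<^sup>+x. indicator A (c *\<^sub>R x) \<partial>subspace_lborel V)"
    by (rule nn_integral_subspace_scale[OF V c]) simp
  also have "\<dots> = (\<integral>\<^sup>+x. ennreal (c ^ dim V) * indicator A (c *\<^sub>R x) \<partial>subspace_lborel V)"
    by (subst nn_integral_cmult) auto
  also have "\<dots> = emeasure (distr (density (subspace_lborel V) (\<lambda>_. ennreal (c ^ dim V))) borel (\<lambda>x. c *\<^sub>R x)) A"
    by (subst nn_integral_indicator[symmetric], simp, subst nn_integral_distr, simp, simp, subst nn_integral_density) auto
  finally show "emeasure (subspace_lborel V) A = emeasure (distr (density (subspace_lborel V) (\<lambda>_. ennreal (c ^ dim V))) borel (\<lambda>x. c *\<^sub>R x)) A" .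
qed simp

lemma integral_subspace_scale:
  fixes V :: "'a::euclidean_space set" and f :: "'a \<Rightarrow> 'b::{banach, second_countable_topology}"
  assumes V: "subspace V" and c: "c > 0" and [measurable]: "f \<in> borel_measurable borel"
  shows "(\<integral>x. f x \<partial>subspace_lborel V) = c ^ dim V *\<^sub>R (\<integral>x. f (c *\<^sub>R x) \<partial>subspace_lborel V)"
proof -
  have "(\<integral>x. f x \<partial>subspace_lborel V) = (\<integral>x. f (c *\<^sub>R x) \<partial>density (subspace_lborel V) (\<lambda>_. ennreal (c ^ dim V)))"
    by (subst subspace_lborel_scale[OF V c], subst integral_distr) auto
  also have "\<dots> = (\<integral>x. c ^ dim V *\<^sub>R f (c *\<^sub>R x) \<partial>subspace_lborel V)"
    by (subst integral_density) (use c in auto)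
  finally show ?thesis by simp
qed

text \<open>
  If the ridge function times \<open>G\<close> is integrable, then Fubini's theorem applies with the slices
  orthogonal to \<open>u\<close>; otherwise the integral is 0 by convention.
\<close>

lemma integral_ridge_zero:
  fixes H :: "'a::euclidean_space set" and G :: "'a \<Rightarrow> complex" and \<phi> :: "real \<Rightarrow> real"
  assumes H: "subspace H" and u: "norm u = 1" "u \<in> H"
    and [measurable]: "G \<in> borel_measurable borel" "\<phi> \<in> borel_measurable borel"
    and z: "\<And>s. \<phi> s \<noteq> 0 \<Longrightarrow> (\<integral>z. G (s *\<^sub>R u + z) \<partial>subspace_lborel {y\<in>H. y \<bullet> u = 0}) = 0"
  shows "(\<integral>y. \<phi> (y \<bullet> u) *\<^sub>R G y \<partial>subspace_lborel H) = 0"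
proof (cases "integrable (subspace_lborel H) (\<lambda>y. \<phi> (y \<bullet> u) *\<^sub>R G y)")
  case False
  then show ?thesis by (rule not_integrable_integral_eq)
next
  case True
  let ?W = "{y\<in>H. y \<bullet> u = 0}"
  have W: "subspace ?W" by (rule subspace_orthogonal_part[OF H])
  interpret S: sigma_finite_measure "subspace_lborel ?W" by (rule sigma_finite_subspace_lborel[OF W])
  interpret PQ: pair_sigma_finite lborel "subspace_lborel ?W" by standard
  let ?f = "\<lambda>(s, y). \<phi> ((s *\<^sub>R u + y) \<bullet> u) *\<^sub>R G (s *\<^sub>R u + y)"
  have i: "integrable (lborel \<Otimes>\<^sub>M subspace_lborel ?W) ?f"
    using True unfolding subspace_lborel_split_line[OF H u]
    by (subst (asm) integrable_distr_eq) (auto simp: case_prod_unfold)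
  have "(\<integral>y. \<phi> (y \<bullet> u) *\<^sub>R G y \<partial>subspace_lborel H) = (\<integral>p. ?f p \<partial>(lborel \<Otimes>\<^sub>M subspace_lborel ?W))"
    by (subst subspace_lborel_split_line[OF H u], subst integral_distr) (auto simp: case_prod_unfold)
  also have "\<dots> = (\<integral>s. \<integral>y. ?f (s, y) \<partial>subspace_lborel ?W \<partial>lborel)"
    using PQ.integral_fst[OF i] by simp
  also have "(\<lambda>s. \<integral>y. ?f (s, y) \<partial>subspace_lborel ?W) = (\<lambda>s. 0)"
  proof
    fix s :: real
    have "(\<integral>y. ?f (s, y) \<partial>subspace_lborel ?W) = (\<integral>y. \<phi> s *\<^sub>R G (s *\<^sub>R u + y) \<partial>subspace_lborel ?W)"
    proof (rule integral_cong_AE)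
      show "AE y in subspace_lborel ?W. ?f (s, y) = \<phi> s *\<^sub>R G (s *\<^sub>R u + y)"
        using AE_subspace_lborel_in[OF W] by eventually_elim (use u in \<open>auto simp: inner_add_left dot_square_norm\<close>)
    qed (auto simp: case_prod_unfold)
    also have "\<dots> = 0" using z[of s] by (cases "\<phi> s = 0") auto
    finally show "(\<integral>y. ?f (s, y) \<partial>subspace_lborel ?W) = 0" .
  qed
  finally show ?thesis by simp
qed

text \<open>
  Along \<open>y\<close> the two Gaussians multiply to one with parameter \<open>t + |y|\<^sup>2\<close>, across \<open>y\<close> only the
  second is present.
\<close>

lemma nn_integral_gaussian_ridge:
  fixes H :: "'a::euclidean_space set"
  assumes H: "subspace H" and t: "t > 0" and y: "y \<in> H" "y \<noteq> 0"
  shows "(\<integral>\<^sup>+w. ennreal (exp (- (y \<bullet> w)\<^sup>2 - t * (norm w)\<^sup>2)) \<partial>subspace_lborel H)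
    = ennreal (sqrt pi ^ dim H * t powr (- ((dim H - 1) / 2)) * (t + (norm y)\<^sup>2) powr (- (1 / 2)))"
proof -
  define u where "u = (1 / norm y) *\<^sub>R y"
  have u: "norm u = 1" "u \<in> H" using y H by (auto simp: u_def subspace_scale)
  have yu: "y = norm y *\<^sub>R u" using y by (simp add: u_def)
  let ?W = "{x\<in>H. x \<bullet> u = 0}"
  have W: "subspace ?W" by (rule subspace_orthogonal_part[OF H])
  have d: "dim H = Suc (dim ?W)" by (rule dim_subspace_orthogonal_part[OF H u])
  have p: "t + (norm y)\<^sup>2 > 0" using t by (simp add: add_pos_nonneg)
  have "(\<integral>\<^sup>+w. ennreal (exp (- (y \<bullet> w)\<^sup>2 - t * (norm w)\<^sup>2)) \<partial>subspace_lborel H)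
    = (\<integral>\<^sup>+s. \<integral>\<^sup>+z. ennreal (exp (- (y \<bullet> (s *\<^sub>R u + z))\<^sup>2 - t * (norm (s *\<^sub>R u + z))\<^sup>2)) \<partial>subspace_lborel ?W \<partial>lborel)"
    by (rule nn_integral_subspace_line[OF H u]) measurable
  also have "\<dots> = (\<integral>\<^sup>+s. \<integral>\<^sup>+z. ennreal (exp (- (t + (norm y)\<^sup>2) * s\<^sup>2)) * ennreal (exp (- t * (norm z)\<^sup>2)) \<partial>subspace_lborel ?W \<partial>lborel)"
  proof (rule nn_integral_cong, rule nn_integral_cong_AE)
    fix s :: real
    show "AE z in subspace_lborel ?W. ennreal (exp (- (y \<bullet> (s *\<^sub>R u + z))\<^sup>2 - t * (norm (s *\<^sub>R u + z))\<^sup>2))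
       = ennreal (exp (- (t + (norm y)\<^sup>2) * s\<^sup>2)) * ennreal (exp (- t * (norm z)\<^sup>2))"
      using AE_subspace_lborel_in[OF W]
    proof eventually_elim
      case (elim z)
      then have z: "z \<bullet> u = 0" by simp
      have uu: "u \<bullet> u = 1" using u by (simp add: dot_square_norm)
      have "y \<bullet> (s *\<^sub>R u + z) = norm y * s" using z uu by (subst yu) (simp add: inner_add_right inner_commute)
      moreover have "(norm (s *\<^sub>R u + z))\<^sup>2 = s\<^sup>2 + (norm z)\<^sup>2"
        unfolding power2_norm_eq_inner using z uu by (simp add: inner_add inner_commute power2_eq_square[of s])
      ultimately have e: "- (y \<bullet> (s *\<^sub>R u + z))\<^sup>2 - t * (norm (s *\<^sub>R u + z))\<^sup>2 = (- (t + (norm y)\<^sup>2) * s\<^sup>2) + (- t * (norm z)\<^sup>2)"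
      proof (simp only:)
        have "- (n * s)\<^sup>2 - t * (s\<^sup>2 + m\<^sup>2) = (- (t + n\<^sup>2) * s\<^sup>2) + (- t * m\<^sup>2)" for n m :: real
          by (simp add: power_mult_distrib algebra_simps)
        then show "- (norm y * s)\<^sup>2 - t * (s\<^sup>2 + (norm z)\<^sup>2) = (- (t + (norm y)\<^sup>2) * s\<^sup>2) + (- t * (norm z)\<^sup>2)" .
      qed
      show ?case unfolding e by (simp only: exp_add ennreal_mult exp_ge_zero)
    qed
  qed
  also have "\<dots> = (\<integral>\<^sup>+s. ennreal (exp (- (t + (norm y)\<^sup>2) * s\<^sup>2)) * ennreal (sqrt (pi / t) ^ dim ?W) \<partial>lborel)"
    using nn_integral_gaussian_subspace[OF W t] by (subst nn_integral_cmult) auto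
  also have "\<dots> = ennreal (sqrt (pi / (t + (norm y)\<^sup>2))) * ennreal (sqrt (pi / t) ^ dim ?W)"
    using nn_integral_gaussian_line[OF p] by (subst nn_integral_multc) auto
  also have "\<dots> = ennreal (sqrt pi ^ dim H * t powr (- ((dim H - 1) / 2)) * (t + (norm y)\<^sup>2) powr (- (1 / 2)))"
  proof -
    have a: "sqrt (pi / (t + (norm y)\<^sup>2)) = sqrt pi * (t + (norm y)\<^sup>2) powr (- (1 / 2))"
      using p by (simp add: real_sqrt_divide powr_minus_divide powr_half_sqrt)
    have b: "sqrt (pi / t) ^ dim ?W = sqrt pi ^ dim ?W * t powr (- (dim ?W / 2))"
    proof -
      have "sqrt t ^ dim ?W = (t powr (1 / 2)) powr dim ?W"
        using t by (subst powr_realpow) (auto simp: powr_half_sqrt)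
      then have "sqrt (pi / t) ^ dim ?W = sqrt pi ^ dim ?W / t powr (dim ?W / 2)"
        by (simp add: real_sqrt_divide power_divide powr_powr)
      then show ?thesis by (simp only: powr_minus divide_inverse[of "sqrt pi ^ dim ?W"])
    qed
    show ?thesis unfolding a b d by (subst ennreal_mult[symmetric]) (auto simp: ac_simps)
  qed
  finally show ?thesis .
qed

lemma powr_decay_le:
  fixes t a b u :: real
  assumes "t > 0" "a \<ge> b" "b \<ge> 0" "u \<ge> 0"
  shows "(t + u) powr (- a) \<le> (min 1 t) powr (- a) * (1 + u) powr (- b)"
proof -
  have "min 1 t * (1 + u) \<le> t + u" using assms mult_left_le_one_le[of u "min 1 t"] by (auto simp: algebra_simps min_def)
  moreover have "min 1 t * (1 + u) > 0" using assms by simp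
  ultimately have "(t + u) powr (- a) \<le> (min 1 t * (1 + u)) powr (- a)"
    using assms by (intro powr_mono2') auto
  also have "\<dots> = (min 1 t) powr (- a) * (1 + u) powr (- a)" using assms by (simp add: powr_mult)
  also have "\<dots> \<le> (min 1 t) powr (- a) * (1 + u) powr (- b)"
    using assms by (intro mult_left_mono powr_mono) auto
  finally show ?thesis .
qed

lemma powr_difference_quotient:
  fixes a x :: real
  assumes "a > 0" "x > 0"
  shows "\<bar>real (Suc n) * (x powr (- a) - (x + 1 / real (Suc n)) powr (- a))\<bar> \<le> a * x powr (- (a + 1))"
    and "(\<lambda>n. real (Suc n) * (x powr (- a) - (x + 1 / real (Suc n)) powr (- a))) \<longlonglongrightarrow> a * x powr (- (a + 1))"
proof -
  let ?h = "\<lambda>n. 1 / real (Suc n)"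
  have D: "((\<lambda>x. x powr (- a)) has_real_derivative (- a * z powr (- (a + 1)))) (at z)" if "z > 0" for z
    by (rule DERIV_cong[OF has_real_derivative_powr[OF that]]) simp
  have h: "?h n > 0" for n by simp
  have "\<exists>z>x. z < x + ?h n \<and> (x + ?h n) powr (- a) - x powr (- a) = (x + ?h n - x) * (- a * z powr (- (a + 1)))"
    using assms h by (intro MVT2 D) auto
  then obtain z where z: "z > x" "(x + ?h n) powr (- a) - x powr (- a) = ?h n * (- a * z powr (- (a + 1)))" by auto
  have "real (Suc n) * (x powr (- a) - (x + ?h n) powr (- a)) = real (Suc n) * (?h n * (a * z powr (- (a + 1))))"
  proof -
    have "x powr (- a) - (x + ?h n) powr (- a) = ?h n * (a * z powr (- (a + 1)))" using z(2) by simp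
    then show ?thesis by (simp only:)
  qed
  also have "\<dots> = a * z powr (- (a + 1))" by simp
  finally have e: "real (Suc n) * (x powr (- a) - (x + ?h n) powr (- a)) = a * z powr (- (a + 1))" .
  show "\<bar>real (Suc n) * (x powr (- a) - (x + ?h n) powr (- a))\<bar> \<le> a * x powr (- (a + 1))"
    unfolding e using assms z(1) by (simp add: abs_mult powr_mono2')
  have "((\<lambda>h. ((x + h) powr (- a) - x powr (- a)) / h) \<longlongrightarrow> - a * x powr (- (a + 1))) (at 0)"
    using D[OF assms(2)] by (simp add: DERIV_def)
  moreover have "filterlim ?h (at 0) sequentially"
    unfolding filterlim_at using LIMSEQ_inverse_real_of_nat by (auto simp: inverse_eq_divide)
  ultimately have "(\<lambda>n. ((x + ?h n) powr (- a) - x powr (- a)) / ?h n) \<longlonglongrightarrow> - a * x powr (- (a + 1))"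
    by (rule filterlim_compose)
  from tendsto_minus[OF this]
  show "(\<lambda>n. real (Suc n) * (x powr (- a) - (x + ?h n) powr (- a))) \<longlonglongrightarrow> a * x powr (- (a + 1))"
    by (simp add: algebra_simps)
qed

text \<open>
  The average of \<open>exp (- (y \<bullet> w)\<^sup>2)\<close> over \<open>w\<close> makes \<open>G\<close> orthogonal to
  \<open>(t + |y|\<^sup>2) powr (- 1/2)\<close> for all \<open>t > 0\<close>.  Differentiation in \<open>t\<close> gives the exponents
  \<open>- 1/2 - l\<close>.  For large \<open>l\<close> these kernels are integrable, and rescaling \<open>y\<close> by \<open>sqrt t\<close>
  turns them into an approximate identity at 0.
\<close>

lemma hyperplane_transform_injective:
  fixes H :: "'a::euclidean_space set" and G :: "'a \<Rightarrow> complex"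
  assumes H: "subspace H" and m: "dim H > 0" and [measurable]: "G \<in> borel_measurable borel"
    and cont: "continuous_on H G"
    and decay: "\<And>y. y \<in> H \<Longrightarrow> norm (G y) \<le> C * (1 + (norm y)\<^sup>2) powr (- \<beta>)" and \<beta>: "\<beta> > (dim H - 1) / 2"
    and zero: "\<And>u s. u \<in> H \<Longrightarrow> norm u = 1 \<Longrightarrow> (\<integral>z. G (s *\<^sub>R u + z) \<partial>subspace_lborel {y\<in>H. y \<bullet> u = 0}) = 0"
  shows "G 0 = 0"
proof -
  let ?L = "subspace_lborel H"
  interpret S: sigma_finite_measure ?L by (rule sigma_finite_subspace_lborel[OF H])
  interpret PQ: pair_sigma_finite ?L ?L by standard
  have dH: "real (dim H - 1) = real (dim H) - 1" using m by simp
  have C: "C \<ge> 0" using decay[of 0] subspace_0[OF H] order_trans[OF norm_ge_zero] by fastforce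
  have \<beta>0: "\<beta> > 0"   proof -
    have "(dim H - 1) / 2 \<ge> 0" by simp
    then show ?thesis using \<beta> by linarith
  qed
  have int: "integrable ?L (\<lambda>y. (t + (norm y)\<^sup>2) powr (- a) *\<^sub>R G y)" if t: "t > 0" and a: "a \<ge> 1 / 2" for t a
  proof (rule integrableI_bounded)
    show "(\<lambda>y. (t + (norm y)\<^sup>2) powr (- a) *\<^sub>R G y) \<in> borel_measurable ?L" by measurable
    let ?K = "C * (min 1 t) powr (- a)"
    have "(\<integral>\<^sup>+y. ennreal (norm ((t + (norm y)\<^sup>2) powr (- a) *\<^sub>R G y)) \<partial>?L)
      \<le> (\<integral>\<^sup>+y. ennreal ?K * ennreal ((1 + (norm y)\<^sup>2) powr (- (\<beta> + 1 / 2))) \<partial>?L)"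
    proof (rule nn_integral_mono_AE)
      show "AE y in ?L. ennreal (norm ((t + (norm y)\<^sup>2) powr (- a) *\<^sub>R G y)) \<le> ennreal ?K * ennreal ((1 + (norm y)\<^sup>2) powr (- (\<beta> + 1 / 2)))"
        using AE_subspace_lborel_in[OF H]
      proof eventually_elim
        case (elim y)
        have "norm ((t + (norm y)\<^sup>2) powr (- a) *\<^sub>R G y) \<le> ((min 1 t) powr (- a) * (1 + (norm y)\<^sup>2) powr (- (1 / 2))) * (C * (1 + (norm y)\<^sup>2) powr (- \<beta>))"
          unfolding norm_scaleR using decay[OF elim] powr_decay_le[OF t a, of "(norm y)\<^sup>2"]
          by (intro mult_mono) auto
        also have "\<dots> = ?K * (1 + (norm y)\<^sup>2) powr (- (\<beta> + 1 / 2))"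
        proof -
          have "x powr (- \<beta>) * x powr (- (1 / 2)) = x powr (- (\<beta> + 1 / 2))" for x :: real
            by (simp flip: powr_add)
          note * = this
          show ?thesis unfolding *[symmetric] by (simp only: ac_simps)
        qed
        finally show ?case using C by (simp flip: ennreal_mult)
      qed
    qed
    also have "\<dots> = ennreal ?K * (\<integral>\<^sup>+y. ennreal ((1 + (norm y)\<^sup>2) powr (- (\<beta> + 1 / 2))) \<partial>?L)"
      by (rule nn_integral_cmult) measurable
    also have "\<dots> < \<infinity>"
      using nn_integral_inverse_power_finite[OF H, of 1 "\<beta> + 1 / 2"] \<beta> dH by (simp add: ennreal_mult_less_top)
    finally show "(\<integral>\<^sup>+y. ennreal (norm ((t + (norm y)\<^sup>2) powr (- a) *\<^sub>R G y)) \<partial>?L) < \<infinity>" .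
  qed
  have z1: "(\<integral>y. (t + (norm y)\<^sup>2) powr (- (1 / 2)) *\<^sub>R G y \<partial>?L) = 0" if t: "t > 0" for t
  proof -
    let ?k = "sqrt pi ^ dim H * t powr (- ((dim H - 1) / 2))"
    have k: "?k > 0" using t by simp
    let ?E = "\<lambda>y w. exp (- (y \<bullet> w)\<^sup>2 - t * (norm w)\<^sup>2)"
    let ?K = "\<lambda>y. ?k * (t + (norm y)\<^sup>2) powr (- (1 / 2))"
    have AEH: "AE y in ?L. y \<in> H \<and> y \<noteq> 0"
      using AE_subspace_lborel_in[OF H] AE_subspace_lborel_nonzero[OF H m] by eventually_elim simp
    have ii: "integrable (?L \<Otimes>\<^sub>M ?L) (\<lambda>(y, w). ?E y w *\<^sub>R G y)"
    proof (rule integrableI_bounded)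
      show "(\<lambda>(y, w). ?E y w *\<^sub>R G y) \<in> borel_measurable (?L \<Otimes>\<^sub>M ?L)" by measurable
      have "(\<integral>\<^sup>+x. ennreal (norm (case x of (y, w) \<Rightarrow> ?E y w *\<^sub>R G y)) \<partial>(?L \<Otimes>\<^sub>M ?L))
        = (\<integral>\<^sup>+y. \<integral>\<^sup>+w. ennreal (?E y w) * ennreal (norm (G y)) \<partial>?L \<partial>?L)"
        by (subst S.nn_integral_fst[symmetric]) (auto simp: ennreal_mult)
      also have "\<dots> = (\<integral>\<^sup>+y. (\<integral>\<^sup>+w. ennreal (?E y w) \<partial>?L) * ennreal (norm (G y)) \<partial>?L)"
        by (intro nn_integral_cong nn_integral_multc) measurable
      also have "\<dots> = (\<integral>\<^sup>+y. ennreal (norm (?k *\<^sub>R ((t + (norm y)\<^sup>2) powr (- (1 / 2)) *\<^sub>R G y))) \<partial>?L)"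
      proof (rule nn_integral_cong_AE)
        show "AE y in ?L. (\<integral>\<^sup>+w. ennreal (?E y w) \<partial>?L) * ennreal (norm (G y)) = ennreal (norm (?k *\<^sub>R ((t + (norm y)\<^sup>2) powr (- (1 / 2)) *\<^sub>R G y)))"
          using AEH
        proof eventually_elim
          case (elim y)
          show ?case using nn_integral_gaussian_ridge[OF H t, of y] elim k
            by (simp add: abs_mult ennreal_mult[symmetric] mult.assoc)
        qed
      qed
      also have "\<dots> < \<infinity>"
        using integrable_scaleR_right[of ?k, OF int[OF t, of "1 / 2"]] unfolding integrable_iff_bounded by auto
      finally show "(\<integral>\<^sup>+x. ennreal (norm (case x of (y, w) \<Rightarrow> ?E y w *\<^sub>R G y)) \<partial>(?L \<Otimes>\<^sub>M ?L)) < \<infinity>" .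
    qed
    have "(\<integral>y. \<integral>w. ?E y w *\<^sub>R G y \<partial>?L \<partial>?L) = (\<integral>w. \<integral>y. ?E y w *\<^sub>R G y \<partial>?L \<partial>?L)"
      using PQ.Fubini_integral[OF ii] by simp
    also have "\<dots> = (\<integral>w. 0 \<partial>?L)"
    proof (rule integral_cong_AE)
      show "AE w in ?L. (\<integral>y. ?E y w *\<^sub>R G y \<partial>?L) = 0"
        using AEH
      proof eventually_elim
        case (elim w)
        let ?u = "(1 / norm w) *\<^sub>R w"
        have u: "norm ?u = 1" "?u \<in> H" using elim H by (auto simp: subspace_scale)
        let ?phi = "\<lambda>s. exp (- (norm w * s)\<^sup>2 - t * (norm w)\<^sup>2)"
        have "(\<integral>y. ?phi (y \<bullet> ?u) *\<^sub>R G y \<partial>?L) = 0"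
          by (rule integral_ridge_zero[OF H u]) (use zero[OF u(2,1)] in auto)
        moreover have "norm w * (y \<bullet> ?u) = y \<bullet> w" for y using elim by simp
        ultimately show ?case by simp
      qed
    qed auto
    also have "(\<integral>y. \<integral>w. ?E y w *\<^sub>R G y \<partial>?L \<partial>?L) = (\<integral>y. ?k *\<^sub>R ((t + (norm y)\<^sup>2) powr (- (1 / 2)) *\<^sub>R G y) \<partial>?L)"
    proof (rule integral_cong_AE)
      show "AE y in ?L. (\<integral>w. ?E y w *\<^sub>R G y \<partial>?L) = ?k *\<^sub>R ((t + (norm y)\<^sup>2) powr (- (1 / 2)) *\<^sub>R G y)"
        using AEH
      proof eventually_elim
        case (elim y)
        have "has_bochner_integral ?L (?E y) (?K y)"
          using nn_integral_gaussian_ridge[OF H t, of y] elim k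
          by (intro has_bochner_integral_nn_integral) auto
        then have "(\<integral>w. ?E y w \<partial>?L) = ?K y" "integrable ?L (?E y)" by (auto simp: has_bochner_integral_iff)
        then show ?case by simp
      qed
    qed auto
    finally have "(\<integral>y. ?k *\<^sub>R ((t + (norm y)\<^sup>2) powr (- (1 / 2)) *\<^sub>R G y) \<partial>?L) = 0" by simp
    moreover have "(\<integral>y. ?k *\<^sub>R ((t + (norm y)\<^sup>2) powr (- (1 / 2)) *\<^sub>R G y) \<partial>?L) = ?k *\<^sub>R (\<integral>y. (t + (norm y)\<^sup>2) powr (- (1 / 2)) *\<^sub>R G y \<partial>?L)"
      by (rule integral_scaleR_right)
    ultimately have "?k *\<^sub>R (\<integral>y. (t + (norm y)\<^sup>2) powr (- (1 / 2)) *\<^sub>R G y \<partial>?L) = 0" by (simp only:)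
    then show ?thesis unfolding scaleR_eq_0_iff using k by linarith
  qed
  have step: "(\<integral>y. (t + (norm y)\<^sup>2) powr (- (a + 1)) *\<^sub>R G y \<partial>?L) = 0"
    if a: "a \<ge> 1 / 2" and t: "t > 0" and z: "\<And>t. t > 0 \<Longrightarrow> (\<integral>y. (t + (norm y)\<^sup>2) powr (- a) *\<^sub>R G y \<partial>?L) = 0" for t a
  proof -
    have p: "t + (norm y)\<^sup>2 > 0" for y :: 'a using t by (simp add: add_pos_nonneg)
    let ?s = "\<lambda>n y. (real (Suc n) * ((t + (norm y)\<^sup>2) powr (- a) - (t + (norm y)\<^sup>2 + 1 / real (Suc n)) powr (- a))) *\<^sub>R G y"
    have "(\<lambda>n. \<integral>y. ?s n y \<partial>?L) \<longlonglongrightarrow> (\<integral>y. (a * (t + (norm y)\<^sup>2) powr (- (a + 1))) *\<^sub>R G y \<partial>?L)"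
    proof (rule integral_dominated_convergence)
      show "integrable ?L (\<lambda>y. norm ((a * (t + (norm y)\<^sup>2) powr (- (a + 1))) *\<^sub>R G y))"
        using integrable_scaleR_right[of a, OF int[OF t, of "a + 1"]] a by (intro integrable_norm) simp
      show "AE y in ?L. (\<lambda>n. ?s n y) \<longlonglongrightarrow> (a * (t + (norm y)\<^sup>2) powr (- (a + 1))) *\<^sub>R G y"
        using powr_difference_quotient(2)[OF _ p] a by (intro AE_I2 tendsto_scaleR tendsto_const) auto
      show "AE y in ?L. norm (?s n y) \<le> norm ((a * (t + (norm y)\<^sup>2) powr (- (a + 1))) *\<^sub>R G y)" for n
        unfolding norm_scaleR using powr_difference_quotient(1)[OF _ p] a
        by (intro AE_I2 mult_right_mono) (auto intro: order_trans[OF _ abs_ge_self])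
    qed measurable
    moreover have "(\<integral>y. ?s n y \<partial>?L) = 0" for n
    proof -
      have "?s n = (\<lambda>y. real (Suc n) *\<^sub>R ((t + (norm y)\<^sup>2) powr (- a) *\<^sub>R G y - ((t + 1 / real (Suc n)) + (norm y)\<^sup>2) powr (- a) *\<^sub>R G y))"
        by (auto simp: scaleR_diff_left algebra_simps)
      then have "(\<integral>y. ?s n y \<partial>?L) = real (Suc n) *\<^sub>R ((\<integral>y. (t + (norm y)\<^sup>2) powr (- a) *\<^sub>R G y \<partial>?L) - (\<integral>y. ((t + 1 / real (Suc n)) + (norm y)\<^sup>2) powr (- a) *\<^sub>R G y \<partial>?L))"
        using int[OF t a] int[OF _ a, of "t + 1 / real (Suc n)"] t by (simp add: add_pos_pos)
      then show ?thesis using z[OF t] z[of "t + 1 / real (Suc n)"] t by (simp add: add_pos_pos)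
    qed
    ultimately have "(\<integral>y. (a * (t + (norm y)\<^sup>2) powr (- (a + 1))) *\<^sub>R G y \<partial>?L) = 0"
      by (simp add: LIMSEQ_const_iff)
    moreover have "(\<integral>y. (a * (t + (norm y)\<^sup>2) powr (- (a + 1))) *\<^sub>R G y \<partial>?L) = a *\<^sub>R (\<integral>y. (t + (norm y)\<^sup>2) powr (- (a + 1)) *\<^sub>R G y \<partial>?L)"
      by (simp flip: scaleR_scaleR)
    ultimately show ?thesis using a by simp
  qed
  have zl: "(\<integral>y. (t + (norm y)\<^sup>2) powr (- (1 / 2 + real l)) *\<^sub>R G y \<partial>?L) = 0" if "t > 0" for t l
    using that
  proof (induction l arbitrary: t)
    case 0
    then show ?case using z1 by simp
  next
    case (Suc l)
    show ?case using step[of "1 / 2 + real l" t] Suc by (simp add: add.commute add.left_commute)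
  qed
  \<comment> \<open>an exponent with \<open>2 a > dim H\<close>, so that the kernel is integrable\<close>
  define a where "a = 1 / 2 + real (dim H)"
  let ?q = "\<lambda>z::'a. (1 + (norm z)\<^sup>2) powr (- a)"
  have q0: "?q z > 0" for z using add_pos_nonneg[of 1 "(norm z)\<^sup>2"] by simp
  have qint: "integrable ?L ?q"
    using nn_integral_inverse_power_finite[OF H, of 1 a] by (intro integrableI_bounded) (auto simp: a_def)
  have scaled: "(\<integral>z. ?q z *\<^sub>R G ((1 / real (Suc n)) *\<^sub>R z) \<partial>?L) = 0" for n
  proof -
    let ?e = "1 / real (Suc n)"
    have e: "?e > 0" by simp
    have "0 = (\<integral>y. (?e\<^sup>2 + (norm y)\<^sup>2) powr (- a) *\<^sub>R G y \<partial>?L)" using zl[of "?e\<^sup>2" "dim H"] by (simp add: a_def)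
    also have "\<dots> = ?e ^ dim H *\<^sub>R (\<integral>z. (?e\<^sup>2 + (norm (?e *\<^sub>R z))\<^sup>2) powr (- a) *\<^sub>R G (?e *\<^sub>R z) \<partial>?L)"
      by (rule integral_subspace_scale[OF H e]) measurable
    also have "(\<lambda>z. (?e\<^sup>2 + (norm (?e *\<^sub>R z))\<^sup>2) powr (- a) *\<^sub>R G (?e *\<^sub>R z)) = (\<lambda>z. (?e\<^sup>2) powr (- a) *\<^sub>R (?q z *\<^sub>R G (?e *\<^sub>R z)))"
    proof
      fix z :: 'a
      have "?e\<^sup>2 + (norm (?e *\<^sub>R z))\<^sup>2 = ?e\<^sup>2 * (1 + (norm z)\<^sup>2)" by (simp add: power_mult_distrib power_divide field_simps)
      then show "(?e\<^sup>2 + (norm (?e *\<^sub>R z))\<^sup>2) powr (- a) *\<^sub>R G (?e *\<^sub>R z) = (?e\<^sup>2) powr (- a) *\<^sub>R (?q z *\<^sub>R G (?e *\<^sub>R z))"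
        by (simp only: powr_mult scaleR_scaleR)
    qed
    finally have "?e ^ dim H *\<^sub>R ((?e\<^sup>2) powr (- a) *\<^sub>R (\<integral>z. ?q z *\<^sub>R G (?e *\<^sub>R z) \<partial>?L)) = 0"
      unfolding integral_scaleR_right by (rule sym)
    moreover have "?e ^ dim H \<noteq> 0" "(?e\<^sup>2) powr (- a) \<noteq> 0" by simp_all
    ultimately show ?thesis unfolding scaleR_eq_0_iff by blast
  qed
  have "(\<lambda>n. \<integral>z. ?q z *\<^sub>R G ((1 / real (Suc n)) *\<^sub>R z) \<partial>?L) \<longlonglongrightarrow> (\<integral>z. ?q z *\<^sub>R G 0 \<partial>?L)"
  proof (rule integral_dominated_convergence)
    show "integrable ?L (\<lambda>z. C * ?q z)" using qint by simp
    show "AE z in ?L. (\<lambda>n. ?q z *\<^sub>R G ((1 / real (Suc n)) *\<^sub>R z)) \<longlonglongrightarrow> ?q z *\<^sub>R G 0"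
      using AE_subspace_lborel_in[OF H]
    proof eventually_elim
      case (elim z)
      have "(\<lambda>n. (1 / real (Suc n)) *\<^sub>R z) \<longlonglongrightarrow> 0 *\<^sub>R z"
        using LIMSEQ_inverse_real_of_nat by (intro tendsto_scaleR tendsto_const) (simp add: inverse_eq_divide)
      then have "(\<lambda>n. G ((1 / real (Suc n)) *\<^sub>R z)) \<longlonglongrightarrow> G 0"
        using elim H by (intro continuous_on_tendsto_compose[OF cont]) (auto simp: subspace_scale subspace_0)
      then show ?case by (intro tendsto_scaleR tendsto_const)
    qed
    show "AE z in ?L. norm (?q z *\<^sub>R G ((1 / real (Suc n)) *\<^sub>R z)) \<le> C * ?q z" for n
      using AE_subspace_lborel_in[OF H]
    proof eventually_elim
      case (elim z)
      let ?y = "(1 / real (Suc n)) *\<^sub>R z"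
      have "norm (G ?y) \<le> C * (1 + (norm ?y)\<^sup>2) powr (- \<beta>)" using elim H by (intro decay) (simp add: subspace_scale)
      also have "\<dots> \<le> C * 1" using C \<beta>0 powr_mono2'[of "- \<beta>" 1 "1 + (norm ?y)\<^sup>2"] by (intro mult_left_mono) auto
      finally show ?case using q0[of z] by (simp add: mult.commute mult_left_mono)
    qed
  qed measurable
  then have "(\<integral>z. ?q z *\<^sub>R G 0 \<partial>?L) = 0" unfolding scaled by (simp add: LIMSEQ_const_iff)
  then have "(\<integral>z. ?q z \<partial>?L) *\<^sub>R G 0 = 0" using qint by simp
  moreover have "(\<integral>z. ?q z \<partial>?L) \<noteq> 0"
  proof
    assume "(\<integral>z. ?q z \<partial>?L) = 0"
    then have "AE z in ?L. ?q z = 0"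
      using integral_nonneg_eq_0_iff_AE[OF qint] q0 by (simp add: less_imp_le)
    then have "AE z in ?L. False" by eventually_elim (use q0 in \<open>metis less_irrefl\<close>)
    then show False using subspace_lborel_not_null[OF H] by simp
  qed
  ultimately show ?thesis by simp
qed

section \<open>Functions whose integrals over distant hyperplanes vanish\<close>

lemma DERIV_pos_part_power:
  assumes "l \<ge> 1"
  shows "((\<lambda>x::real. max 0 x ^ Suc l) has_real_derivative (real (Suc l) * max 0 x ^ l)) (at x)"
proof -
  consider "x > 0" | "x < 0" | "x = 0" by linarith
  then show ?thesis
  proof cases
    case 1
    have "((\<lambda>x. x ^ Suc l) has_real_derivative (real (Suc l) * x ^ l)) (at x)"
      using DERIV_pow[of "Suc l" x] by simp
    then have "((\<lambda>x::real. max 0 x ^ Suc l) has_real_derivative (real (Suc l) * x ^ l)) (at x)"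
      by (rule has_field_derivative_transform_within_open[where S="{0<..}"]) (use 1 in auto)
    then show ?thesis using 1 by (simp add: max_def)
  next
    case 2
    have "((\<lambda>x. 0) has_real_derivative 0) (at x)" by simp
    then have "((\<lambda>x::real. max 0 x ^ Suc l) has_real_derivative 0) (at x)"
      by (rule has_field_derivative_transform_within_open[where S="{..<0}"]) (use 2 in auto)
    moreover have "real (Suc l) * max 0 x ^ l = 0" using 2 assms by (simp add: power_0_left)
    ultimately show ?thesis by (simp only:)
  next
    case 3
    have "(\<lambda>h. max 0 h ^ Suc l / h) \<midarrow>0\<rightarrow> (0::real)"
    proof (rule tendsto_0_le[where K=1])
      show "((\<lambda>h. h ^ l) \<longlongrightarrow> (0::real)) (at 0)"
        using tendsto_power[OF tendsto_ident_at[of "0::real" UNIV], of l] assms by (simp add: power_0_left)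
      show "\<forall>\<^sub>F h in at 0. norm (max 0 h ^ Suc l / h) \<le> norm (h ^ l :: real) * 1"
        by (intro always_eventually allI) (auto simp: max_def divide_simps abs_mult power_abs intro: mult_nonneg_nonpos)
    qed
    then show ?thesis using 3 assms by (simp add: DERIV_def power_0_left)
  qed
qed

lemma pos_part_power_diff_le:
  fixes x x' M :: real
  assumes "l \<ge> 1" "\<bar>x\<bar> \<le> M" "\<bar>x'\<bar> \<le> M"
  shows "\<bar>max 0 x' ^ Suc l - max 0 x ^ Suc l\<bar> \<le> (real (Suc l) * M ^ l) * \<bar>x' - x\<bar>"
proof -
  have "norm (max 0 x' ^ Suc l - max 0 x ^ Suc l) \<le> (real (Suc l) * M ^ l) * norm (x' - x)"
  proof (rule field_differentiable_bound[where S="{-M..M}" and f'="\<lambda>x. real (Suc l) * max 0 x ^ l"])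
    show "((\<lambda>x. max 0 x ^ Suc l) has_real_derivative real (Suc l) * max 0 z ^ l) (at z within {-M..M})" for z
      by (rule has_field_derivative_at_within[OF DERIV_pos_part_power[OF assms(1)]])
    show "norm (real (Suc l) * max 0 z ^ l) \<le> real (Suc l) * M ^ l" if "z \<in> {-M..M}" for z
      using that by (auto simp: abs_mult intro!: mult_left_mono power_mono)
  qed (use assms in auto)
  then show ?thesis by simp
qed

text \<open>
  The truncated powers of exponent at least 2 are differentiable everywhere; this form of
  the derivative is the one used for differentiation under the integral.
\<close>

lemma pos_part_power_quotient:
  fixes x c :: real
  assumes "l \<ge> 1"
  shows "(\<lambda>n. real (Suc n) * (max 0 (x + c / real (Suc n)) ^ Suc l - max 0 x ^ Suc l)) \<longlonglongrightarrow> real (Suc l) * max 0 x ^ l * c"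
proof -
  have "((\<lambda>h. max 0 (x + h * c) ^ Suc l) has_real_derivative real (Suc l) * max 0 (x + 0 * c) ^ l * c) (at 0)"
    by (rule DERIV_chain2[where f="\<lambda>x. max 0 x ^ Suc l" and g="\<lambda>h. x + h * c", OF DERIV_pos_part_power[OF assms]])
       (auto intro!: derivative_eq_intros)
  then have "((\<lambda>h. (max 0 (x + h * c) ^ Suc l - max 0 x ^ Suc l) / h) \<longlongrightarrow> real (Suc l) * max 0 x ^ l * c) (at 0)"
    by (simp add: DERIV_def)
  moreover have "filterlim (\<lambda>n. 1 / real (Suc n)) (at 0) sequentially"
    unfolding filterlim_at using LIMSEQ_inverse_real_of_nat by (auto simp: inverse_eq_divide)
  ultimately have "(\<lambda>n. (max 0 (x + 1 / real (Suc n) * c) ^ Suc l - max 0 x ^ Suc l) / (1 / real (Suc n))) \<longlonglongrightarrow> real (Suc l) * max 0 x ^ l * c"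
    by (rule filterlim_compose)
  then show ?thesis by (simp add: mult.commute)
qed

definition poly_growth :: "('a::real_normed_vector \<Rightarrow> real) \<Rightarrow> bool" where
  "poly_growth g \<longleftrightarrow> (\<exists>K M. \<forall>y. \<bar>g y\<bar> \<le> K * (1 + (norm y)\<^sup>2) ^ M)"

lemma one_plus_ge: "1 \<le> 1 + (norm y)\<^sup>2" by simp

lemma poly_growthI: "(\<And>y. \<bar>g y\<bar> \<le> K * (1 + (norm y)\<^sup>2) ^ M) \<Longrightarrow> poly_growth g"
  unfolding poly_growth_def by blast

lemma poly_growthE:
  assumes "poly_growth g"
  obtains K M where "K \<ge> 0" "\<And>y. \<bar>g y\<bar> \<le> K * (1 + (norm y)\<^sup>2) ^ M"
proof -
  obtain K M where KM: "\<And>y. \<bar>g y\<bar> \<le> K * (1 + (norm y)\<^sup>2) ^ M" using assms unfolding poly_growth_def by blast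
  have "K \<ge> 0" using KM[of 0] by simp
  then show ?thesis using that KM by blast
qed

lemma poly_growth_mono: "poly_growth g \<Longrightarrow> (\<And>y. \<bar>f y\<bar> \<le> \<bar>g y\<bar>) \<Longrightarrow> poly_growth f"
  unfolding poly_growth_def by (meson order_trans)

lemma poly_growth_const: "poly_growth (\<lambda>_. c)"
  by (rule poly_growthI[of _ "\<bar>c\<bar>" 0]) simp

lemma poly_growth_norm: "poly_growth (\<lambda>y. norm y)"
proof (rule poly_growthI[of _ 1 1])
  fix y :: 'a
  have "2 * norm y \<le> 1 + (norm y)\<^sup>2" using zero_le_power2[of "norm y - 1"] by (simp add: power2_diff)
  then show "\<bar>norm y\<bar> \<le> 1 * (1 + (norm y)\<^sup>2) ^ 1" by simp (use norm_ge_zero[of y] in linarith)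
qed

lemma poly_growth_add:
  assumes "poly_growth f" "poly_growth g" shows "poly_growth (\<lambda>y. f y + g y)"
proof -
  obtain K M where f: "K \<ge> 0" "\<And>y. \<bar>f y\<bar> \<le> K * (1 + (norm y)\<^sup>2) ^ M" using poly_growthE[OF assms(1)] by blast
  obtain K' M' where g: "K' \<ge> 0" "\<And>y. \<bar>g y\<bar> \<le> K' * (1 + (norm y)\<^sup>2) ^ M'" using poly_growthE[OF assms(2)] by blast
  show ?thesis
  proof (rule poly_growthI[of _ "K + K'" "M + M'"])
    fix y :: 'a
    have "\<bar>f y\<bar> \<le> K * (1 + (norm y)\<^sup>2) ^ (M + M')"
      using f(2)[of y] by (rule order_trans) (intro mult_left_mono power_increasing f(1), auto)
    moreover have "\<bar>g y\<bar> \<le> K' * (1 + (norm y)\<^sup>2) ^ (M + M')"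
      using g(2)[of y] by (rule order_trans) (intro mult_left_mono power_increasing g(1), auto)
    ultimately show "\<bar>f y + g y\<bar> \<le> (K + K') * (1 + (norm y)\<^sup>2) ^ (M + M')"
      by (simp add: distrib_right)
  qed
qed

lemma poly_growth_mult:
  assumes "poly_growth f" "poly_growth g" shows "poly_growth (\<lambda>y. f y * g y)"
proof -
  obtain K M where f: "K \<ge> 0" "\<And>y. \<bar>f y\<bar> \<le> K * (1 + (norm y)\<^sup>2) ^ M" using poly_growthE[OF assms(1)] by blast
  obtain K' M' where g: "K' \<ge> 0" "\<And>y. \<bar>g y\<bar> \<le> K' * (1 + (norm y)\<^sup>2) ^ M'" using poly_growthE[OF assms(2)] by blast
  show ?thesis
  proof (rule poly_growthI[of _ "K * K'" "M + M'"])
    fix y :: 'a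
    have "\<bar>f y\<bar> * \<bar>g y\<bar> \<le> (K * (1 + (norm y)\<^sup>2) ^ M) * (K' * (1 + (norm y)\<^sup>2) ^ M')"
      by (rule mult_mono[OF f(2) g(2)]) (use f(1) in auto)
    then show "\<bar>f y * g y\<bar> \<le> K * K' * (1 + (norm y)\<^sup>2) ^ (M + M')"
      by (simp add: abs_mult power_add ac_simps)
  qed
qed

lemma poly_growth_power: "poly_growth f \<Longrightarrow> poly_growth (\<lambda>y. f y ^ n)"
  by (induction n) (auto intro: poly_growth_const poly_growth_mult)

lemma poly_growth_inner: "poly_growth (\<lambda>y::'a::euclidean_space. y \<bullet> v)"
  by (rule poly_growth_mono[OF poly_growth_mult[OF poly_growth_norm poly_growth_const[of "norm v"]]])
     (simp add: Cauchy_Schwarz_ineq2 abs_mult)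

lemma poly_growth_pos_part: "poly_growth f \<Longrightarrow> poly_growth (\<lambda>y. max 0 (f y - t))"
proof -
  assume "poly_growth f"
  then have "poly_growth (\<lambda>y. f y + (- t))" by (rule poly_growth_add[OF _ poly_growth_const])
  then show ?thesis by (rule poly_growth_mono) auto
qed

lemma poly_growth_real_polynomial:
  fixes q :: "'a::euclidean_space \<Rightarrow> real"
  assumes "real_polynomial_function q" shows "poly_growth q"
  using assms
proof (induction rule: real_polynomial_function.induct)
  case (linear f)
  then obtain K where K: "K \<ge> 0" "\<And>y. norm (f y) \<le> norm y * K" using bounded_linear.nonneg_bounded by blast
  then show ?case
    by (intro poly_growth_mono[OF poly_growth_mult[OF poly_growth_norm poly_growth_const[of K]]])
       (simp add: abs_mult)
qed (auto intro: poly_growth_const poly_growth_add poly_growth_mult)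

text \<open>
  A null ball would make all its dilates null, and these exhaust the space.
\<close>

lemma emeasure_ball_subspace_pos:
  fixes H :: "'a::euclidean_space set"
  assumes H: "subspace H" and y: "y \<in> H" and r: "r > 0"
  shows "emeasure (subspace_lborel H) (ball y r) > 0"
proof (rule ccontr)
  let ?L = "subspace_lborel H"
  assume "\<not> ?thesis"
  then have z: "emeasure ?L (ball y r) = 0" by simp
  have "emeasure ?L (ball y r) = emeasure (distr ?L borel (\<lambda>x. y + x)) (ball y r)"
    by (simp add: subspace_lborel_translate[OF H y])
  also have "\<dots> = emeasure ?L ((\<lambda>x. y + x) -` ball y r)" by (subst emeasure_distr) auto
  also have "(\<lambda>x. y + x) -` ball y r = ball 0 r" by (auto simp: dist_norm)
  finally have z0: "emeasure ?L (ball 0 r) = 0" using z by simp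
  have zn: "emeasure ?L (ball 0 (real (Suc n) * r)) = 0" for n
  proof -
    have "emeasure ?L (ball 0 (real (Suc n) * r)) = (\<integral>\<^sup>+x. indicator (ball 0 (real (Suc n) * r)) x \<partial>?L)" by simp
    also have "\<dots> = ennreal (real (Suc n) ^ dim H) * (\<integral>\<^sup>+x. indicator (ball 0 (real (Suc n) * r)) (real (Suc n) *\<^sub>R x) \<partial>?L)"
      by (rule nn_integral_subspace_scale[OF H]) (auto intro!: borel_measurable_indicator)
    also have "(\<lambda>x. indicator (ball 0 (real (Suc n) * r)) (real (Suc n) *\<^sub>R x :: 'a) :: ennreal) = indicator (ball 0 r)"
    proof
      fix x :: 'a
      have "real (Suc n) *\<^sub>R x \<in> ball 0 (real (Suc n) * r) \<longleftrightarrow> real (Suc n) * norm x < real (Suc n) * r" by simp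
      also have "\<dots> \<longleftrightarrow> x \<in> ball 0 r" by (subst mult_less_cancel_left_pos) auto
      finally show "indicator (ball 0 (real (Suc n) * r)) (real (Suc n) *\<^sub>R x) = (indicator (ball 0 r) x :: ennreal)"
        by (simp only: indicator_def)
    qed
    finally show ?thesis using z0 by simp
  qed
  have "(\<Union>n. ball (0::'a) (real (Suc n) * r)) \<in> null_sets ?L"
    using zn by (intro null_sets_UN') (auto simp: null_sets_def)
  moreover have "(\<Union>n. ball (0::'a) (real (Suc n) * r)) = UNIV"
  proof -
    have "\<exists>n. norm x < real (Suc n) * r" for x :: 'a
    proof -
      obtain n where "norm x / r < real n" using reals_Archimedean2 by blast
      then have "norm x < real n * r" using r by (simp add: field_simps)
      also have "\<dots> \<le> real (Suc n) * r" using r by simp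
      finally show ?thesis by blast
    qed
    then show ?thesis by auto
  qed
  ultimately have "AE x in ?L. False" by (simp add: AE_iff_null)
  then show False using subspace_lborel_not_null[OF H] by simp
qed

locale rapid_decay =
  fixes H :: "'a::euclidean_space set" and F :: "'a \<Rightarrow> complex" and R :: real
  assumes subH: "subspace H" and dimH: "dim H > 0" and R: "R \<ge> 0"
    and F_borel [measurable]: "F \<in> borel_measurable borel" and F_cont: "continuous_on H F"
    and F_decay: "\<And>M. \<exists>C. \<forall>y\<in>H. norm (F y) \<le> C * (1 + (norm y)\<^sup>2) powr (- real M)"
    and F_zero: "\<And>u s. u \<in> H \<Longrightarrow> norm u = 1 \<Longrightarrow> s > R \<Longrightarrow>
        (\<integral>z. F (s *\<^sub>R u + z) \<partial>subspace_lborel {y\<in>H. y \<bullet> u = 0}) = 0"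
begin

abbreviation "L \<equiv> subspace_lborel H"

lemma integrable_poly_growth:
  assumes "poly_growth g" and [measurable]: "g \<in> borel_measurable borel"
  shows "integrable L (\<lambda>y. g y *\<^sub>R F y)"
proof -
  obtain K M where K: "K \<ge> 0" "\<And>y. \<bar>g y\<bar> \<le> K * (1 + (norm y)\<^sup>2) ^ M" using poly_growthE[OF assms(1)] by blast
  define P where "P = M + dim H + 1"
  obtain C where C: "\<forall>y\<in>H. norm (F y) \<le> C * (1 + (norm y)\<^sup>2) powr (- real P)" using F_decay by blast
  have C0: "C \<ge> 0" using C subspace_0[OF subH] order_trans[OF norm_ge_zero] by fastforce
  show ?thesis
  proof (rule integrableI_bounded)
    have "(\<integral>\<^sup>+y. ennreal (norm (g y *\<^sub>R F y)) \<partial>L) \<le> (\<integral>\<^sup>+y. ennreal (K * C) * ennreal ((1 + (norm y)\<^sup>2) powr (- (real (dim H) + 1))) \<partial>L)"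
    proof (rule nn_integral_mono_AE)
      show "AE y in L. ennreal (norm (g y *\<^sub>R F y)) \<le> ennreal (K * C) * ennreal ((1 + (norm y)\<^sup>2) powr (- (real (dim H) + 1)))"
        using AE_subspace_lborel_in[OF subH]
      proof eventually_elim
        case (elim y)
        let ?x = "1 + (norm y)\<^sup>2"
        have x: "?x > 0" using one_plus_ge[of y] by linarith
        have "norm (g y *\<^sub>R F y) \<le> (K * ?x ^ M) * (C * ?x powr (- real P))"
          unfolding norm_scaleR using C elim K x by (intro mult_mono) auto
        also have "\<dots> = K * C * (?x powr real M * ?x powr (- real P))" using x by (simp add: powr_realpow)
        also have "?x powr real M * ?x powr (- real P) = ?x powr (- (real (dim H) + 1))"
          by (simp add: P_def flip: powr_add)
        finally show ?case using K C0 by (simp flip: ennreal_mult)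
      qed
    qed
    also have "\<dots> = ennreal (K * C) * (\<integral>\<^sup>+y. ennreal ((1 + (norm y)\<^sup>2) powr (- (real (dim H) + 1))) \<partial>L)"
      by (rule nn_integral_cmult) measurable
    also have "\<dots> < \<infinity>"
      using nn_integral_inverse_power_finite[OF subH, of 1 "real (dim H) + 1"] by (simp add: ennreal_mult_less_top)
    finally show "(\<integral>\<^sup>+y. ennreal (norm (g y *\<^sub>R F y)) \<partial>L) < \<infinity>" .
  qed simp
qed

text \<open>
  These are the weights \<open>q\<close> for which \<open>q F\<close> inherits from \<open>F\<close> the orthogonality to the
  functions supported by half-spaces that miss the ball.  Truncated powers represent these
  functions because they may be differentiated in \<open>w\<close>.
\<close>

definition annihilated :: "('a \<Rightarrow> real) \<Rightarrow> bool" where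
  "annihilated q \<longleftrightarrow> poly_growth q \<and> q \<in> borel_measurable borel \<and>
     (\<forall>l w t. l \<ge> 1 \<longrightarrow> w \<in> H \<longrightarrow> R * norm w < t \<longrightarrow> (\<integral>y. (max 0 (y \<bullet> w - t) ^ l * q y) *\<^sub>R F y \<partial>L) = 0)"

lemma annihilated_1: "annihilated (\<lambda>_. 1)"
  unfolding annihilated_def
proof (intro conjI allI impI)
  fix l :: nat and w :: 'a and t :: real
  assume l: "1 \<le> l" and w: "w \<in> H" and t: "R * norm w < t"
  show "(\<integral>y. (max 0 (y \<bullet> w - t) ^ l * 1) *\<^sub>R F y \<partial>L) = 0"
  proof (cases "w = 0")
    case True
    then show ?thesis using t l by (simp add: power_0_left)
  next
    case False
    let ?u = "(1 / norm w) *\<^sub>R w"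
    have u: "norm ?u = 1" "?u \<in> H" using False w subH by (auto simp: subspace_scale)
    have "(\<integral>y. (max 0 (norm w * (y \<bullet> ?u) - t) ^ l) *\<^sub>R F y \<partial>L) = 0"
    proof (rule integral_ridge_zero[OF subH u])
      fix s :: real assume "max 0 (norm w * s - t) ^ l \<noteq> 0"
      then have "t < norm w * s" using l by (auto simp: max_def power_0_left split: if_splits)
      then have "norm w * R < norm w * s" using t by (simp add: mult.commute)
      then have "R < s" using False by simp
      then show "(\<integral>z. F (s *\<^sub>R ?u + z) \<partial>subspace_lborel {y \<in> H. y \<bullet> ?u = 0}) = 0" by (rule F_zero[OF u(2,1)])
    qed auto
    moreover have "norm w * (y \<bullet> ?u) = y \<bullet> w" for y using False by simp
    ultimately show ?thesis by simp
  qed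
qed (auto intro: poly_growth_const)

text \<open>
  The derivative of \<open>max 0 (y \<bullet> w - t)\<close> to the power \<open>l + 1\<close> in \<open>w\<close> along \<open>v\<close> is
  \<open>(l + 1) (y \<bullet> v)\<close> times the \<open>l\<close>-th power, and the condition \<open>R |w| < t\<close> survives small
  changes of \<open>w\<close>.
\<close>

lemma annihilated_inner:
  assumes q: "annihilated q" and v: "v \<in> H"
  shows "annihilated (\<lambda>y. (y \<bullet> v) * q y)"
  unfolding annihilated_def
proof (intro conjI allI impI)
  have qg: "poly_growth q" and [measurable]: "q \<in> borel_measurable borel" using q by (auto simp: annihilated_def)
  show "poly_growth (\<lambda>y. (y \<bullet> v) * q y)" by (intro poly_growth_mult poly_growth_inner qg)
  show "(\<lambda>y. (y \<bullet> v) * q y) \<in> borel_measurable borel" by measurable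
  fix l :: nat and w :: 'a and t :: real
  assume l: "1 \<le> l" and w: "w \<in> H" and t: "R * norm w < t"
  let ?w = "\<lambda>n. w + (1 / real (Suc n)) *\<^sub>R v"
  let ?p = "\<lambda>w y. max 0 (y \<bullet> w - t) ^ Suc l"
  let ?s = "\<lambda>n y. (real (Suc n) * (?p (?w n) y - ?p w y) * q y) *\<^sub>R F y"
  let ?d = "\<lambda>y. (real (Suc l) * max 0 (y \<bullet> w - t) ^ l * (y \<bullet> v) * q y) *\<^sub>R F y"
  let ?M = "\<lambda>y. norm y * (norm w + norm v) + \<bar>t\<bar>"
  let ?b = "\<lambda>y. (real (Suc l) * ?M y ^ l) * norm y * norm v * \<bar>q y\<bar>"
  have bg: "poly_growth ?b"
    by (intro poly_growth_mult poly_growth_power poly_growth_add poly_growth_const poly_growth_norm poly_growth_mono[OF qg]) auto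
  have yw: "y \<bullet> ?w n - t = (y \<bullet> w - t) + (y \<bullet> v) / real (Suc n)" for y n
    by (simp add: inner_add_right)
  have "(\<lambda>n. \<integral>y. ?s n y \<partial>L) \<longlonglongrightarrow> (\<integral>y. ?d y \<partial>L)"
  proof (rule integral_dominated_convergence)
    show "integrable L (\<lambda>y. norm (?b y *\<^sub>R F y))"
      by (intro integrable_norm integrable_poly_growth bg) measurable
    show "AE y in L. (\<lambda>n. ?s n y) \<longlonglongrightarrow> ?d y"
      unfolding yw using l by (intro AE_I2 tendsto_scaleR tendsto_mult tendsto_const pos_part_power_quotient) auto
    show "AE y in L. norm (?s n y) \<le> norm (?b y *\<^sub>R F y)" for n
    proof (rule AE_I2)
      fix y :: 'a
      have n1: "1 / real (Suc n) \<le> 1" by simp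
      have a1: "\<bar>y \<bullet> w\<bar> \<le> norm y * norm w" "\<bar>y \<bullet> v\<bar> \<le> norm y * norm v" by (rule Cauchy_Schwarz_ineq2)+
      have a2: "\<bar>(y \<bullet> v) / real (Suc n)\<bar> \<le> norm y * norm v"
      proof -
        have "\<bar>(y \<bullet> v) / real (Suc n)\<bar> = \<bar>y \<bullet> v\<bar> * (1 / real (Suc n))" by (simp add: abs_divide)
        also have "\<dots> \<le> (norm y * norm v) * 1" using a1(2) n1 by (intro mult_mono) auto
        finally show ?thesis by simp
      qed
      have m1: "\<bar>y \<bullet> w - t\<bar> \<le> ?M y" using a1 norm_ge_zero[of y] norm_ge_zero[of v]
        by (simp add: distrib_left)
      have m2: "\<bar>y \<bullet> ?w n - t\<bar> \<le> ?M y" unfolding yw distrib_left using a1 a2 by linarith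
      have "\<bar>?p (?w n) y - ?p w y\<bar> \<le> (real (Suc l) * ?M y ^ l) * \<bar>(y \<bullet> v) / real (Suc n)\<bar>"
        using pos_part_power_diff_le[OF l m1 m2] unfolding yw by simp
      then have "real (Suc n) * \<bar>?p (?w n) y - ?p w y\<bar> \<le> real (Suc n) * ((real (Suc l) * ?M y ^ l) * \<bar>(y \<bullet> v) / real (Suc n)\<bar>)"
        by (rule mult_left_mono) simp
      also have "\<dots> = (real (Suc l) * ?M y ^ l) * \<bar>y \<bullet> v\<bar>" by (simp add: abs_divide)
      also have "\<dots> \<le> (real (Suc l) * ?M y ^ l) * (norm y * norm v)"
        using a1(2) by (rule mult_left_mono) simp
      finally have "real (Suc n) * \<bar>?p (?w n) y - ?p w y\<bar> \<le> (real (Suc l) * ?M y ^ l) * norm y * norm v" by (simp only: mult.assoc)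
      then have "real (Suc n) * \<bar>?p (?w n) y - ?p w y\<bar> * \<bar>q y\<bar> * norm (F y) \<le> ?b y * norm (F y)"
        by (intro mult_right_mono) auto
      moreover have "?b y \<ge> 0" by simp
      moreover have "norm (?s n y) = real (Suc n) * \<bar>?p (?w n) y - ?p w y\<bar> * \<bar>q y\<bar> * norm (F y)"
        by (simp only: norm_scaleR abs_mult abs_of_nat)
      moreover have "norm (?b y *\<^sub>R F y) = ?b y * norm (F y)" using \<open>?b y \<ge> 0\<close> by (simp only: norm_scaleR abs_of_nonneg)
      ultimately show "norm (?s n y) \<le> norm (?b y *\<^sub>R F y)" by (simp only:)
    qed
  qed measurable
  moreover have "(\<lambda>n. \<integral>y. ?s n y \<partial>L) \<longlonglongrightarrow> 0"
  proof (rule tendsto_eventually)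
    have "(\<lambda>n. R * norm (?w n)) \<longlonglongrightarrow> R * norm (w + 0 *\<^sub>R v)"
      using LIMSEQ_inverse_real_of_nat by (intro tendsto_intros) (simp add: inverse_eq_divide)
    then have "eventually (\<lambda>n. R * norm (?w n) < t) sequentially" using t by (intro order_tendstoD(2)) auto
    then show "eventually (\<lambda>n. (\<integral>y. ?s n y \<partial>L) = 0) sequentially"
    proof eventually_elim
      case (elim n)
      have wn: "?w n \<in> H" using w v subH by (intro subspace_add subspace_scale)
      have i: "integrable L (\<lambda>y. (?p x y * q y) *\<^sub>R F y)" for x
        by (intro integrable_poly_growth poly_growth_mult poly_growth_power poly_growth_pos_part poly_growth_inner qg) measurable
      have "?s n = (\<lambda>y. real (Suc n) *\<^sub>R ((?p (?w n) y * q y) *\<^sub>R F y - (?p w y * q y) *\<^sub>R F y))"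
        by (auto simp: fun_eq_iff left_diff_distrib right_diff_distrib scaleR_diff_left scaleR_diff_right mult.assoc simp del: of_nat_Suc power_Suc)
      then have "(\<integral>y. ?s n y \<partial>L) = real (Suc n) *\<^sub>R ((\<integral>y. (?p (?w n) y * q y) *\<^sub>R F y \<partial>L) - (\<integral>y. (?p w y * q y) *\<^sub>R F y \<partial>L))"
        by (simp only: integral_scaleR_right Bochner_Integration.integral_diff[OF i i])
      moreover have "(\<integral>y. (?p (?w n) y * q y) *\<^sub>R F y \<partial>L) = 0" "(\<integral>y. (?p w y * q y) *\<^sub>R F y \<partial>L) = 0"
        using q wn elim w t unfolding annihilated_def by (auto simp del: power_Suc)
      ultimately show ?case by (simp only: diff_self scaleR_zero_right)
    qed
  qed
  ultimately have "(\<integral>y. ?d y \<partial>L) = 0" by (rule LIMSEQ_unique)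
  moreover have "?d = (\<lambda>y. real (Suc l) *\<^sub>R ((max 0 (y \<bullet> w - t) ^ l * ((y \<bullet> v) * q y)) *\<^sub>R F y))"
    by (auto simp: fun_eq_iff mult.assoc)
  ultimately have "real (Suc l) *\<^sub>R (\<integral>y. (max 0 (y \<bullet> w - t) ^ l * ((y \<bullet> v) * q y)) *\<^sub>R F y \<partial>L) = 0"
    by (simp only: integral_scaleR_right)
  then show "(\<integral>y. (max 0 (y \<bullet> w - t) ^ l * ((y \<bullet> v) * q y)) *\<^sub>R F y \<partial>L) = 0"
    unfolding scaleR_eq_0_iff by simp
qed

lemma annihilated_cong:
  assumes "annihilated q" "poly_growth q'" "q' \<in> borel_measurable borel" "\<And>y. y \<in> H \<Longrightarrow> q' y = q y"
  shows "annihilated q'"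
proof -
  have [measurable]: "q \<in> borel_measurable borel" "q' \<in> borel_measurable borel" using assms by (auto simp: annihilated_def)
  have "(\<integral>y. (max 0 (y \<bullet> w - t) ^ l * q' y) *\<^sub>R F y \<partial>L) = (\<integral>y. (max 0 (y \<bullet> w - t) ^ l * q y) *\<^sub>R F y \<partial>L)" for l w t
    using AE_subspace_lborel_in[OF subH] by (intro integral_cong_AE) (auto simp: assms(4))
  then show ?thesis using assms unfolding annihilated_def by simp
qed

text \<open>
  The factor \<open>q\<close> is arbitrary in the induction: this makes products of polynomials a matter of
  using the induction hypothesis twice.
\<close>

lemma annihilated_polynomial_mult:
  assumes "real_polynomial_function p" "annihilated q"
  shows "annihilated (\<lambda>y. p y * q y)"
  using assms
proof (induction p arbitrary: q rule: real_polynomial_function.induct)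
  case (linear f)
  note blf = linear(1) and annq = linear(2)
  interpret bounded_linear f by (rule blf)
  obtain B where B: "orthonormal_basis B H" using orthonormal_basis_exists[OF subH] by blast
  have fin: "finite B" and sp: "span B = H" and po: "pairwise orthogonal B" and no: "\<And>b. b \<in> B \<Longrightarrow> norm b = 1"
    using B orthonormal_basis_independent[OF B] by (auto simp: orthonormal_basis_def)
  define v where "v = (\<Sum>b\<in>B. f b *\<^sub>R b)"
  have v: "v \<in> H" unfolding v_def using sp by (intro subspace_sum[OF subH] subspace_scale[OF subH]) (auto intro: span_base)
  have fv: "f y = y \<bullet> v" if "y \<in> H" for y
  proof -
    have "y \<in> span B" using that sp by simp
    then have "y = (\<Sum>b\<in>B. (y \<bullet> b) *\<^sub>R b)" using orthonormal_basis_expand[OF po no _ fin] by metis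
    then have "f y = f (\<Sum>b\<in>B. (y \<bullet> b) *\<^sub>R b)" by simp
    also have "\<dots> = (\<Sum>b\<in>B. (y \<bullet> b) * f b)" by (simp add: sum scaleR)
    also have "\<dots> = y \<bullet> v" by (simp add: v_def inner_sum_right mult.commute)
    finally show ?thesis .
  qed
  have "q \<in> borel_measurable borel" "poly_growth q" using annq by (auto simp: annihilated_def)
  moreover have "f \<in> borel_measurable borel"
    by (intro borel_measurable_continuous_onI linear_continuous_on blf)
  moreover have "poly_growth f" by (intro poly_growth_real_polynomial real_polynomial_function.intros(1) blf)
  ultimately show ?case
    by (intro annihilated_cong[OF annihilated_inner[OF annq v]] poly_growth_mult) (auto simp: fv)
next
  case (const c)
  have "(\<integral>y. (max 0 (y \<bullet> w - t) ^ l * (c * q y)) *\<^sub>R F y \<partial>L) = c *\<^sub>R (\<integral>y. (max 0 (y \<bullet> w - t) ^ l * q y) *\<^sub>R F y \<partial>L)" for l w t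
    unfolding integral_scaleR_right[symmetric] by (simp add: ac_simps)
  then show ?case using const unfolding annihilated_def by (auto intro: poly_growth_mult poly_growth_const)
next
  case (add f g)
  note f = add.IH(1)[OF add.prems] and g = add.IH(2)[OF add.prems]
  have [measurable]: "(\<lambda>y. f y * q y) \<in> borel_measurable borel" "(\<lambda>y. g y * q y) \<in> borel_measurable borel"
    using f g by (auto simp: annihilated_def)
  have pg: "poly_growth (\<lambda>y. f y * q y)" "poly_growth (\<lambda>y. g y * q y)" using f g by (auto simp: annihilated_def)
  have "(\<integral>y. (max 0 (y \<bullet> w - t) ^ l * (f y * q y + g y * q y)) *\<^sub>R F y \<partial>L)
    = (\<integral>y. (max 0 (y \<bullet> w - t) ^ l * (f y * q y)) *\<^sub>R F y \<partial>L) + (\<integral>y. (max 0 (y \<bullet> w - t) ^ l * (g y * q y)) *\<^sub>R F y \<partial>L)" for l w t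
    unfolding distrib_left scaleR_add_left
    by (intro Bochner_Integration.integral_add integrable_poly_growth poly_growth_mult poly_growth_power poly_growth_pos_part poly_growth_inner pg) measurable
  then have "annihilated (\<lambda>y. f y * q y + g y * q y)"
    using f g unfolding annihilated_def by (auto intro: poly_growth_add)
  then show ?case by (simp only: distrib_right)
next
  case (mult f g)
  show ?case using mult.IH(1)[OF mult.IH(2)[OF mult.prems]] by (simp only: mult.assoc)
qed

lemma annihilated_polynomial:
  assumes "real_polynomial_function p" shows "annihilated p"
  using annihilated_polynomial_mult[OF assms annihilated_1] by simp

end

text \<open>
  A combination of truncated powers with at least the first power, as \<open>annihilated\<close> demands,
  whose average over all directions can be computed in closed form.
\<close>

lemma truncated_cubic:
  fixes s T :: real
  assumes "T > 0"
  shows "max 0 (s - T) ^ 3 + 3 * T * max 0 (s - T) ^ 2 + 2 * T\<^sup>2 * max 0 (s - T) = (if s > T then s * (s\<^sup>2 - T\<^sup>2) else 0)"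
  by (auto simp: max_def power2_eq_square power3_eq_cube algebra_simps)

text \<open>
  Integrating by parts once removes the factor \<open>(r s)\<^sup>2 - T\<^sup>2\<close>, which vanishes at the lower
  end \<open>s = T / r\<close>; only the boundary term of the last antiderivative survives.
\<close>

lemma nn_integral_radial_profile:
  fixes r T C :: real and k :: nat
  assumes r: "r > 0" and T: "T > 0" and C: "C > 0"
  shows "(\<integral>\<^sup>+s. ennreal (if s\<^sup>2 < 1 \<and> r * s > T then (r * s) * ((r * s)\<^sup>2 - T\<^sup>2) * ((1 - s\<^sup>2) ^ k * C) else 0) \<partial>lborel)
    = ennreal (C * (r ^ 3 * max 0 (1 - T\<^sup>2 / r\<^sup>2) ^ (k + 2) / (2 * (real k + 1) * (real k + 2))))"
proof (cases "T < r")
  case False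
  have h: "\<not> (s\<^sup>2 < 1 \<and> r * s > T)" for s
  proof
    assume s: "s\<^sup>2 < 1 \<and> r * s > T"
    then have "s < 1" using abs_square_less_1[of s] by auto
    then have "r * s < r" using r by simp
    then show False using s False by simp
  qed
  have m: "max 0 (1 - T\<^sup>2 / r\<^sup>2) = 0"
  proof -
    have "r\<^sup>2 \<le> T\<^sup>2" using False r by (intro power_mono) auto
    then show ?thesis using r by (simp add: divide_simps)
  qed
  show ?thesis unfolding m if_not_P[OF h] by simp
next
  case True
  let ?a = "T / r"
  have a: "0 < ?a" "?a < 1" using True r T by auto
  let ?f = "\<lambda>s. (r * s) * ((r * s)\<^sup>2 - T\<^sup>2) * ((1 - s\<^sup>2) ^ k * C)"
  let ?A = "\<lambda>s. - C * (r * (r\<^sup>2 * s\<^sup>2 - T\<^sup>2) * (1 - s\<^sup>2) ^ Suc k / (2 * (real k + 1)) + r ^ 3 * (1 - s\<^sup>2) ^ Suc (Suc k) / (2 * (real k + 1) * (real k + 2)))"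
  have "(\<integral>\<^sup>+s. ennreal (if s\<^sup>2 < 1 \<and> r * s > T then ?f s else 0) \<partial>lborel)
    = (\<integral>\<^sup>+s. ennreal (?f s) * indicator {?a..1} s \<partial>lborel)"
  proof (rule nn_integral_cong_AE)
    have "AE s in lborel. s \<noteq> ?a \<and> s \<noteq> (1::real)" by (intro AE_conjI AE_lborel_singleton)
    then show "AE s in lborel. ennreal (if s\<^sup>2 < 1 \<and> r * s > T then ?f s else 0) = ennreal (?f s) * indicator {?a..1} s"
    proof eventually_elim
      case (elim s)
      have "s\<^sup>2 < 1 \<and> r * s > T \<longleftrightarrow> s \<in> {?a..1}"
      proof
        assume h: "s\<^sup>2 < 1 \<and> r * s > T"
        then have "s < 1" using abs_square_less_1[of s] by auto
        then show "s \<in> {?a..1}" using h r by (simp add: field_simps)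
      next
        assume h: "s \<in> {?a..1}"
        then have "?a < s" "s < 1" using elim by auto
        moreover from this have "0 < s" using a by linarith
        ultimately show "s\<^sup>2 < 1 \<and> r * s > T" using r a abs_square_less_1[of s] by (auto simp: field_simps)
      qed
      then show ?case by (simp add: indicator_def)
    qed
  qed
  also have "\<dots> = ennreal (?A 1 - ?A ?a)"
  proof (rule nn_integral_FTC_Icc)
    fix s assume s: "s \<in> {?a..1}"
    show "(?A has_real_derivative ?f s) (at s)"
    proof -
      have d1: "((\<lambda>s. (1 - s\<^sup>2) ^ Suc j) has_real_derivative (- (2 * s * (real (Suc j) * (1 - s\<^sup>2) ^ j)))) (at s)" for j
        by (auto intro!: derivative_eq_intros simp del: power_Suc)
      have d2: "((\<lambda>s. r\<^sup>2 * s\<^sup>2 - T\<^sup>2) has_real_derivative (r\<^sup>2 * (2 * s))) (at s)"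
        by (auto intro!: derivative_eq_intros)
      let ?P = "(1 - s\<^sup>2) ^ k"
      have "(?A has_real_derivative (- C * ((r * (r\<^sup>2 * (2 * s)) * (1 - s\<^sup>2) ^ Suc k + - (2 * s * (real (Suc k) * (1 - s\<^sup>2) ^ k)) * (r * (r\<^sup>2 * s\<^sup>2 - T\<^sup>2))) / (2 * (real k + 1))
         + r ^ 3 * - (2 * s * (real (Suc (Suc k)) * (1 - s\<^sup>2) ^ Suc k)) / (2 * (real k + 1) * (real k + 2))))) (at s)"
        by (rule DERIV_cmult[OF DERIV_add[OF DERIV_cdivide[OF DERIV_mult[OF DERIV_cmult[OF d2, of r] d1[of k]], of "2 * (real k + 1)"]
          DERIV_cdivide[OF DERIV_cmult[OF d1[of "Suc k"], of "r ^ 3"], of "2 * (real k + 1) * (real k + 2)"]], of "- C"])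
      moreover have "(- C * ((r * (r\<^sup>2 * (2 * s)) * (1 - s\<^sup>2) ^ Suc k + - (2 * s * (real (Suc k) * (1 - s\<^sup>2) ^ k)) * (r * (r\<^sup>2 * s\<^sup>2 - T\<^sup>2))) / (2 * (real k + 1))
         + r ^ 3 * - (2 * s * (real (Suc (Suc k)) * (1 - s\<^sup>2) ^ Suc k)) / (2 * (real k + 1) * (real k + 2)))) = ?f s"
      proof -
        have k1: "real (Suc k) = real k + 1" "real (Suc (Suc k)) = real k + 2" by auto
        have "- C * ((r * (r\<^sup>2 * (2 * s)) * (x * P) + - (2 * s * (n * P)) * (r * (r\<^sup>2 * s\<^sup>2 - T\<^sup>2))) / (2 * n)
         + r ^ 3 * - (2 * s * (m * (x * P))) / (2 * n * m)) = (r * s) * ((r * s)\<^sup>2 - T\<^sup>2) * (P * C)"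
          if "n > 0" "m > 0" for n m P x
          using that by (simp add: field_simps power2_eq_square power3_eq_cube)
        from this[of "real k + 1" "real k + 2" "1 - s\<^sup>2" ?P] show ?thesis unfolding k1 power_Suc by simp
      qed
      ultimately show ?thesis by (rule DERIV_cong)
    qed
    have "T \<le> r * s" using s r by (simp add: field_simps)
    then have "T\<^sup>2 \<le> (r * s)\<^sup>2" using T by (intro power_mono) auto
    moreover have "s\<^sup>2 \<le> 1" using s a abs_square_le_1[of s] by auto
    moreover have "0 \<le> s" using s a by auto
    ultimately show "0 \<le> ?f s" using r C by (intro mult_nonneg_nonneg) auto
  qed (use a in auto)
  also have "?A 1 - ?A ?a = C * (r ^ 3 * max 0 (1 - T\<^sup>2 / r\<^sup>2) ^ (k + 2) / (2 * (real k + 1) * (real k + 2)))"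
  proof -
    have "r\<^sup>2 * ?a\<^sup>2 - T\<^sup>2 = 0" using r by (simp add: power_divide)
    moreover have "1 - ?a\<^sup>2 = max 0 (1 - T\<^sup>2 / r\<^sup>2)"
    proof -
      have "T\<^sup>2 \<le> r\<^sup>2" using True T by (intro power_mono) auto
      then show ?thesis using r by (simp add: power_divide)
    qed
    ultimately show ?thesis by simp
  qed
  finally show ?thesis .
qed

context rapid_decay
begin

definition "\<kappa> = (real (dim H) - 1) / 2"

text \<open>
  The exponent is such that the integral of \<open>bump (1 - s\<^sup>2 - |z|\<^sup>2)\<close> over a hyperplane is an
  integral power of \<open>1 - s\<^sup>2\<close>, whatever the parity of the dimension.
\<close>

definition bump :: "real \<Rightarrow> real" where "bump x = (max 0 x) powr \<kappa>"

lemma kappa: "\<kappa> \<ge> 0" using dimH by (simp add: \<kappa>_def)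

lemma bump_nonneg: "bump x \<ge> 0" by (simp add: bump_def)

lemma bump_measurable [measurable]: "bump \<in> borel_measurable borel"
  unfolding bump_def by measurable

lemma section_mass:
  obtains C where "C > 0" "\<And>u. u \<in> H \<Longrightarrow> norm u = 1 \<Longrightarrow>
     (\<integral>\<^sup>+z. ennreal (bump (1 - (norm z)\<^sup>2)) \<partial>subspace_lborel {y\<in>H. y \<bullet> u = 0}) = ennreal C"
proof -
  obtain u0 where u0: "u0 \<in> H" "norm u0 = 1" using subspace_unit_exists[OF subH dimH] by blast
  let ?W = "\<lambda>u. {y\<in>H. y \<bullet> u = 0}"
  let ?I = "\<lambda>u. \<integral>\<^sup>+z. ennreal (bump (1 - (norm z)\<^sup>2)) \<partial>subspace_lborel (?W u)"
  have W: "subspace (?W u)" for u by (rule subspace_orthogonal_part[OF subH])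
  have eq: "?I u = ?I u0" if "u \<in> H" "norm u = 1" for u
  proof (rule nn_integral_radial_dim[OF W W, of u u0 "\<lambda>x. ennreal (bump (1 - x\<^sup>2))"])
    show "dim (?W u) = dim (?W u0)"
      using dim_subspace_orthogonal_part[OF subH that(2,1)] dim_subspace_orthogonal_part[OF subH u0(2,1)] by simp
  qed measurable
  have sm: "(norm z)\<^sup>2 < 1" if "norm z < 1" for z :: 'a using that abs_square_less_1[of "norm z"] by simp
  have "?I u0 \<le> (\<integral>\<^sup>+z. indicator (ball 0 1) z \<partial>subspace_lborel (?W u0))"
  proof (rule nn_integral_mono)
    fix z :: 'a
    show "ennreal (bump (1 - (norm z)\<^sup>2)) \<le> indicator (ball 0 1) z"
    proof (cases "norm z < 1")
      case True
      then show ?thesis using sm[OF True] kappa by (simp add: bump_def powr_le1)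
    next
      case False
      then have "1 \<le> (norm z)\<^sup>2" by (simp add: one_le_power)
      then show ?thesis by (simp add: bump_def)
    qed
  qed
  also have "\<dots> < \<infinity>" using emeasure_ball_subspace_finite[OF W] by simp
  finally obtain C where C: "?I u0 = ennreal C" "C \<ge> 0" by (cases "?I u0") auto
  have "C \<noteq> 0"
  proof
    assume "C = 0"
    then have "AE z in subspace_lborel (?W u0). ennreal (bump (1 - (norm z)\<^sup>2)) = 0"
      using C \<open>C = 0\<close> by (subst nn_integral_0_iff_AE[symmetric]) auto
    then have "AE z in subspace_lborel (?W u0). z \<notin> ball 0 1"
    proof eventually_elim
      case (elim z)
      show ?case
      proof
        assume "z \<in> ball 0 1"
        then have "1 - (norm z)\<^sup>2 > 0" using sm[of z] by simp
        then show False using elim by (simp add: bump_def)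
      qed
    qed
    then have "emeasure (subspace_lborel (?W u0)) {z\<in>space (subspace_lborel (?W u0)). z \<in> ball 0 1} = 0"
      by (rule emeasure_eq_0_AE)
    moreover have "{z\<in>space (subspace_lborel (?W u0)). z \<in> ball 0 1} = ball 0 1" by auto
    ultimately have "emeasure (subspace_lborel (?W u0)) (ball 0 1) = 0" by (simp only:)
    then show False using emeasure_ball_subspace_pos[OF W, of 0 u0 1] subspace_0[OF subH] by simp
  qed
  then show ?thesis using that[of C] C eq by simp
qed

lemma section_mass_scaled:
  assumes C: "C > 0" "(\<integral>\<^sup>+z. ennreal (bump (1 - (norm z)\<^sup>2)) \<partial>subspace_lborel {y\<in>H. y \<bullet> u = 0}) = ennreal C"
    and u: "u \<in> H" "norm u = 1"
  shows "(\<integral>\<^sup>+z. ennreal (bump (1 - s\<^sup>2 - (norm z)\<^sup>2)) \<partial>subspace_lborel {y\<in>H. y \<bullet> u = 0})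
    = ennreal (if s\<^sup>2 < 1 then (1 - s\<^sup>2) ^ (dim H - 1) * C else 0)"
proof (cases "s\<^sup>2 < 1")
  case False
  then have "bump (1 - s\<^sup>2 - (norm z)\<^sup>2) = 0" for z :: 'a
  proof -
    have "1 - s\<^sup>2 - (norm z)\<^sup>2 \<le> 0" using False zero_le_power2[of "norm z"] by linarith
    then show ?thesis by (simp add: bump_def)
  qed
  then show ?thesis using False by simp
next
  case True
  let ?W = "{y\<in>H. y \<bullet> u = 0}"
  have W: "subspace ?W" by (rule subspace_orthogonal_part[OF subH])
  have dW: "dim ?W = dim H - 1" using dim_subspace_orthogonal_part[OF subH u(2,1)] by simp
  define c where "c = sqrt (1 - s\<^sup>2)"
  have c: "c > 0" "c\<^sup>2 = 1 - s\<^sup>2" using True by (auto simp: c_def)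
  have ck: "(c\<^sup>2) powr \<kappa> = c ^ (dim H - 1)"
  proof -
    have "(c\<^sup>2) powr \<kappa> = (c powr 2) powr \<kappa>" using c(1) by simp
    also have "\<dots> = c powr (real (dim H - 1))" 
    proof -
      have "2 * \<kappa> = real (dim H - 1)" using dimH by (simp add: \<kappa>_def of_nat_diff)
      then show ?thesis by (simp only: powr_powr)
    qed
    finally show ?thesis using c(1) by (simp add: powr_realpow)
  qed
  have "(\<integral>\<^sup>+z. ennreal (bump (1 - s\<^sup>2 - (norm z)\<^sup>2)) \<partial>subspace_lborel ?W)
    = ennreal (c ^ (dim H - 1)) * (\<integral>\<^sup>+z. ennreal (bump (1 - s\<^sup>2 - (norm (c *\<^sub>R z))\<^sup>2)) \<partial>subspace_lborel ?W)"
    unfolding dW[symmetric] by (rule nn_integral_subspace_scale[OF W c(1)]) measurable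
  also have "(\<lambda>z::'a. ennreal (bump (1 - s\<^sup>2 - (norm (c *\<^sub>R z))\<^sup>2))) = (\<lambda>z. ennreal (c ^ (dim H - 1)) * ennreal (bump (1 - (norm z)\<^sup>2)))"
  proof
    fix z :: 'a
    have "1 - s\<^sup>2 - (norm (c *\<^sub>R z))\<^sup>2 = c\<^sup>2 * (1 - (norm z)\<^sup>2)"
      by (simp add: power_mult_distrib c(2) right_diff_distrib)
    moreover have "max 0 (c\<^sup>2 * x) = c\<^sup>2 * max 0 x" for x using c(1) by (auto simp: max_def zero_le_mult_iff mult_le_0_iff)
    ultimately have "bump (1 - s\<^sup>2 - (norm (c *\<^sub>R z))\<^sup>2) = c ^ (dim H - 1) * bump (1 - (norm z)\<^sup>2)"
      unfolding bump_def by (simp only: powr_mult ck)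
    then show "ennreal (bump (1 - s\<^sup>2 - (norm (c *\<^sub>R z))\<^sup>2)) = ennreal (c ^ (dim H - 1)) * ennreal (bump (1 - (norm z)\<^sup>2))"
      using c(1) bump_nonneg by (simp add: ennreal_mult)
  qed
  also have "ennreal (c ^ (dim H - 1)) * (\<integral>\<^sup>+z. ennreal (c ^ (dim H - 1)) * ennreal (bump (1 - (norm z)\<^sup>2)) \<partial>subspace_lborel ?W)
    = ennreal (c ^ (dim H - 1)) * (ennreal (c ^ (dim H - 1)) * ennreal C)"
    by (subst nn_integral_cmult) (use C in auto)
  also have "\<dots> = ennreal ((c\<^sup>2) ^ (dim H - 1) * C)"
    using c(1) C(1) by (simp add: power2_eq_square power_mult_distrib mult.assoc flip: ennreal_mult)
  finally show ?thesis using True c(2) by simp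
qed

text \<open>
  By \<open>truncated_cubic\<close> this is \<open>s (s\<^sup>2 - T\<^sup>2)\<close> for \<open>s > T\<close>.
\<close>

definition ridge :: "real \<Rightarrow> real \<Rightarrow> real" where
  "ridge T s = max 0 (s - T) ^ 3 + 3 * T * max 0 (s - T) ^ 2 + 2 * T\<^sup>2 * max 0 (s - T)"

lemma ridge_measurable [measurable]: "ridge T \<in> borel_measurable borel"
  unfolding ridge_def by measurable

lemma ridge_nonneg: "T > 0 \<Longrightarrow> ridge T s \<ge> 0"
  by (simp add: ridge_def)

lemma nn_integral_ridge_average:
  assumes C: "C > 0" "\<And>u. u \<in> H \<Longrightarrow> norm u = 1 \<Longrightarrow>
     (\<integral>\<^sup>+z. ennreal (bump (1 - (norm z)\<^sup>2)) \<partial>subspace_lborel {y\<in>H. y \<bullet> u = 0}) = ennreal C"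
    and T: "T > 0" and y: "y \<in> H" "y \<noteq> 0"
  shows "(\<integral>\<^sup>+w. ennreal (bump (1 - (norm w)\<^sup>2) * ridge T (y \<bullet> w)) \<partial>L)
    = ennreal (C / (2 * real (dim H) * (real (dim H) + 1)) * (norm y ^ 3 * max 0 (1 - T\<^sup>2 / (norm y)\<^sup>2) ^ (dim H + 1)))"
proof -
  define r where "r = norm y"
  have r: "r > 0" using y by (simp add: r_def)
  define u where "u = (1 / r) *\<^sub>R y"
  have u: "norm u = 1" "u \<in> H" using y subH by (auto simp: u_def r_def subspace_scale)
  have yu: "y = r *\<^sub>R u" using r by (simp add: u_def)
  have uu: "u \<bullet> u = 1" using u by (simp add: dot_square_norm)
  let ?W = "{x\<in>H. x \<bullet> u = 0}"
  have W: "subspace ?W" by (rule subspace_orthogonal_part[OF subH])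
  have "(\<integral>\<^sup>+w. ennreal (bump (1 - (norm w)\<^sup>2) * ridge T (y \<bullet> w)) \<partial>L)
    = (\<integral>\<^sup>+s. \<integral>\<^sup>+z. ennreal (bump (1 - (norm (s *\<^sub>R u + z))\<^sup>2) * ridge T (y \<bullet> (s *\<^sub>R u + z))) \<partial>subspace_lborel ?W \<partial>lborel)"
    by (rule nn_integral_subspace_line[OF subH u]) measurable
  also have "\<dots> = (\<integral>\<^sup>+s. \<integral>\<^sup>+z. ennreal (ridge T (r * s)) * ennreal (bump (1 - s\<^sup>2 - (norm z)\<^sup>2)) \<partial>subspace_lborel ?W \<partial>lborel)"
  proof (rule nn_integral_cong, rule nn_integral_cong_AE)
    fix s :: real
    show "AE z in subspace_lborel ?W. ennreal (bump (1 - (norm (s *\<^sub>R u + z))\<^sup>2) * ridge T (y \<bullet> (s *\<^sub>R u + z)))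
       = ennreal (ridge T (r * s)) * ennreal (bump (1 - s\<^sup>2 - (norm z)\<^sup>2))"
      using AE_subspace_lborel_in[OF W]
    proof eventually_elim
      case (elim z)
      then have z: "z \<bullet> u = 0" by simp
      have 1: "y \<bullet> (s *\<^sub>R u + z) = r * s" unfolding yu using z uu by (simp add: inner_add_right inner_commute)
      have "(norm (s *\<^sub>R u + z))\<^sup>2 = s\<^sup>2 + (norm z)\<^sup>2"
        unfolding power2_norm_eq_inner using z uu by (simp add: inner_add inner_commute power2_eq_square[of s])
      then have 2: "1 - (norm (s *\<^sub>R u + z))\<^sup>2 = 1 - s\<^sup>2 - (norm z)\<^sup>2" by simp
      show ?case unfolding 1 2 using ridge_nonneg[OF T] bump_nonneg by (simp add: ennreal_mult mult.commute)
    qed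
  qed
  also have "\<dots> = (\<integral>\<^sup>+s. ennreal (if s\<^sup>2 < 1 \<and> r * s > T then (r * s) * ((r * s)\<^sup>2 - T\<^sup>2) * ((1 - s\<^sup>2) ^ (dim H - 1) * C) else 0) \<partial>lborel)"
  proof (rule nn_integral_cong)
    fix s :: real
    have "(\<integral>\<^sup>+z. ennreal (ridge T (r * s)) * ennreal (bump (1 - s\<^sup>2 - (norm z)\<^sup>2)) \<partial>subspace_lborel ?W)
      = ennreal (ridge T (r * s)) * (\<integral>\<^sup>+z. ennreal (bump (1 - s\<^sup>2 - (norm z)\<^sup>2)) \<partial>subspace_lborel ?W)"
      by (rule nn_integral_cmult) measurable
    also have "\<dots> = ennreal (ridge T (r * s)) * ennreal (if s\<^sup>2 < 1 then (1 - s\<^sup>2) ^ (dim H - 1) * C else 0)"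
      by (simp only: section_mass_scaled[OF C(1) C(2)[OF u(2,1)] u(2,1)])
    also have "\<dots> = ennreal (ridge T (r * s) * (if s\<^sup>2 < 1 then (1 - s\<^sup>2) ^ (dim H - 1) * C else 0))"
      using ridge_nonneg[OF T] C(1) by (subst ennreal_mult) auto
    also have "ridge T (r * s) * (if s\<^sup>2 < 1 then (1 - s\<^sup>2) ^ (dim H - 1) * C else 0)
       = (if s\<^sup>2 < 1 \<and> r * s > T then (r * s) * ((r * s)\<^sup>2 - T\<^sup>2) * ((1 - s\<^sup>2) ^ (dim H - 1) * C) else 0)"
      unfolding ridge_def truncated_cubic[OF T] by simp
    finally show "(\<integral>\<^sup>+z. ennreal (ridge T (r * s)) * ennreal (bump (1 - s\<^sup>2 - (norm z)\<^sup>2)) \<partial>subspace_lborel ?W)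
       = ennreal (if s\<^sup>2 < 1 \<and> r * s > T then (r * s) * ((r * s)\<^sup>2 - T\<^sup>2) * ((1 - s\<^sup>2) ^ (dim H - 1) * C) else 0)" .
  qed
  also have "\<dots> = ennreal (C * (r ^ 3 * max 0 (1 - T\<^sup>2 / r\<^sup>2) ^ (dim H - 1 + 2) / (2 * (real (dim H - 1) + 1) * (real (dim H - 1) + 2))))"
    by (rule nn_integral_radial_profile[OF r T C(1)])
  also have "\<dots> = ennreal (C / (2 * real (dim H) * (real (dim H) + 1)) * (norm y ^ 3 * max 0 (1 - T\<^sup>2 / (norm y)\<^sup>2) ^ (dim H + 1)))"
  proof -
    have "dim H - 1 + 2 = dim H + 1" "real (dim H - 1) + 1 = real (dim H)" "real (dim H - 1) + 2 = real (dim H) + 1"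
      using dimH by auto
    then show ?thesis unfolding r_def by (simp only: times_divide_eq_right times_divide_eq_left)
  qed
  finally show ?thesis .
qed

text \<open>
  For \<open>|w| < 1\<close> and \<open>T > R\<close> the ridge function of \<open>y \<bullet> w\<close> is orthogonal to \<open>p F\<close>.  Its
  average over \<open>w\<close> is radial.
\<close>

lemma radial_zero:
  assumes p: "real_polynomial_function p" and T: "T > R" "T > 0"
  shows "(\<integral>y. (norm y ^ 3 * max 0 (1 - T\<^sup>2 / (norm y)\<^sup>2) ^ (dim H + 1) * p y) *\<^sub>R F y \<partial>L) = 0"
proof -
  obtain C where C: "C > 0" "\<And>u. u \<in> H \<Longrightarrow> norm u = 1 \<Longrightarrow>
     (\<integral>\<^sup>+z. ennreal (bump (1 - (norm z)\<^sup>2)) \<partial>subspace_lborel {y\<in>H. y \<bullet> u = 0}) = ennreal C"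
    using section_mass by blast
  have pg: "poly_growth p" by (rule poly_growth_real_polynomial[OF p])
  have [measurable]: "p \<in> borel_measurable borel"
    using annihilated_polynomial[OF p] by (simp add: annihilated_def)
  interpret S: sigma_finite_measure L by (rule sigma_finite_subspace_lborel[OF subH])
  interpret PQ: pair_sigma_finite L L by standard
  define k where "k = C / (2 * real (dim H) * (real (dim H) + 1))"
  have k: "k > 0" using C dimH by (simp add: k_def)
  define K where "K y = norm y ^ 3 * max 0 (1 - T\<^sup>2 / (norm y)\<^sup>2) ^ (dim H + 1)" for y :: 'a
  have [measurable]: "K \<in> borel_measurable borel" unfolding K_def by measurable
  have K0: "K y \<ge> 0" for y by (simp add: K_def)
  have Kg: "poly_growth K"
  proof (rule poly_growth_mono[OF poly_growth_power[OF poly_growth_norm, of 3]])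
    fix y :: 'a
    have "max 0 (1 - T\<^sup>2 / (norm y)\<^sup>2) ^ (dim H + 1) \<le> 1" by (rule power_le_one) auto
    then show "\<bar>K y\<bar> \<le> \<bar>norm y ^ 3\<bar>" using K0[of y] by (simp add: K_def mult_left_le)
  qed
  let ?E = "\<lambda>y w. bump (1 - (norm w)\<^sup>2) * ridge T (y \<bullet> w)"
  have E0: "?E y w \<ge> 0" for y w using ridge_nonneg[OF T(2)] bump_nonneg by simp
  have int: "integrable L (\<lambda>y. (k * K y * p y) *\<^sub>R F y)"
    by (intro integrable_poly_growth poly_growth_mult Kg pg poly_growth_const) measurable
  have AEH: "AE y in L. y \<in> H \<and> y \<noteq> 0"
    using AE_subspace_lborel_in[OF subH] AE_subspace_lborel_nonzero[OF subH dimH] by eventually_elim simp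
  have avg: "(\<integral>\<^sup>+w. ennreal (?E y w) \<partial>L) = ennreal (k * K y)" if "y \<in> H \<and> y \<noteq> 0" for y
    using nn_integral_ridge_average[OF C T(2), of y] that unfolding k_def K_def by simp
  have ii: "integrable (L \<Otimes>\<^sub>M L) (\<lambda>(y, w). (?E y w * p y) *\<^sub>R F y)"
  proof (rule integrableI_bounded)
    show "(\<lambda>(y, w). (?E y w * p y) *\<^sub>R F y) \<in> borel_measurable (L \<Otimes>\<^sub>M L)" by measurable
    have "(\<integral>\<^sup>+x. ennreal (norm (case x of (y, w) \<Rightarrow> (?E y w * p y) *\<^sub>R F y)) \<partial>(L \<Otimes>\<^sub>M L))
      = (\<integral>\<^sup>+y. \<integral>\<^sup>+w. ennreal (?E y w) * ennreal (norm (p y *\<^sub>R F y)) \<partial>L \<partial>L)"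
    proof (subst S.nn_integral_fst[symmetric])
      have "norm ((?E y w * p y) *\<^sub>R F y) = ?E y w * norm (p y *\<^sub>R F y)" for y w
        by (simp only: norm_scaleR abs_mult[of "?E y w" "p y"] abs_of_nonneg[OF E0] mult.assoc[of "?E y w"])
      then show "(\<integral>\<^sup>+y. \<integral>\<^sup>+w. ennreal (norm (case (y, w) of (y, w) \<Rightarrow> (?E y w * p y) *\<^sub>R F y)) \<partial>L \<partial>L)
        = (\<integral>\<^sup>+y. \<integral>\<^sup>+w. ennreal (?E y w) * ennreal (norm (p y *\<^sub>R F y)) \<partial>L \<partial>L)"
        by (intro nn_integral_cong) (simp only: case_prod_conv ennreal_mult[OF E0 norm_ge_zero])
    qed measurable
    also have "\<dots> = (\<integral>\<^sup>+y. (\<integral>\<^sup>+w. ennreal (?E y w) \<partial>L) * ennreal (norm (p y *\<^sub>R F y)) \<partial>L)"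
      by (intro nn_integral_cong nn_integral_multc) measurable
    also have "\<dots> = (\<integral>\<^sup>+y. ennreal (norm ((k * K y * p y) *\<^sub>R F y)) \<partial>L)"
    proof (rule nn_integral_cong_AE)
      show "AE y in L. (\<integral>\<^sup>+w. ennreal (?E y w) \<partial>L) * ennreal (norm (p y *\<^sub>R F y)) = ennreal (norm ((k * K y * p y) *\<^sub>R F y))"
        using AEH
      proof eventually_elim
        case (elim y)
        show ?case unfolding avg[OF elim] using k K0[of y] by (simp add: abs_mult ennreal_mult[symmetric] mult.assoc)
      qed
    qed
    also have "\<dots> < \<infinity>" using int unfolding integrable_iff_bounded by auto
    finally show "(\<integral>\<^sup>+x. ennreal (norm (case x of (y, w) \<Rightarrow> (?E y w * p y) *\<^sub>R F y)) \<partial>(L \<Otimes>\<^sub>M L)) < \<infinity>" .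
  qed
  have "(\<integral>y. \<integral>w. (?E y w * p y) *\<^sub>R F y \<partial>L \<partial>L) = (\<integral>w. \<integral>y. (?E y w * p y) *\<^sub>R F y \<partial>L \<partial>L)"
    using PQ.Fubini_integral[OF ii] by simp
  also have "\<dots> = (\<integral>w. 0 \<partial>L)"
  proof (rule integral_cong_AE)
    show "AE w in L. (\<integral>y. (?E y w * p y) *\<^sub>R F y \<partial>L) = 0"
      using AEH
    proof eventually_elim
      case (elim w)
      show ?case
      proof (cases "norm w < 1")
        case False
        then have "1 \<le> (norm w)\<^sup>2" by (simp add: one_le_power)
        then have "bump (1 - (norm w)\<^sup>2) = 0" by (simp add: bump_def)
        then show ?thesis by simp
      next
        case True
        have "R * norm w \<le> R * 1" using True R by (intro mult_left_mono) auto
        then have RT: "R * norm w < T" using T by simp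
        let ?b = "bump (1 - (norm w)\<^sup>2)"
        let ?J = "\<lambda>l y. (max 0 (y \<bullet> w - T) ^ l * p y) *\<^sub>R F y"
        have z: "(\<integral>y. ?J l y \<partial>L) = 0" if "l \<ge> 1" for l
          using annihilated_polynomial[OF p] that elim RT unfolding annihilated_def by blast
        have i: "integrable L (?J l)" for l
          by (intro integrable_poly_growth poly_growth_mult poly_growth_power poly_growth_pos_part poly_growth_inner pg) measurable
        have "(\<integral>y. (?E y w * p y) *\<^sub>R F y \<partial>L) = (\<integral>y. ?b *\<^sub>R (?J 3 y + ((3 * T) *\<^sub>R ?J 2 y + (2 * T\<^sup>2) *\<^sub>R ?J 1 y)) \<partial>L)"
        proof -
          have "(b * (x + 3 * T * x' + 2 * T\<^sup>2 * x'') * q) *\<^sub>R f = b *\<^sub>R ((x * q) *\<^sub>R f + ((3 * T) *\<^sub>R (x' * q) *\<^sub>R f + (2 * T\<^sup>2) *\<^sub>R (x'' * q) *\<^sub>R f))"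
            for b x x' x'' q :: real and f :: complex
            by (simp add: scaleR_conv_of_real algebra_simps)
          then show ?thesis unfolding ridge_def by (simp only: power_one_right)
        qed
        also have "\<dots> = ?b *\<^sub>R ((\<integral>y. ?J 3 y \<partial>L) + ((3 * T) *\<^sub>R (\<integral>y. ?J 2 y \<partial>L) + (2 * T\<^sup>2) *\<^sub>R (\<integral>y. ?J 1 y \<partial>L)))"
          by (simp only: integral_scaleR_right Bochner_Integration.integral_add[OF i[of 3] Bochner_Integration.integrable_add[OF integrable_scaleR_right[OF i] integrable_scaleR_right[OF i]]]
             Bochner_Integration.integral_add[OF integrable_scaleR_right[OF i] integrable_scaleR_right[OF i]])
        also have "\<dots> = 0" by (simp only: z order_refl one_le_numeral scaleR_zero_right add_0_left)
        finally show ?thesis .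
      qed
    qed
  qed auto
  also have "(\<integral>y. \<integral>w. (?E y w * p y) *\<^sub>R F y \<partial>L \<partial>L) = (\<integral>y. (k * K y * p y) *\<^sub>R F y \<partial>L)"
  proof (rule integral_cong_AE)
    show "AE y in L. (\<integral>w. (?E y w * p y) *\<^sub>R F y \<partial>L) = (k * K y * p y) *\<^sub>R F y"
      using AEH
    proof eventually_elim
      case (elim y)
      have "has_bochner_integral L (?E y) (k * K y)"
        using avg[OF elim] E0 k K0[of y] by (intro has_bochner_integral_nn_integral) auto
      then have "(\<integral>w. ?E y w \<partial>L) = k * K y" "integrable L (?E y)" by (auto simp: has_bochner_integral_iff)
      then have "(\<integral>w. ?E y w *\<^sub>R (p y *\<^sub>R F y) \<partial>L) = (k * K y) *\<^sub>R (p y *\<^sub>R F y)" by (simp only: integral_scaleR_left)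
      then show ?case by (simp only: scaleR_scaleR)
    qed
  qed auto
  finally have z: "(\<integral>y. (k * K y * p y) *\<^sub>R F y \<partial>L) = 0" by simp
  have "(\<integral>y. (k * K y * p y) *\<^sub>R F y \<partial>L) = k *\<^sub>R (\<integral>y. (K y * p y) *\<^sub>R F y \<partial>L)"
    by (simp only: mult.assoc scaleR_scaleR[symmetric] integral_scaleR_right)
  with z have "k *\<^sub>R (\<integral>y. (K y * p y) *\<^sub>R F y \<partial>L) = 0" by (simp only:)
  then show ?thesis unfolding scaleR_eq_0_iff K_def using k by auto
qed

text \<open>
  The averaged kernel is \<open>max 0 (|y|\<^sup>2 - T\<^sup>2)\<close> to the power \<open>dim H + 1\<close>, divided by the power
  \<open>2 dim H - 1\<close> of \<open>|y|\<close>.  The latter does not depend on \<open>T\<close>; it matters only for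
  \<open>|y| > T \<ge> r0\<close> and is kept bounded elsewhere.
\<close>

definition decay_weight :: "real \<Rightarrow> 'a \<Rightarrow> real" where
  "decay_weight r0 y = 1 / (max r0 (norm y)) ^ (2 * dim H - 1)"

lemma decay_weight_measurable [measurable]: "decay_weight r0 \<in> borel_measurable borel"
  unfolding decay_weight_def by measurable

lemma decay_weight_pos: "r0 > 0 \<Longrightarrow> decay_weight r0 y > 0"
  by (simp add: decay_weight_def less_max_iff_disj)

lemma decay_weight_growth: "r0 > 0 \<Longrightarrow> poly_growth (decay_weight r0)"
proof (rule poly_growthI[of _ "1 / r0 ^ (2 * dim H - 1)" 0])
  fix y :: 'a assume r0: "r0 > 0"
  have "1 / (max r0 (norm y)) ^ (2 * dim H - 1) \<le> 1 / r0 ^ (2 * dim H - 1)"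
    using r0 by (intro divide_left_mono power_mono) (auto intro!: mult_pos_pos zero_less_power simp: less_max_iff_disj)
  then show "\<bar>decay_weight r0 y\<bar> \<le> 1 / r0 ^ (2 * dim H - 1) * (1 + (norm y)\<^sup>2) ^ 0"
    using decay_weight_pos[OF r0, of y] by (simp add: decay_weight_def)
qed

text \<open>
  Differentiation in \<open>\<tau>\<close> lowers the exponent by one, so the induction runs downwards from
  \<open>radial_zero\<close>.
\<close>

lemma truncated_power_zero:
  assumes p: "real_polynomial_function p" and r0: "r0 > R" "r0 > 0" and j: "1 \<le> j" "j \<le> dim H + 1"
    and tau: "\<tau> \<ge> r0\<^sup>2"
  shows "(\<integral>y. (max 0 ((norm y)\<^sup>2 - \<tau>) ^ j * (decay_weight r0 y * p y)) *\<^sub>R F y \<partial>L) = 0"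
  using j tau
proof (induction "dim H + 1 - j" arbitrary: j \<tau>)
  case 0
  then have j: "j = dim H + 1" by simp
  define T where "T = sqrt \<tau>"
  have T: "T \<ge> r0" "T\<^sup>2 = \<tau>" "T > 0"
  proof -
    have "\<tau> \<ge> 0" using 0 zero_le_power2[of r0] by linarith
    then show "T\<^sup>2 = \<tau>" by (simp add: T_def)
    show "T \<ge> r0" using 0 r0 by (simp add: T_def real_le_rsqrt)
    then show "T > 0" using r0 by simp
  qed
  have "norm y ^ 3 * max 0 (1 - T\<^sup>2 / (norm y)\<^sup>2) ^ (dim H + 1) = max 0 ((norm y)\<^sup>2 - \<tau>) ^ j * decay_weight r0 y" for y :: 'a
  proof (cases "norm y > T")
    case True
    let ?r = "norm y"
    have r: "?r > 0" "max r0 ?r = ?r" using True T by auto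
    have T2: "T\<^sup>2 < ?r\<^sup>2" using True T by (intro power_strict_mono) auto
    then have m: "max 0 (?r\<^sup>2 - \<tau>) = ?r\<^sup>2 - \<tau>" "max 0 (1 - T\<^sup>2 / ?r\<^sup>2) = (?r\<^sup>2 - \<tau>) / ?r\<^sup>2"
      using r T(2) by (auto simp: diff_divide_distrib)
    have "(?r\<^sup>2) ^ (dim H + 1) = ?r ^ 3 * ?r ^ (2 * dim H - 1)"
      using dimH by (simp add: power_add[symmetric] power_mult[symmetric])
    then have w: "?r ^ 3 * (1 / (?r\<^sup>2) ^ (dim H + 1)) = 1 / ?r ^ (2 * dim H - 1)" using r by simp
    have "?r ^ 3 * ((?r\<^sup>2 - \<tau>) ^ j / (?r\<^sup>2) ^ (dim H + 1)) = (?r\<^sup>2 - \<tau>) ^ j * (?r ^ 3 * (1 / (?r\<^sup>2) ^ (dim H + 1)))"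
      by simp
    then show ?thesis unfolding w m decay_weight_def r(2) j power_divide .
  next
    case False
    then have "(norm y)\<^sup>2 \<le> T\<^sup>2" by (intro power_mono) auto
    then have "max 0 ((norm y)\<^sup>2 - \<tau>) = 0" using T by simp
    moreover have "norm y ^ 3 * max 0 (1 - T\<^sup>2 / (norm y)\<^sup>2) ^ (dim H + 1) = 0"
    proof (cases "norm y = 0")
      case False
      then have "1 \<le> T\<^sup>2 / (norm y)\<^sup>2" using \<open>(norm y)\<^sup>2 \<le> T\<^sup>2\<close> by (simp add: le_divide_eq)
      then show ?thesis by simp
    qed simp
    ultimately show ?thesis using j by simp
  qed
  then have "norm y ^ 3 * max 0 (1 - T\<^sup>2 / (norm y)\<^sup>2) ^ (dim H + 1) * p y = max 0 ((norm y)\<^sup>2 - \<tau>) ^ j * (decay_weight r0 y * p y)" for y :: 'a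
    by (simp only: mult.assoc)
  moreover have "T > R" using T r0 by linarith
  ultimately show ?case using radial_zero[OF p _ T(3)] by (simp only:)
next
  case (Suc n)
  define l where "l = j"
  have l: "1 \<le> l" "Suc l \<le> dim H + 1" using Suc by (auto simp: l_def)
  have IH: "(\<integral>y. (max 0 ((norm y)\<^sup>2 - t) ^ Suc l * (decay_weight r0 y * p y)) *\<^sub>R F y \<partial>L) = 0" if "t \<ge> r0\<^sup>2" for t
    using Suc.hyps(1)[of "Suc l" t] Suc.hyps(2) l that by (simp add: l_def del: power_Suc)
  have pg: "poly_growth p" by (rule poly_growth_real_polynomial[OF p])
  have [measurable]: "p \<in> borel_measurable borel" using annihilated_polynomial[OF p] by (simp add: annihilated_def)
  let ?q = "\<lambda>y. decay_weight r0 y * p y"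
  have qg: "poly_growth ?q" by (intro poly_growth_mult decay_weight_growth[OF r0(2)] pg)
  let ?p = "\<lambda>t y. max 0 ((norm y)\<^sup>2 - t) ^ Suc l"
  let ?t = "\<lambda>n. \<tau> + 1 / real (Suc n)"
  let ?s = "\<lambda>n y. (real (Suc n) * (?p (?t n) y - ?p \<tau> y) * ?q y) *\<^sub>R F y"
  let ?d = "\<lambda>y. (real (Suc l) * max 0 ((norm y)\<^sup>2 - \<tau>) ^ l * (- 1) * ?q y) *\<^sub>R F y"
  have tau0: "\<tau> \<ge> 0" using Suc.prems zero_le_power2[of r0] by linarith
  let ?M = "\<lambda>y. norm y ^ 2 + (\<tau> + 1)"
  let ?b = "\<lambda>y. (real (Suc l) * ?M y ^ l) * ?q y"
  have bg: "poly_growth ?b"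
    by (intro poly_growth_mult[OF _ qg] poly_growth_mult poly_growth_power poly_growth_add poly_growth_const poly_growth_norm)
  have yt: "(norm y)\<^sup>2 - ?t n = ((norm y)\<^sup>2 - \<tau>) + (- 1) / real (Suc n)" for y :: 'a and n by simp
  have "(\<lambda>n. \<integral>y. ?s n y \<partial>L) \<longlonglongrightarrow> (\<integral>y. ?d y \<partial>L)"
  proof (rule integral_dominated_convergence)
    show "integrable L (\<lambda>y. norm (?b y *\<^sub>R F y))"
      by (intro integrable_norm integrable_poly_growth bg) measurable
    show "AE y in L. (\<lambda>n. ?s n y) \<longlonglongrightarrow> ?d y"
      unfolding yt using l by (intro AE_I2 tendsto_scaleR tendsto_mult tendsto_const pos_part_power_quotient) auto
    show "AE y in L. norm (?s n y) \<le> norm (?b y *\<^sub>R F y)" for n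
    proof (rule AE_I2)
      fix y :: 'a
      have n1: "1 / real (Suc n) \<le> 1" "1 / real (Suc n) \<ge> 0" by auto
      have m1: "\<bar>(norm y)\<^sup>2 - \<tau>\<bar> \<le> ?M y" "\<bar>(norm y)\<^sup>2 - ?t n\<bar> \<le> ?M y"
        using tau0 n1 zero_le_power2[of "norm y"] by linarith+
      have "\<bar>?p (?t n) y - ?p \<tau> y\<bar> \<le> (real (Suc l) * ?M y ^ l) * \<bar>((norm y)\<^sup>2 - ?t n) - ((norm y)\<^sup>2 - \<tau>)\<bar>"
        by (rule pos_part_power_diff_le[OF l(1) m1])
      also have "\<bar>((norm y)\<^sup>2 - ?t n) - ((norm y)\<^sup>2 - \<tau>)\<bar> = 1 / real (Suc n)" by simp
      finally have "real (Suc n) * \<bar>?p (?t n) y - ?p \<tau> y\<bar> \<le> real (Suc n) * ((real (Suc l) * ?M y ^ l) * (1 / real (Suc n)))"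
        by (rule mult_left_mono) simp
      also have "\<dots> = real (Suc l) * ?M y ^ l" by simp
      finally have "real (Suc n) * \<bar>?p (?t n) y - ?p \<tau> y\<bar> * (\<bar>?q y\<bar> * norm (F y)) \<le> (real (Suc l) * ?M y ^ l) * (\<bar>?q y\<bar> * norm (F y))"
        by (rule mult_right_mono) simp
      moreover have "norm (?s n y) = real (Suc n) * \<bar>?p (?t n) y - ?p \<tau> y\<bar> * (\<bar>?q y\<bar> * norm (F y))"
        by (simp only: norm_scaleR abs_mult[of "real (Suc n) * (?p (?t n) y - ?p \<tau> y)" "?q y"] abs_mult[of "real (Suc n)"] abs_of_nat mult.assoc[of "real (Suc n) * _"])
      moreover have "norm (?b y *\<^sub>R F y) = (real (Suc l) * ?M y ^ l) * (\<bar>?q y\<bar> * norm (F y))"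
      proof -
        have "0 \<le> real (Suc l) * ?M y ^ l" using tau0 by simp
        then show ?thesis by (simp only: norm_scaleR abs_mult[of "real (Suc l) * ?M y ^ l" "?q y"] abs_of_nonneg mult.assoc[of "real (Suc l) * ?M y ^ l"])
      qed
      ultimately show "norm (?s n y) \<le> norm (?b y *\<^sub>R F y)" by (simp only:)
    qed
  qed measurable
  moreover have "(\<integral>y. ?s n y \<partial>L) = 0" for n
  proof -
    have i: "integrable L (\<lambda>y. (?p x y * ?q y) *\<^sub>R F y)" for x
      by (intro integrable_poly_growth poly_growth_mult[OF _ qg] poly_growth_power poly_growth_pos_part poly_growth_norm) measurable
    have "?s n = (\<lambda>y. real (Suc n) *\<^sub>R ((?p (?t n) y * ?q y) *\<^sub>R F y - (?p \<tau> y * ?q y) *\<^sub>R F y))"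
    proof -
      have "(m * (a - b) * q) *\<^sub>R f = m *\<^sub>R ((a * q) *\<^sub>R f - (b * q) *\<^sub>R f)" for m a b q :: real and f :: complex
        by (simp add: scaleR_conv_of_real algebra_simps)
      then show ?thesis by (simp only:)
    qed
    then have "(\<integral>y. ?s n y \<partial>L) = real (Suc n) *\<^sub>R ((\<integral>y. (?p (?t n) y * ?q y) *\<^sub>R F y \<partial>L) - (\<integral>y. (?p \<tau> y * ?q y) *\<^sub>R F y \<partial>L))"
      by (simp only: integral_scaleR_right Bochner_Integration.integral_diff[OF i i])
    moreover have "?t n \<ge> r0\<^sup>2" using Suc.prems(3) by (simp add: add_increasing2)
    ultimately show ?thesis using IH[OF Suc.prems(3)] IH[of "?t n"] by (simp only: diff_self scaleR_zero_right)
  qed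
  ultimately have "(\<integral>y. ?d y \<partial>L) = 0" by (simp only: LIMSEQ_const_iff)
  moreover have "?d = (\<lambda>y. (- real (Suc l)) *\<^sub>R ((max 0 ((norm y)\<^sup>2 - \<tau>) ^ l * ?q y) *\<^sub>R F y))"
  proof -
    have "(m * a * (- 1) * q) *\<^sub>R f = (- m) *\<^sub>R ((a * q) *\<^sub>R f)" for m a q :: real and f :: complex by simp
    then show ?thesis by (simp only:)
  qed
  ultimately have "(- real (Suc l)) *\<^sub>R (\<integral>y. (max 0 ((norm y)\<^sup>2 - \<tau>) ^ l * ?q y) *\<^sub>R F y \<partial>L) = 0"
    by (simp only: integral_scaleR_right)
  then show ?case unfolding scaleR_eq_0_iff l_def by simp
qed

lemma continuous_zero_of_square:
  fixes g :: "'a \<Rightarrow> real"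
  assumes [measurable]: "g \<in> borel_measurable borel" and cont: "continuous_on H g" and int: "integrable L (\<lambda>y. (g y)\<^sup>2)"
    and z: "(\<integral>y. (g y)\<^sup>2 \<partial>L) = 0" and y: "y \<in> H"
  shows "g y = 0"
proof (rule ccontr)
  assume ny: "g y \<noteq> 0"
  have ae: "AE y in L. (g y)\<^sup>2 = 0" using integral_nonneg_eq_0_iff_AE[OF int] z by simp
  obtain e where e: "e > 0" "\<And>x. x \<in> H \<Longrightarrow> dist y x < e \<Longrightarrow> g x \<noteq> 0"
    using continuous_on_avoid[OF cont y ny] by (auto simp: dist_commute)
  have "AE x in L. x \<notin> ball y e"
    using ae AE_subspace_lborel_in[OF subH] by eventually_elim (use e(2) in auto)
  then have "emeasure L {x\<in>space L. x \<in> ball y e} = 0" by (rule emeasure_eq_0_AE)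
  moreover have "{x\<in>space L. x \<in> ball y e} = ball y e" by auto
  ultimately show False using emeasure_ball_subspace_pos[OF subH y e(1)] by simp
qed

text \<open>
  A second difference in \<open>\<tau>\<close> of \<open>max 0 (|y|\<^sup>2 - \<tau>)\<close> is a hat function of \<open>|y|\<^sup>2\<close>.  Its product
  with \<open>F\<close> has compact support and is orthogonal to all polynomials, hence, by the
  Stone-Weierstrass theorem, to its own real and imaginary part.
\<close>

lemma vanishes_outside_ball:
  assumes y0: "y0 \<in> H" "norm y0 > R"
  shows "F y0 = 0"
proof -
  define r0 where "r0 = (R + norm y0) / 2"
  have r0: "r0 > R" "r0 > 0" "r0 < norm y0" using y0 R by (auto simp: r0_def)
  define \<tau> where "\<tau> = (norm y0)\<^sup>2"
  have r2: "r0\<^sup>2 < \<tau>" unfolding \<tau>_def using r0 by (intro power_strict_mono) auto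
  \<comment> \<open>the largest step for which no node of the second difference falls below \<open>r0\<^sup>2\<close>\<close>
  define \<delta> where "\<delta> = \<tau> - r0\<^sup>2"
  have d: "\<delta> > 0" using r2 by (simp add: \<delta>_def)
  define \<psi> where "\<psi> y = max 0 ((norm y)\<^sup>2 - (\<tau> - \<delta>)) - 2 * max 0 ((norm y)\<^sup>2 - \<tau>) + max 0 ((norm y)\<^sup>2 - (\<tau> + \<delta>))" for y :: 'a
  have [measurable]: "\<psi> \<in> borel_measurable borel" unfolding \<psi>_def by measurable
  have psi0: "\<psi> y0 > 0" using d by (simp add: \<psi>_def \<tau>_def[symmetric])
  have psi_out: "\<psi> y = 0" if "norm y > sqrt (\<tau> + \<delta>)" for y
  proof -
    have "\<tau> + \<delta> \<ge> 0" using d by (simp add: \<tau>_def)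
    then have "\<tau> + \<delta> < (norm y)\<^sup>2" using that real_less_lsqrt[of "norm y" "\<tau> + \<delta>"] by (metis linorder_not_le norm_ge_zero order_less_irrefl real_sqrt_le_iff real_sqrt_unique)
    then show ?thesis using d by (simp add: \<psi>_def)
  qed
  have psig: "poly_growth \<psi>"
  proof -
    have "poly_growth (\<lambda>y::'a. max 0 ((norm y)\<^sup>2 - (\<tau> - \<delta>)) + (- 2) * max 0 ((norm y)\<^sup>2 - \<tau>) + max 0 ((norm y)\<^sup>2 - (\<tau> + \<delta>)))"
      by (intro poly_growth_add poly_growth_mult poly_growth_const poly_growth_pos_part poly_growth_power poly_growth_norm)
    then show ?thesis by (rule poly_growth_mono) (simp add: \<psi>_def)
  qed
  define G where "G y = decay_weight r0 y * \<psi> y" for y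
  have [measurable]: "G \<in> borel_measurable borel" unfolding G_def by measurable
  have Gg: "poly_growth G" unfolding G_def by (intro poly_growth_mult decay_weight_growth psig r0)
  have G0: "G y0 \<noteq> 0" unfolding G_def using psi0 decay_weight_pos[OF r0(2), of y0] by simp
  have Gz: "(\<integral>y. (p y * G y) *\<^sub>R F y \<partial>L) = 0" if p: "real_polynomial_function p" for p
  proof -
    have pg: "poly_growth p" by (rule poly_growth_real_polynomial[OF p])
    have [measurable]: "p \<in> borel_measurable borel" using annihilated_polynomial[OF p] by (simp add: annihilated_def)
    let ?J = "\<lambda>t y. (max 0 ((norm y)\<^sup>2 - t) ^ 1 * (decay_weight r0 y * p y)) *\<^sub>R F y"
    have z: "(\<integral>y. ?J t y \<partial>L) = 0" if "t \<ge> r0\<^sup>2" for t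
      by (rule truncated_power_zero[OF p r0(1,2) _ _ that]) auto
    have i: "integrable L (?J t)" for t
      by (intro integrable_poly_growth poly_growth_mult poly_growth_power poly_growth_pos_part poly_growth_norm decay_weight_growth r0 pg) measurable
    have "(\<lambda>y. (p y * G y) *\<^sub>R F y) = (\<lambda>y. ?J (\<tau> - \<delta>) y - 2 *\<^sub>R ?J \<tau> y + ?J (\<tau> + \<delta>) y)"
    proof -
      have "(q * (w * (a - 2 * b + c))) *\<^sub>R f = (a ^ 1 * (w * q)) *\<^sub>R f - 2 *\<^sub>R (b ^ 1 * (w * q)) *\<^sub>R f + (c ^ 1 * (w * q)) *\<^sub>R f"
        for q w a b c :: real and f :: complex
        by (simp add: scaleR_conv_of_real algebra_simps)
      then show ?thesis unfolding G_def \<psi>_def by (simp only:)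
    qed
    then have "(\<integral>y. (p y * G y) *\<^sub>R F y \<partial>L) = (\<integral>y. ?J (\<tau> - \<delta>) y \<partial>L) - 2 *\<^sub>R (\<integral>y. ?J \<tau> y \<partial>L) + (\<integral>y. ?J (\<tau> + \<delta>) y \<partial>L)"
      by (simp only: Bochner_Integration.integral_add[OF Bochner_Integration.integrable_diff[OF i integrable_scaleR_right[OF i]] i]
        Bochner_Integration.integral_diff[OF i integrable_scaleR_right[OF i]] integral_scaleR_right)
    moreover have "\<tau> - \<delta> \<ge> r0\<^sup>2" "\<tau> \<ge> r0\<^sup>2" "\<tau> + \<delta> \<ge> r0\<^sup>2" using r2 d by (auto simp: \<delta>_def)
    ultimately show ?thesis using z by (simp only: scaleR_zero_right diff_self add_0)
  qed
  have part_zero: "c (G y0 *\<^sub>R F y0) = 0" if c: "bounded_linear (c :: complex \<Rightarrow> real)" "\<And>x. \<bar>c x\<bar> \<le> norm x" for c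
  proof -
    interpret c: bounded_linear c by (rule c)
    let ?g = "\<lambda>y. c (G y *\<^sub>R F y)"
    have contG: "continuous_on UNIV G"
    proof -
      have "max r0 (norm y) > 0" for y :: 'a using r0(2) by (simp add: less_max_iff_disj)
      then have "max r0 (norm y) ^ (2 * dim H - 1) \<noteq> 0" for y :: 'a by (metis power_not_zero order_less_irrefl)
      then show ?thesis unfolding G_def \<psi>_def decay_weight_def by (intro continuous_intros) auto
    qed
    have cg: "continuous_on H ?g"
      by (intro c.continuous_on continuous_intros continuous_on_subset[OF contG] F_cont) auto
    have [measurable]: "c \<in> borel_measurable borel"
      by (intro borel_measurable_continuous_onI linear_continuous_on c)
    have [measurable]: "?g \<in> borel_measurable borel" by measurable
    have iG: "integrable L (\<lambda>y. G y *\<^sub>R F y)" by (rule integrable_poly_growth[OF Gg]) measurable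
    have ig: "integrable L ?g" by (rule integrable_bounded_linear[OF c(1) iG])
    have pz: "integrable L (\<lambda>y. p y * ?g y)" "(\<integral>y. p y * ?g y \<partial>L) = 0" if p: "real_polynomial_function p" for p
    proof -
      have [measurable]: "p \<in> borel_measurable borel" using annihilated_polynomial[OF p] by (simp add: annihilated_def)
      have i: "integrable L (\<lambda>y. (p y * G y) *\<^sub>R F y)"
        by (intro integrable_poly_growth poly_growth_mult poly_growth_real_polynomial p Gg) measurable
      have e: "c ((p y * G y) *\<^sub>R F y) = p y * ?g y" for y by (simp only: scaleR_scaleR[symmetric] c.scaleR real_scaleR_def)
      show "integrable L (\<lambda>y. p y * ?g y)" using integrable_bounded_linear[OF c(1) i] by (simp only: e)
      show "(\<integral>y. p y * ?g y \<partial>L) = 0" using integral_bounded_linear[OF c(1) i] Gz[OF p] by (simp only: e c.zero)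
    qed
    define S where "S = H \<inter> cball 0 (sqrt (\<tau> + \<delta>))"
    have S: "compact S" unfolding S_def by (intro closed_Int_compact closed_subspace subH compact_cball)
    have out: "?g y = 0" if "y \<in> H" "y \<notin> S" for y
      using psi_out[of y] that by (simp add: S_def G_def c.zero)
    have bdd: "bounded (?g ` S)"
      by (intro compact_imp_bounded compact_continuous_image S continuous_on_subset[OF cg]) (auto simp: S_def)
    then obtain B where B: "\<And>y. y \<in> S \<Longrightarrow> \<bar>?g y\<bar> \<le> B" unfolding bounded_iff by auto
    have gB: "\<bar>?g y\<bar> \<le> \<bar>B\<bar>" if "y \<in> H" for y using B[of y] out[OF that] by (cases "y \<in> S") auto
    have i2: "integrable L (\<lambda>y. (?g y)\<^sup>2)"
    proof (rule Bochner_Integration.integrable_bound[OF integrable_mult_right[OF ig, of "\<bar>B\<bar>"]])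
      show "AE y in L. norm ((?g y)\<^sup>2) \<le> norm (\<bar>B\<bar> * ?g y)"
        using AE_subspace_lborel_in[OF subH]
      proof eventually_elim
        case (elim y)
        have "\<bar>?g y\<bar> * \<bar>?g y\<bar> \<le> \<bar>B\<bar> * \<bar>?g y\<bar>" by (rule mult_right_mono[OF gB[OF elim]]) simp
        then show ?case by (simp add: power2_eq_square abs_mult)
      qed
    qed measurable
    have le: "(\<integral>y. (?g y)\<^sup>2 \<partial>L) \<le> e * (\<integral>y. \<bar>?g y\<bar> \<partial>L)" if e: "e > 0" for e
    proof -
      obtain p where p: "real_polynomial_function p" "\<And>y. y \<in> S \<Longrightarrow> \<bar>?g y - p y\<bar> < e"
        using Stone_Weierstrass_real_polynomial_function[OF S continuous_on_subset[OF cg] e] by (auto simp: S_def)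
      have "(\<integral>y. (?g y)\<^sup>2 \<partial>L) = (\<integral>y. (?g y)\<^sup>2 - p y * ?g y \<partial>L)"
        using pz[OF p(1)] i2 by simp
      also have "\<dots> \<le> (\<integral>y. e * \<bar>?g y\<bar> \<partial>L)"
      proof (rule integral_mono_AE)
        show "integrable L (\<lambda>y. (?g y)\<^sup>2 - p y * ?g y)" using pz[OF p(1)] i2 by simp
        show "integrable L (\<lambda>y. e * \<bar>?g y\<bar>)" using ig by simp
        show "AE y in L. (?g y)\<^sup>2 - p y * ?g y \<le> e * \<bar>?g y\<bar>"
          using AE_subspace_lborel_in[OF subH]
        proof eventually_elim
          case (elim y)
          show ?case
          proof (cases "y \<in> S")
            case True
            have "(?g y)\<^sup>2 - p y * ?g y = (?g y - p y) * ?g y" by (simp add: power2_eq_square left_diff_distrib)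
            also have "\<dots> \<le> \<bar>(?g y - p y) * ?g y\<bar>" by simp
            also have "\<dots> = \<bar>?g y - p y\<bar> * \<bar>?g y\<bar>" by (rule abs_mult)
            also have "\<dots> \<le> e * \<bar>?g y\<bar>" using p(2)[OF True] by (intro mult_right_mono) auto
            finally show ?thesis .
          next
            case False
            then show ?thesis using out[OF elim False] by simp
          qed
        qed
      qed
      finally show ?thesis by simp
    qed
    have "(\<integral>y. (?g y)\<^sup>2 \<partial>L) \<le> 0"
    proof (rule field_le_epsilon)
      fix e :: real assume e: "e > 0"
      let ?I = "\<integral>y. \<bar>?g y\<bar> \<partial>L"
      have I: "?I \<ge> 0" by simp
      then have I1: "?I + 1 > 0" by linarith
      have q: "?I / (?I + 1) \<le> 1" unfolding divide_le_eq_1_pos[OF I1] by linarith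
      have "(\<integral>y. (?g y)\<^sup>2 \<partial>L) \<le> (e / (?I + 1)) * ?I" by (rule le, rule divide_pos_pos, rule e) (use I in linarith)
      also have "\<dots> = e * (?I / (?I + 1))" by simp
      also have "\<dots> \<le> e * 1" by (rule mult_left_mono[OF q]) (use e in simp)
      finally show "(\<integral>y. (?g y)\<^sup>2 \<partial>L) \<le> 0 + e" by simp
    qed
    moreover have "(\<integral>y. (?g y)\<^sup>2 \<partial>L) \<ge> 0" by simp
    ultimately have "(\<integral>y. (?g y)\<^sup>2 \<partial>L) = 0" by (rule antisym)
    then show ?thesis by (intro continuous_zero_of_square[OF _ cg i2 _ y0(1)]) auto
  qed
  have "Re (G y0 *\<^sub>R F y0) = 0" by (rule part_zero[OF bounded_linear_Re abs_Re_le_cmod])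
  moreover have "Im (G y0 *\<^sub>R F y0) = 0" by (rule part_zero[OF bounded_linear_Im abs_Im_le_cmod])
  ultimately have "G y0 *\<^sub>R F y0 = 0" by (simp add: complex_eq_iff)
  then show ?thesis using G0 by simp
qed

end

section \<open>Planes through the pole and null sets\<close>

lemma nn_integral_subspace_uminus:
  fixes V :: "'a::euclidean_space set"
  assumes V: "subspace V" and [measurable]: "f \<in> borel_measurable borel"
  shows "(\<integral>\<^sup>+x. f (- x) \<partial>subspace_lborel V) = (\<integral>\<^sup>+x. f x \<partial>subspace_lborel V)"
proof -
  obtain B where B: "orthonormal_basis B V" using orthonormal_basis_exists[OF V] by blast
  have fin: "finite B" using orthonormal_basis_independent[OF B] by auto
  let ?g = "\<lambda>x::'a. ennreal (exp (- 1 * (norm x)\<^sup>2))"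
  have "(\<integral>\<^sup>+x. f x \<partial>subspace_lborel V) * ennreal (sqrt (pi / 1) ^ dim V)
     = (\<integral>\<^sup>+x. f (- x) \<partial>subspace_lborel V) * ennreal (sqrt (pi / 1) ^ dim V)"
    using invariant_measures_exchange[OF fin fin refl, of ?g f "\<lambda>v. v"] nn_integral_gaussian_subspace[OF V, of 1]
    by (simp add: subspace_lborel_eq_combination[OF B] mult.commute)
  moreover have "\<not> sqrt (pi / 1) ^ dim V \<le> 0" by (simp add: not_le)
  ultimately show ?thesis unfolding mult_right_ennreal_cancel by auto
qed

lemma second_point_scale: "c \<noteq> 0 \<Longrightarrow> second_point N (c *\<^sub>R u) = second_point N u"
  by (simp add: second_point_def)

text \<open>
  Negative factors occur because both rays of a line give the same second point.
\<close>

lemma null_scale_iff: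
  fixes V :: "'a::euclidean_space set"
  assumes V: "subspace V" and c: "c \<noteq> 0" and [measurable]: "f \<in> borel_measurable borel"
  shows "(\<integral>\<^sup>+x. f (c *\<^sub>R x) \<partial>subspace_lborel V) = 0 \<longleftrightarrow> (\<integral>\<^sup>+x. f x \<partial>subspace_lborel V) = 0"
proof -
  have *: "(\<integral>\<^sup>+x. g (c *\<^sub>R x) \<partial>subspace_lborel V) = 0 \<longleftrightarrow> (\<integral>\<^sup>+x. g x \<partial>subspace_lborel V) = 0"
    if "c > 0" and "g \<in> borel_measurable borel" for c :: real and g :: "'a \<Rightarrow> ennreal"
    using nn_integral_subspace_scale[OF V that] that(1) by simp
  show ?thesis
  proof (cases "c > 0")
    case True
    then show ?thesis by (rule *) simp
  next
    case False
    then have "- c > 0" using c by simp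
    from *[OF this, of "\<lambda>x. f (- x)"] show ?thesis using nn_integral_subspace_uminus[OF V, of f] by simp
  qed
qed

context pole_slice
begin

lemma shifted_direction: "s \<noteq> 0 \<Longrightarrow> second_point N (s *\<^sub>R \<nu> + (- s * \<rho>) *\<^sub>R z) = second_point N (p + z - N)"
proof -
  assume s: "s \<noteq> 0"
  have pN: "p - N = - (1 / \<rho>) *\<^sub>R \<nu>" using rho(4) by (simp add: \<nu>_def scaleR_diff_right)
  have "s *\<^sub>R \<nu> + (- s * \<rho>) *\<^sub>R z = (- s * \<rho>) *\<^sub>R (z + (p - N))"
    unfolding pN using rho(4) by (simp add: scaleR_add_right scaleR_diff_right)
  also have "z + (p - N) = p + z - N" by simp
  finally show ?thesis using second_point_scale[of "- s * \<rho>"] s rho(4) by simp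
qed

text \<open>
  In the coordinates \<open>s \<nu> + w\<close> every section \<open>s \<noteq> 0\<close> of the cone of directions leading to \<open>Z\<close>
  is a dilate of the set over which the stereographic formula for the area of \<open>Z\<close>
  integrates a positive density.
\<close>

lemma cone_null_iff:
  assumes d: "dim U > 0" and [measurable]: "Z \<in> sets borel"
  shows "(\<integral>\<^sup>+u. indicator Z (second_point N u) \<partial>subspace_lborel V) = 0 \<longleftrightarrow> emeasure (surface_measure (pole_plane N U p)) Z = 0"
proof -
  interpret S: sigma_finite_measure "subspace_lborel U" by (rule sigma_finite_subspace_lborel[OF subU])
  let ?I = "\<integral>\<^sup>+z. indicator Z (second_point N (p + z - N)) \<partial>subspace_lborel U"
  have inner: "(\<integral>\<^sup>+w. indicator Z (second_point N (s *\<^sub>R \<nu> + w)) \<partial>subspace_lborel U) = 0 \<longleftrightarrow> ?I = 0" if s: "s \<noteq> 0" for s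
  proof -
    have "- s * \<rho> \<noteq> 0" using s rho(4) by simp
    from null_scale_iff[OF subU this, of "\<lambda>w. indicator Z (second_point N (s *\<^sub>R \<nu> + w))"]
    show ?thesis unfolding shifted_direction[OF s] by simp
  qed
  have "(\<integral>\<^sup>+u. indicator Z (second_point N u) \<partial>subspace_lborel V)
     = (\<integral>\<^sup>+s. \<integral>\<^sup>+w. indicator Z (second_point N (s *\<^sub>R \<nu> + w)) \<partial>subspace_lborel U \<partial>lborel)"
    using nn_integral_subspace_line[OF subV norm_nu nu_V, of "\<lambda>u. indicator Z (second_point N u)"] V_orth_nu by simp
  then have "(\<integral>\<^sup>+u. indicator Z (second_point N u) \<partial>subspace_lborel V) = 0 \<longleftrightarrow>
     (AE s in lborel. (\<integral>\<^sup>+w. indicator Z (second_point N (s *\<^sub>R \<nu> + w)) \<partial>subspace_lborel U) = 0)"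
    by (simp add: nn_integral_0_iff_AE)
  also have "\<dots> \<longleftrightarrow> (AE s in lborel. s \<noteq> (0::real) \<longrightarrow> ?I = 0)"
  proof (rule eventually_cong)
    show "AE s in lborel. s \<noteq> (0::real)" by (rule AE_lborel_singleton)
    show "((\<integral>\<^sup>+w. indicator Z (second_point N (s *\<^sub>R \<nu> + w)) \<partial>subspace_lborel U) = 0) = (s \<noteq> 0 \<longrightarrow> ?I = 0)" if "s \<noteq> 0" for s
      using inner[OF that] that by simp
  qed
  also have "\<dots> \<longleftrightarrow> ?I = 0"
  proof
    assume "AE s in lborel. s \<noteq> (0::real) \<longrightarrow> ?I = 0"
    then have ae: "AE s in lborel :: real measure. ?I = 0"
      using AE_lborel_singleton[of "0::real"] by eventually_elim simp
    show "?I = 0"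
    proof (rule ccontr)
      assume "?I \<noteq> 0"
      then have "AE s in lborel :: real measure. False" using ae by simp
      then have "AE s in subspace_lborel (UNIV :: real set). False" unfolding subspace_lborel_UNIV .
      then show False using subspace_lborel_not_null[of "UNIV :: real set"] by simp
    qed
  qed simp
  also have "\<dots> \<longleftrightarrow> emeasure (surface_measure (pole_plane N U p)) Z = 0"
  proof -
    have "emeasure (surface_measure (pole_plane N U p)) Z
       = (\<integral>\<^sup>+z. ennreal ((2 / (1 + (norm (p + z))\<^sup>2)) ^ dim U) * indicator Z (second_point N (p + z - N)) \<partial>subspace_lborel U)"
      unfolding surface_measure_pole_plane[OF d]
      by (subst nn_integral_indicator[symmetric], simp, subst nn_integral_distr, simp, simp, subst nn_integral_density) auto
    moreover have "ennreal ((2 / (1 + (norm (p + z))\<^sup>2)) ^ dim U) * i = 0 \<longleftrightarrow> i = 0" for z i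
    proof -
      have "1 + (norm (p + z))\<^sup>2 > 0" by (simp add: add_pos_nonneg)
      then have "(2 / (1 + (norm (p + z))\<^sup>2)) ^ dim U > 0" by simp
      then have "ennreal ((2 / (1 + (norm (p + z))\<^sup>2)) ^ dim U) \<noteq> 0" unfolding ennreal_eq_0_iff by linarith
      then show ?thesis unfolding mult_eq_0_iff by blast
    qed
    ultimately show ?thesis by (simp only:) (subst (1 2) nn_integral_0_iff_AE, simp_all)
  qed
  finally show ?thesis .
qed

lemma affine_plane: "affine (pole_plane N U p)"
  unfolding c_plane using subV by (simp add: affine_translation[symmetric] subspace_imp_affine)

lemma aff_dim_plane: "aff_dim (pole_plane N U p) = int (dim U) + 1"
proof -
  have "aff_dim (pole_plane N U p) = aff_dim V" unfolding c_plane by (rule aff_dim_translation_eq)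
  also have "\<dots> = int (dim V)" by (rule aff_dim_subspace[OF subV])
  finally show ?thesis by (simp add: dim_V)
qed

lemma N_in_plane: "N \<in> pole_plane N U p"
  unfolding pole_plane_def by (rule image_eqI[of _ _ 0]) (auto simp: span_zero)

lemma p_in_plane: "p \<in> pole_plane N U p"
proof -
  have "- (N - p) \<in> span (insert (N - p) U)" by (intro span_neg span_base) simp
  then show ?thesis unfolding pole_plane_def by (intro image_eqI[of _ _ "- (N - p)"]) auto
qed

end

text \<open>
  The vector \<open>p\<close> is the component of \<open>x\<close> orthogonal to the direction \<open>U\<close> of the trace.
\<close>

lemma pole_plane_exists:
  fixes N :: "'a::euclidean_space"
  assumes N: "norm N = 1" and t: "affine \<tau>" "N \<in> \<tau>" "x \<in> \<tau>" "x \<bullet> N = 0"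
  obtains U p where "pole_slice N U p" "\<tau> = pole_plane N U p" "aff_dim \<tau> = int (dim U) + 1"
    "U = {v. N + v \<in> \<tau> \<and> v \<bullet> N = 0}"
proof -
  define D where "D = {v. N + v \<in> \<tau>}"
  have tD: "\<tau> = (+) N ` D" 
  proof (intro equalityI subsetI)
    fix x assume "x \<in> \<tau>"
    then show "x \<in> (+) N ` D" by (intro image_eqI[of _ _ "x - N"]) (auto simp: D_def)
  qed (auto simp: D_def)
  have sD: "subspace D"
  proof -
    have "D = (\<lambda>x. (- N) + x) ` \<tau>" 
      unfolding tD by (simp add: image_image)
    then show ?thesis using affine_diffs_subspace[OF t(1,2)] by simp
  qed
  define U where "U = {v\<in>D. v \<bullet> N = 0}"
  have sU: "subspace U" unfolding U_def by (rule subspace_orthogonal_part[OF sD])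
  have NN: "N \<bullet> N = 1" using N by (simp add: dot_square_norm)
  obtain y p where yp: "y \<in> U" "\<And>w. w \<in> U \<Longrightarrow> orthogonal p w" "x = y + p"
    using orthogonal_subspace_decomp_exists[of U x] span_eq_iff[THEN iffD2, OF sU] by metis
  have pN: "p \<bullet> N = 0" using yp t(4) by (simp add: U_def inner_add_left)
  interpret pole_slice N U p
  proof
    show "x \<bullet> p = 0" if "x \<in> U" for x using yp(2)[OF that] by (simp add: orthogonal_def inner_commute)
  qed (use N sU pN in \<open>auto simp: U_def\<close>)
  have xNV: "x - N \<in> D" using t(3) by (simp add: D_def)
  have yV: "y \<in> D" using yp by (simp add: U_def)
  have NpV: "N - p \<in> D"
  proof -
    have "N - p = y - (x - N)" using yp(3) by simp
    then show ?thesis using subspace_diff[OF sD yV xNV] by (simp only:)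
  qed
  have "D = span (insert (N - p) U)"
  proof
    show "span (insert (N - p) U) \<subseteq> D" using NpV by (intro span_minimal sD) (auto simp: U_def)
    show "D \<subseteq> span (insert (N - p) U)"
    proof
      fix v assume v: "v \<in> D"
      have "(N - p) \<bullet> N = 1" using NN pN by (simp add: inner_diff_left)
      then have "v - (v \<bullet> N) *\<^sub>R (N - p) \<in> U"
        using v NpV sD by (simp add: U_def subspace_diff subspace_scale inner_diff_left)
      then have "v - (v \<bullet> N) *\<^sub>R (N - p) \<in> span U" by (rule span_base)
      then show "v \<in> span (insert (N - p) U)" unfolding span_insert by blast
    qed
  qed
  then have eq: "\<tau> = pole_plane N U p" unfolding tD pole_plane_def by simp
  show ?thesis
  proof (rule that[OF pole_slice_axioms eq])
    show "aff_dim \<tau> = int (dim U) + 1" unfolding eq by (rule aff_dim_plane)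
    show "U = {v. N + v \<in> \<tau> \<and> v \<bullet> N = 0}" unfolding U_def D_def by simp
  qed
qed

lemma subspace_hyperplane: "subspace {y :: 'a::euclidean_space. y \<bullet> N = 0}"
  using subspace_orthogonal_part[of "UNIV :: 'a set" N] by simp

lemma dim_orthogonal_complement_line:
  fixes N :: "'a::euclidean_space"
  assumes "norm N = 1" shows "DIM('a) = Suc (dim {y. y \<bullet> N = 0})"
  using dim_subspace_orthogonal_part[of "UNIV :: 'a set" N] assms by simp

lemma pole_slice_whole_space:
  fixes N :: "'a::euclidean_space"
  assumes N: "norm N = 1"
  shows "pole_slice N {y. y \<bullet> N = 0} 0" "pole_slice.V N {y. y \<bullet> N = 0} 0 = UNIV" "pole_plane N {y. y \<bullet> N = 0} 0 = UNIV"
proof -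
  let ?K = "{y. y \<bullet> N = 0}"
  show "pole_slice N ?K 0" by standard (use subspace_hyperplane N in auto)
  then interpret K: pole_slice N ?K 0 .
  have "span K.V = UNIV" using dim_eq_full[of K.V] K.dim_V dim_orthogonal_complement_line[OF N] by simp
  then show V: "K.V = UNIV" using span_eq_iff[THEN iffD2, OF K.subV] by (simp only:)
  show "pole_plane N ?K 0 = UNIV" unfolding pole_plane_def K.V_def[symmetric] V by (simp add: surj_plus)
qed

lemma nn_integral_surface_sphere:
  fixes g :: "'a::euclidean_space \<Rightarrow> ennreal"
  assumes [measurable]: "g \<in> borel_measurable borel"
  shows "(\<integral>\<^sup>+x. g x \<partial>surface_measure UNIV) = ennreal (DIM('a)) * (\<integral>\<^sup>+x. g ((1 / norm x) *\<^sub>R x) * indicator (ball 0 1) x \<partial>lborel)"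
proof -
  have cp: "closest_point (UNIV :: 'a set) 0 = 0" by (rule closest_point_self) simp
  have [measurable]: "(\<lambda>x::'a. (1 / norm x) *\<^sub>R x) \<in> borel_measurable (restrict_space lborel (ball 0 1))"
    by (rule measurable_restrict_space1) measurable
  have e: "surface_measure (UNIV :: 'a set) = scale_measure (ennreal (DIM('a)))
     (distr (restrict_space lborel (ball 0 1)) borel (\<lambda>x. (1 / norm x) *\<^sub>R x))"
    by (simp add: surface_measure_def Let_def cp subspace_lborel_UNIV)
  show ?thesis unfolding e
    by (subst nn_integral_scale_measure, simp, subst nn_integral_distr, simp, simp, subst nn_integral_restrict_space) auto
qed

lemma finite_surface_sphere: "finite_measure (surface_measure (UNIV :: 'a::euclidean_space set))"
proof
  have "emeasure (surface_measure (UNIV :: 'a set)) (space (surface_measure UNIV)) = (\<integral>\<^sup>+x. 1 \<partial>surface_measure (UNIV :: 'a set))"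
    by simp
  also have "\<dots> = ennreal (DIM('a)) * emeasure lborel (ball (0::'a) 1)"
    by (subst nn_integral_surface_sphere) auto
  also have "\<dots> < \<infinity>" using emeasure_ball_subspace_finite[of "UNIV :: 'a set" 0 1] by (simp add: subspace_lborel_UNIV ennreal_mult_less_top)
  finally show "emeasure (surface_measure (UNIV :: 'a set)) (space (surface_measure UNIV)) \<noteq> \<infinity>" by simp
qed

lemma sets_surface_measure [simp, measurable_cong]: "sets (surface_measure \<tau>) = sets borel"
  by (simp add: surface_measure_def Let_def)

lemma space_surface_measure [simp]: "space (surface_measure \<tau>) = UNIV"
  by (simp add: surface_measure_def Let_def space_scale_measure)

text \<open>
  A direction is \<open>x / |x|\<close> with \<open>x\<close> uniform in the ball.  The factor \<open>1 / |x|\<close> can be absorbed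
  in \<open>t\<close>, and \<open>t x \<in> M\<close> is a null event for each \<open>t \<noteq> 0\<close>.
\<close>

lemma polar_null:
  fixes M :: "'a::euclidean_space set"
  assumes [measurable]: "M \<in> sets borel" and null: "emeasure lborel M = 0"
  shows "(\<integral>\<^sup>+v. \<integral>\<^sup>+t. indicator M (t *\<^sub>R v) \<partial>lborel \<partial>surface_measure UNIV) = 0"
proof -
  have [measurable]: "ball (0::'a) 1 \<in> sets borel" by simp
  have "(\<integral>\<^sup>+x. \<integral>\<^sup>+t. indicator M (t *\<^sub>R x) \<partial>(lborel :: real measure) \<partial>(lborel :: 'a measure)) = (\<integral>\<^sup>+t. \<integral>\<^sup>+x. indicator M (t *\<^sub>R x) \<partial>lborel \<partial>lborel)"
    by (rule lborel_pair.Fubini') measurable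
  also have "\<dots> = (\<integral>\<^sup>+t. 0 \<partial>(lborel :: real measure))"
  proof (rule nn_integral_cong_AE)
    show "AE t in lborel. (\<integral>\<^sup>+x. indicator M (t *\<^sub>R x) \<partial>(lborel :: 'a measure)) = 0"
      using AE_lborel_singleton[of "0::real"]
    proof eventually_elim
      case (elim t)
      then show ?case using null_scale_iff[of "UNIV :: 'a set" t "indicator M"] null by (simp add: subspace_lborel_UNIV)
    qed
  qed
  finally have "AE x in lborel. (\<integral>\<^sup>+t. indicator M (t *\<^sub>R x) \<partial>(lborel :: real measure)) = 0"
    by (simp add: nn_integral_0_iff_AE)
  then have "AE x in lborel. (\<integral>\<^sup>+t. indicator M (t *\<^sub>R ((1 / norm x) *\<^sub>R x)) \<partial>(lborel :: real measure)) * indicator (ball 0 1) x = 0"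
    using AE_lborel_singleton[of "0::'a"]
  proof eventually_elim
    case (elim x)
    have "(\<integral>\<^sup>+t. indicator M (t *\<^sub>R ((1 / norm x) *\<^sub>R x)) \<partial>(lborel :: real measure))
      = ennreal \<bar>norm x\<bar> * (\<integral>\<^sup>+t. indicator M ((0 + norm x * t) *\<^sub>R ((1 / norm x) *\<^sub>R x)) \<partial>(lborel :: real measure))"
      by (rule nn_integral_real_affine) (use elim in auto)
    also have "\<dots> = 0" using elim by simp
    finally show ?case by simp
  qed
  then have "(\<integral>\<^sup>+x. (\<integral>\<^sup>+t. indicator M (t *\<^sub>R ((1 / norm x) *\<^sub>R x)) \<partial>(lborel :: real measure)) * indicator (ball 0 1) x \<partial>lborel) = 0"
    by (subst nn_integral_0_iff_AE) measurable
  moreover have "(\<lambda>v. \<integral>\<^sup>+t. indicator M (t *\<^sub>R v) \<partial>(lborel :: real measure)) \<in> borel_measurable borel" by measurable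
  ultimately show ?thesis by (simp only: nn_integral_surface_sphere mult_zero_right)
qed

section \<open>The slice transform as a plane transform\<close>

lemma completion_AE_borel:
  fixes f f' :: "'a \<Rightarrow> 'b::{banach, second_countable_topology}"
  assumes f': "f' \<in> borel_measurable M" and ae: "AE x in M. f x = f' x"
  shows "f \<in> borel_measurable (completion M)"
    and "integrable (completion M) f \<longleftrightarrow> integrable M f'"
    and "integral\<^sup>L (completion M) f = integral\<^sup>L M f'"
proof -
  have aec: "AE x in completion M. f x = f' x" using ae by (rule AE_completion)
  have f'c: "f' \<in> borel_measurable (completion M)" using f' by (rule measurable_completion)
  show m: "f \<in> borel_measurable (completion M)"
  proof (rule measurableI)
    fix A :: "'b set" assume A: "A \<in> sets borel"
    show "f -` A \<inter> space (completion M) \<in> sets (completion M)"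
    proof (rule completion.in_sets_AE)
      show "f' -` A \<inter> space (completion M) \<in> sets (completion M)" using f'c A by (rule measurable_sets)
      show "AE x in completion M. x \<in> f' -` A \<inter> space (completion M) \<longleftrightarrow> x \<in> f -` A \<inter> space (completion M)"
        using aec by eventually_elim auto
    qed auto
  qed simp
  have "integrable (completion M) f \<longleftrightarrow> integrable (completion M) f'"
    by (rule integrable_cong_AE[OF m f'c aec])
  also have "\<dots> \<longleftrightarrow> integrable M f'" by (rule integrable_completion[OF f'])
  finally show "integrable (completion M) f \<longleftrightarrow> integrable M f'" .
  have "integral\<^sup>L (completion M) f = integral\<^sup>L (completion M) f'"
    by (rule integral_cong_AE[OF m f'c aec])
  also have "\<dots> = integral\<^sup>L M f'" by (rule integral_completion[OF f'])
  finally show "integral\<^sup>L (completion M) f = integral\<^sup>L M f'" .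
qed

lemma inverse_stereographic:
  fixes N :: "'a::euclidean_space"
  assumes N: "norm N = 1" and x: "x \<bullet> N = 0"
  shows "norm (second_point N (x - N)) = 1"
    and "1 - second_point N (x - N) \<bullet> N = 2 / (1 + (norm x)\<^sup>2)"
    and "second_point N (x - N) \<noteq> N"
proof -
  have NN: "N \<bullet> N = 1" using N by (simp add: dot_square_norm)
  have pos: "1 + x \<bullet> x > 0" by (simp add: add_pos_nonneg)
  define t where "t = 2 / (1 + x \<bullet> x)"
  have t: "t > 0" using pos by (simp add: t_def)
  have t2: "t * (1 + x \<bullet> x) = 2" using pos by (metis t_def less_irrefl nonzero_divide_eq_eq)
  have xx: "(x - N) \<bullet> (x - N) = 1 + x \<bullet> x" using NN x by (simp add: inner_diff inner_commute)
  have "N \<bullet> (x - N) = - 1" using NN x by (simp add: inner_diff_right inner_commute)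
  then have e: "second_point N (x - N) = N + t *\<^sub>R (x - N)"
    unfolding second_point_def xx t_def by simp
  have "(N + t *\<^sub>R (x - N)) \<bullet> (N + t *\<^sub>R (x - N)) = 1 + 2 * t * (N \<bullet> (x - N)) + t * (t * ((x - N) \<bullet> (x - N)))"
    using NN by (simp add: inner_add inner_commute algebra_simps)
  also have "\<dots> = 1" unfolding xx \<open>N \<bullet> (x - N) = - 1\<close> t2 by simp
  finally show "norm (second_point N (x - N)) = 1" unfolding e by (simp add: norm_eq_1)
  have "second_point N (x - N) \<bullet> N = 1 - t" unfolding e using NN x by (simp add: inner_add_left inner_diff_left)
  then show s: "1 - second_point N (x - N) \<bullet> N = 2 / (1 + (norm x)\<^sup>2)"
    by (simp add: t_def power2_norm_eq_inner)
  show "second_point N (x - N) \<noteq> N"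
    using s NN t by (auto simp: t_def power2_norm_eq_inner)
qed

lemma stereographic:
  fixes N :: "'a::euclidean_space"
  assumes N: "norm N = 1" and e: "norm \<eta> = 1" "\<eta> \<noteq> N"
  obtains x where "x \<bullet> N = 0" "second_point N (x - N) = \<eta>" "1 + (norm x)\<^sup>2 = 2 / (1 - \<eta> \<bullet> N)" "1 - \<eta> \<bullet> N > 0"
proof -
  have NN: "N \<bullet> N = 1" and ee: "\<eta> \<bullet> \<eta> = 1" using N e by (simp_all add: dot_square_norm)
  have d: "(\<eta> - N) \<bullet> (\<eta> - N) = 2 * (1 - \<eta> \<bullet> N)" using NN ee by (simp add: inner_diff inner_commute)
  have "(\<eta> - N) \<bullet> (\<eta> - N) > 0" using e by simp
  then have pos: "1 - \<eta> \<bullet> N > 0" unfolding d by simp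
  define c where "c = 1 / (1 - \<eta> \<bullet> N)"
  have c: "c \<noteq> 0" "c * (1 - \<eta> \<bullet> N) = 1" using pos by (auto simp: c_def)
  define x where "x = N + c *\<^sub>R (\<eta> - N)"
  have x: "x \<bullet> N = 0"
  proof -
    have "x \<bullet> N = 1 - c * (1 - \<eta> \<bullet> N)" using NN by (simp add: x_def inner_add_left inner_diff_left algebra_simps)
    then show ?thesis using c(2) by simp
  qed
  have "second_point N (x - N) = second_point N (\<eta> - N)" unfolding x_def using second_point_scale[OF c(1)] by simp
  also have "\<dots> = \<eta>"
  proof -
    have "2 * (N \<bullet> (\<eta> - N)) / ((\<eta> - N) \<bullet> (\<eta> - N)) = - 1"
      unfolding d using NN pos by (simp add: inner_diff_right inner_commute divide_eq_eq)
    then show ?thesis unfolding second_point_def by simp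
  qed
  finally have s: "second_point N (x - N) = \<eta>" .
  have "1 + (norm x)\<^sup>2 = 2 / (1 - \<eta> \<bullet> N)"
  proof -
    have "1 + (norm x)\<^sup>2 > 0" by (simp add: add_pos_nonneg)
    then show ?thesis using inverse_stereographic(2)[OF N x] pos unfolding s by (simp add: field_simps)
  qed
  then show ?thesis using that x s pos by blast
qed

text \<open>
  The factor is the density in \<open>surface_measure_pole_plane\<close>, so that integrals of \<open>f\<close> over
  slices become integrals over planes of dimension \<open>d\<close>.
\<close>

definition pullback :: "'a::euclidean_space \<Rightarrow> nat \<Rightarrow> ('a \<Rightarrow> complex) \<Rightarrow> 'a \<Rightarrow> complex" where
  "pullback N d f x = (if x \<bullet> N = 0 then (2 / (1 + (norm x)\<^sup>2)) ^ d *\<^sub>R f (second_point N (x - N)) else 0)"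

lemma punctured_sphere_borel [measurable]: "sphere (0::'a::euclidean_space) 1 - {N} \<in> sets borel"
  by simp

lemma pullback_borel:
  fixes f :: "'a::euclidean_space \<Rightarrow> complex"
  assumes N: "norm N = 1" and f: "continuous_on (sphere 0 1 - {N}) f"
  shows "pullback N d f \<in> borel_measurable borel"
proof -
  define f' where "f' \<eta> = indicator (sphere 0 1 - {N}) \<eta> *\<^sub>R f \<eta>" for \<eta>
  have [measurable]: "f' \<in> borel_measurable borel"
    unfolding f'_def by (rule borel_measurable_continuous_on_indicator[OF _ f]) simp
  have "pullback N d f = (\<lambda>x. indicator {x. x \<bullet> N = 0} x *\<^sub>R ((2 / (1 + (norm x)\<^sup>2)) ^ d *\<^sub>R f' (second_point N (x - N))))"
    using inverse_stereographic[OF N] by (auto simp: fun_eq_iff pullback_def f'_def indicator_def)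
  also have "\<dots> \<in> borel_measurable borel" by measurable
  finally show ?thesis .
qed

lemma pullback_continuous:
  fixes f :: "'a::euclidean_space \<Rightarrow> complex"
  assumes N: "norm N = 1" and f: "continuous_on (sphere 0 1 - {N}) f"
  shows "continuous_on {x. x \<bullet> N = 0} (pullback N d f)"
proof -
  have ne: "x - N \<noteq> 0" if "x \<bullet> N = 0" for x using that N by (auto simp: dot_square_norm)
  have "continuous_on {x. x \<bullet> N = 0} (\<lambda>x. (2 / (1 + (norm x)\<^sup>2)) ^ d *\<^sub>R f (second_point N (x - N)))"
  proof (intro continuous_intros)
    show "continuous_on {x. x \<bullet> N = 0} (\<lambda>x. f (second_point N (x - N)))"
    proof (rule continuous_on_compose2[OF f])
      show "continuous_on {x. x \<bullet> N = 0} (\<lambda>x. second_point N (x - N))"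
        unfolding second_point_def using ne by (intro continuous_intros) auto
      show "(\<lambda>x. second_point N (x - N)) ` {x. x \<bullet> N = 0} \<subseteq> sphere 0 1 - {N}"
        using inverse_stereographic[OF N] by auto
    qed
    show "\<forall>x\<in>{x. x \<bullet> N = 0}. 1 + (norm x)\<^sup>2 \<noteq> 0"
      by (metis add_pos_nonneg less_irrefl zero_le_power2 zero_less_one)
  qed
  then show ?thesis by (rule continuous_on_cong[THEN iffD1, rotated 2]) (auto simp: pullback_def)
qed

lemma pullback_bound:
  fixes f :: "'a::euclidean_space \<Rightarrow> complex"
  assumes N: "norm N = 1" and x: "x \<bullet> N = 0"
    and C: "\<And>\<eta>. \<eta> \<in> sphere 0 1 - {N} \<Longrightarrow> (1 - \<eta> \<bullet> N) powr \<mu> * norm (f \<eta>) \<le> C"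
  shows "norm (pullback N d f x) \<le> (C * 2 powr (real d - \<mu>)) * (1 + (norm x)\<^sup>2) powr (- (real d - \<mu>))"
proof -
  define t where "t = 2 / (1 + (norm x)\<^sup>2)"
  have pos: "1 + (norm x)\<^sup>2 > 0" by (simp add: add_pos_nonneg)
  then have t: "t > 0" by (simp add: t_def)
  let ?e = "second_point N (x - N)"
  have "t powr \<mu> * norm (f ?e) \<le> C"
    using C[of ?e] inverse_stereographic[OF N x] by (simp add: t_def)
  then have "t powr (real d - \<mu>) * (t powr \<mu> * norm (f ?e)) \<le> t powr (real d - \<mu>) * C" by (rule mult_left_mono) simp
  moreover have "t powr (real d - \<mu>) * (t powr \<mu> * norm (f ?e)) = norm (pullback N d f x)"
  proof -
    have "t powr (real d - \<mu>) * t powr \<mu> = t ^ d" using t by (simp add: powr_realpow flip: powr_add)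
    then show ?thesis using t x unfolding pullback_def t_def[symmetric] by (simp add: mult.assoc[symmetric])
  qed
  moreover have "t powr (real d - \<mu>) = 2 powr (real d - \<mu>) * (1 + (norm x)\<^sup>2) powr (- (real d - \<mu>))"
  proof -
    have "(2 / D) powr e = 2 powr e * D powr (- e)" if "D > 0" for D e :: real
      using that by (simp add: powr_divide powr_minus_divide)
    then show ?thesis unfolding t_def using pos by blast
  qed
  ultimately have "norm (pullback N d f x) \<le> (2 powr (real d - \<mu>) * (1 + (norm x)\<^sup>2) powr (- (real d - \<mu>))) * C" by (simp only:)
  then show ?thesis by (simp only: ac_simps)
qed

context pole_slice
begin

lemma surface_AE:
  assumes d: "dim U > 0" and P: "\<And>z. z \<in> U \<Longrightarrow> P (second_point N (p + z - N))" and [measurable]: "Measurable.pred borel P"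
  shows "AE \<eta> in surface_measure (pole_plane N U p). P \<eta>"
proof -
  have m: "1 + (norm (p + z))\<^sup>2 > 0" for z by (simp add: add_pos_nonneg)
  show ?thesis
    unfolding surface_measure_pole_plane[OF d]
    using AE_subspace_lborel_in[OF subU]
    by (subst AE_distr_iff, simp, simp, subst AE_density, simp) (auto elim!: eventually_mono intro: P)
qed

lemma foot_orth: "z \<in> U \<Longrightarrow> (p + z) \<bullet> N = 0" using U_N p_N by (simp add: inner_add_left)

lemma norm_foot: "z \<in> U \<Longrightarrow> (norm (p + z))\<^sup>2 = (norm p)\<^sup>2 + (norm z)\<^sup>2"
  by (rule norm_add_Pythagorean) (use p_U in \<open>auto simp: orthogonal_def inner_commute[of p]\<close>)

lemma slice_integral:
  assumes d: "dim U > 0" and f: "continuous_on (sphere 0 1 - {N}) f"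
  shows "integrable (completion (surface_measure (pole_plane N U p))) f \<longleftrightarrow>
      integrable (subspace_lborel U) (\<lambda>z. pullback N (dim U) f (p + z))"
    and "(\<integral>\<eta>. f \<eta> \<partial>completion (surface_measure (pole_plane N U p))) = (\<integral>z. pullback N (dim U) f (p + z) \<partial>subspace_lborel U)"
proof -
  let ?M = "surface_measure (pole_plane N U p)"
  define f' where "f' \<eta> = indicator (sphere 0 1 - {N}) \<eta> *\<^sub>R f \<eta>" for \<eta>
  have [measurable]: "f' \<in> borel_measurable borel"
    unfolding f'_def by (rule borel_measurable_continuous_on_indicator[OF _ f]) simp
  have "AE \<eta> in ?M. \<eta> \<in> sphere 0 1 - {N}"
    by (rule surface_AE[OF d]) (use inverse_stereographic[OF norm_N foot_orth] in auto)
  then have ae: "AE \<eta> in ?M. f \<eta> = f' \<eta>" by eventually_elim (simp add: f'_def)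
  have f'M: "f' \<in> borel_measurable ?M" by simp
  note c = completion_AE_borel[OF f'M ae]
  have m0: "0 \<le> (2 / (1 + (norm (p + z))\<^sup>2)) ^ dim U" for z by (intro zero_le_power divide_nonneg_nonneg) auto
  let ?g = "\<lambda>z. (2 / (1 + (norm (p + z))\<^sup>2)) ^ dim U *\<^sub>R f' (second_point N (p + z - N))"
  have eq: "AE z in subspace_lborel U. ?g z = pullback N (dim U) f (p + z)"
    using AE_subspace_lborel_in[OF subU]
  proof eventually_elim
    case (elim z)
    then show ?case using foot_orth[OF elim] inverse_stereographic[OF norm_N foot_orth[OF elim]]
      by (simp add: pullback_def f'_def)
  qed
  have [measurable]: "pullback N (dim U) f \<in> borel_measurable borel" by (rule pullback_borel[OF norm_N f])
  have "integrable ?M f' \<longleftrightarrow> integrable (subspace_lborel U) ?g"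
    unfolding surface_measure_pole_plane[OF d]
    by (subst integrable_distr_eq, simp, simp, subst integrable_density) (auto intro!: AE_I2 m0)
  also have "\<dots> \<longleftrightarrow> integrable (subspace_lborel U) (\<lambda>z. pullback N (dim U) f (p + z))"
    by (rule integrable_cong_AE[OF _ _ eq]) measurable
  finally show "integrable (completion ?M) f \<longleftrightarrow> integrable (subspace_lborel U) (\<lambda>z. pullback N (dim U) f (p + z))"
    using c(2) by simp
  have "integral\<^sup>L ?M f' = integral\<^sup>L (subspace_lborel U) ?g"
    unfolding surface_measure_pole_plane[OF d]
    by (subst integral_distr, simp, simp, subst integral_density) (auto intro!: AE_I2 m0)
  also have "\<dots> = integral\<^sup>L (subspace_lborel U) (\<lambda>z. pullback N (dim U) f (p + z))"
    by (rule integral_cong_AE[OF _ _ eq]) measurable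
  finally show "(\<integral>\<eta>. f \<eta> \<partial>completion ?M) = (\<integral>z. pullback N (dim U) f (p + z) \<partial>subspace_lborel U)"
    using c(3) by simp
qed

end

lemma pole_slice_hyperplane:
  fixes N :: "'a::euclidean_space"
  assumes N: "norm N = 1" and H: "subspace H" "\<And>y. y \<in> H \<Longrightarrow> y \<bullet> N = 0"
    and x: "x \<bullet> N = 0" "\<And>y. y \<in> H \<Longrightarrow> y \<bullet> x = 0" and u: "u \<in> H"
  shows "pole_slice N {y\<in>H. y \<bullet> u = 0} (x + s *\<^sub>R u)"
proof
  show "subspace {y\<in>H. y \<bullet> u = 0}" by (rule subspace_orthogonal_part[OF H(1)])
qed (use assms in \<open>auto simp: inner_add_left inner_add_right\<close>)

lemma cap_threshold:
  fixes b r :: real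
  assumes "-1 < b" "b < 1" "1 + r\<^sup>2 = 2 / (1 - t)" "1 - t > 0" "r \<ge> 0"
  shows "t > b \<longleftrightarrow> r > sqrt ((1 + b) / (1 - b))"
proof -
  have "t > b \<longleftrightarrow> 2 / (1 - b) < 2 / (1 - t)"
  proof
    assume "t > b" then show "2 / (1 - b) < 2 / (1 - t)" using assms by (intro divide_strict_left_mono) auto
  next
    assume h: "2 / (1 - b) < 2 / (1 - t)"
    show "t > b"
    proof (rule ccontr)
      assume "\<not> t > b"
      then have "2 / (1 - t) \<le> 2 / (1 - b)" using assms by (intro divide_left_mono) auto
      then show False using h by simp
    qed
  qed
  also have "\<dots> \<longleftrightarrow> (1 + b) / (1 - b) < r\<^sup>2"
  proof -
    have "(1 + b) / (1 - b) = 2 / (1 - b) - 1" using assms by (simp add: field_simps)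
    then show ?thesis unfolding assms(3)[symmetric] by auto
  qed
  also have "\<dots> \<longleftrightarrow> sqrt ((1 + b) / (1 - b)) < r"
    using assms by (metis real_sqrt_abs real_sqrt_less_iff abs_of_nonneg)
  finally show ?thesis .
qed

lemma distance_threshold:
  fixes b r :: real
  assumes "-1 < b" "b < 1" "r \<ge> 0"
  shows "sqrt ((1 + b) / 2) < r / sqrt (1 + r\<^sup>2) \<longleftrightarrow> r > sqrt ((1 + b) / (1 - b))"
proof -
  have p: "1 + r\<^sup>2 > 0" by (simp add: add_pos_nonneg)
  have "r / sqrt (1 + r\<^sup>2) = sqrt (r\<^sup>2 / (1 + r\<^sup>2))" using assms by (simp add: real_sqrt_divide)
  then have "sqrt ((1 + b) / 2) < r / sqrt (1 + r\<^sup>2) \<longleftrightarrow> (1 + b) / 2 < r\<^sup>2 / (1 + r\<^sup>2)" by simp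
  also have "\<dots> \<longleftrightarrow> (1 + b) * (1 + r\<^sup>2) < 2 * r\<^sup>2" using p by (simp add: field_simps)
  also have "\<dots> \<longleftrightarrow> 1 + b < r\<^sup>2 * (1 - b)" by (auto simp: algebra_simps)
  also have "\<dots> \<longleftrightarrow> (1 + b) / (1 - b) < r\<^sup>2" using assms by (simp add: field_simps)
  also have "\<dots> \<longleftrightarrow> sqrt ((1 + b) / (1 - b)) < r"
    using assms by (metis real_sqrt_abs real_sqrt_less_iff abs_of_nonneg)
  finally show ?thesis .
qed

text \<open>
  There is room for a \<open>(d + 1)\<close>-dimensional subspace \<open>H\<close> orthogonal to both \<open>N\<close> and \<open>x\<close>.  All
  points of \<open>x + H\<close> are at least as far from the origin as \<open>x\<close>, hence all hyperplane
  integrals on \<open>x + H\<close> vanish.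
\<close>

lemma support_low_dimension:
  fixes N :: "'a::euclidean_space" and f :: "'a \<Rightarrow> complex"
  assumes N: "norm N = 1" and d: "d > 0" "d + 2 < DIM('a)" and R: "R \<ge> 0"
    and f: "continuous_on (sphere 0 1 - {N}) f"
    and C: "\<And>\<eta>. \<eta> \<in> sphere 0 1 - {N} \<Longrightarrow> (1 - \<eta> \<bullet> N) powr \<mu> * norm (f \<eta>) \<le> C" and mu: "\<mu> < real d / 2"
    and zero: "\<And>U p. pole_slice N U p \<Longrightarrow> dim U = d \<Longrightarrow> norm p > R \<Longrightarrow> (\<integral>z. pullback N d f (p + z) \<partial>subspace_lborel U) = 0"
    and x: "x \<bullet> N = 0" "norm x > R"
  shows "pullback N d f x = 0"
proof -
  have x0: "x \<noteq> 0" using x R by auto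
  let ?u = "(1 / norm x) *\<^sub>R x"
  let ?K = "{y. y \<bullet> N = 0}"
  have K: "subspace ?K" by (rule subspace_hyperplane)
  have u: "norm ?u = 1" "?u \<in> ?K" using x0 x by auto
  have dK: "DIM('a) = Suc (Suc (dim {y\<in>?K. y \<bullet> ?u = 0}))"
    using dim_orthogonal_complement_line[OF N] dim_subspace_orthogonal_part[OF K u] by simp
  have "Suc d \<le> dim {y\<in>?K. y \<bullet> ?u = 0}" using d dK by linarith
  then obtain H where H: "subspace H" "H \<subseteq> span {y\<in>?K. y \<bullet> ?u = 0}" "dim H = Suc d"
    by (rule choose_subspace_of_subspace)
  have sp: "span {y\<in>?K. y \<bullet> ?u = 0} = {y\<in>?K. y \<bullet> ?u = 0}"
    using subspace_orthogonal_part[OF K, of ?u] by (simp only: span_eq_iff)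
  have HN: "y \<bullet> N = 0" and Hx: "y \<bullet> x = 0" if "y \<in> H" for y
    using subsetD[OF H(2)[unfolded sp] that] x0 by auto
  have [measurable]: "pullback N d f \<in> borel_measurable borel" by (rule pullback_borel[OF N f])
  have n2: "(norm (x + y))\<^sup>2 = (norm x)\<^sup>2 + (norm y)\<^sup>2" if "y \<in> H" for y
    by (rule norm_add_Pythagorean) (use Hx[OF that] in \<open>simp add: orthogonal_def inner_commute\<close>)
  let ?G = "\<lambda>y. pullback N d f (x + y)"
  let ?C = "C * 2 powr (real d - \<mu>)"
  have "?G 0 = 0"
  proof (rule hyperplane_transform_injective[OF H(1), of ?G ?C "real d - \<mu>"])
    show "dim H > 0" using H by simp
    show "?G \<in> borel_measurable borel" by measurable
    show "continuous_on H ?G"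
      by (rule continuous_on_compose2[OF pullback_continuous[OF N f]])
         (auto intro!: continuous_intros simp: inner_add_left x HN)
    show "(real (dim H - 1)) / 2 < real d - \<mu>" using H(3) mu by simp
    show "norm (?G y) \<le> ?C * (1 + (norm y)\<^sup>2) powr (- (real d - \<mu>))" if y: "y \<in> H" for y
    proof -
      have "norm (?G y) \<le> ?C * (1 + (norm (x + y))\<^sup>2) powr (- (real d - \<mu>))"
        by (rule pullback_bound[OF N _ C]) (use x HN[OF y] in \<open>auto simp: inner_add_left\<close>)
      also have "\<dots> \<le> ?C * (1 + (norm y)\<^sup>2) powr (- (real d - \<mu>))"
      proof (rule mult_left_mono)
        have p: "1 + (norm y)\<^sup>2 > 0" by (simp add: add_pos_nonneg)
        show "(1 + (norm (x + y))\<^sup>2) powr (- (real d - \<mu>)) \<le> (1 + (norm y)\<^sup>2) powr (- (real d - \<mu>))"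
          using mu d p n2[OF y] by (intro powr_mono2') auto
        have "C \<ge> 0"
        proof -
          have "second_point N (x - N) \<in> sphere 0 1 - {N}" using inverse_stereographic[OF N x(1)] by simp
          from C[OF this] show ?thesis by (rule order_trans[OF mult_nonneg_nonneg[OF powr_ge_zero norm_ge_zero]])
        qed
        then show "?C \<ge> 0" by simp
      qed
      finally show ?thesis .
    qed
    show "(\<integral>z. ?G (s *\<^sub>R u + z) \<partial>subspace_lborel {y\<in>H. y \<bullet> u = 0}) = 0" if u: "u \<in> H" "norm u = 1" for u s
    proof -
      have ps: "pole_slice N {y\<in>H. y \<bullet> u = 0} (x + s *\<^sub>R u)"
        by (rule pole_slice_hyperplane[OF N H(1) HN x(1) Hx u(1)])
      have dd: "dim {y\<in>H. y \<bullet> u = 0} = d" using dim_subspace_orthogonal_part[OF H(1) u(2,1)] H(3) by simp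
      have "(norm x)\<^sup>2 \<le> (norm (x + s *\<^sub>R u))\<^sup>2" using n2[of "s *\<^sub>R u"] u H(1) by (simp add: subspace_scale)
      then have "norm x \<le> norm (x + s *\<^sub>R u)" by (rule power2_le_imp_le) simp
      then have "norm (x + s *\<^sub>R u) > R" using x by simp
      from zero[OF ps dd this] show ?thesis by (simp add: add.assoc)
    qed
  qed
  then show ?thesis by simp
qed

text \<open>
  Here the traces are the hyperplanes of the space orthogonal to \<open>N\<close>.
\<close>

lemma support_hyperplanes:
  fixes N :: "'a::euclidean_space" and f :: "'a \<Rightarrow> complex"
  assumes N: "norm N = 1" and d: "d + 2 = DIM('a)" and R: "R \<ge> 0"
    and f: "continuous_on (sphere 0 1 - {N}) f"
    and C: "\<And>m. m > 0 \<Longrightarrow> \<exists>C. \<forall>\<eta>\<in>sphere 0 1 - {N}. (1 - \<eta> \<bullet> N) powr (real d - m / 2) * norm (f \<eta>) \<le> C"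
    and zero: "\<And>U p. pole_slice N U p \<Longrightarrow> dim U = d \<Longrightarrow> norm p > R \<Longrightarrow> (\<integral>z. pullback N d f (p + z) \<partial>subspace_lborel U) = 0"
    and x: "x \<bullet> N = 0" "norm x > R"
  shows "pullback N d f x = 0"
proof -
  let ?K = "{y. y \<bullet> N = 0}"
  have K: "subspace ?K" by (rule subspace_hyperplane)
  have dK: "dim ?K = Suc d" using dim_orthogonal_complement_line[OF N] d by simp
  interpret rapid_decay ?K "pullback N d f" R
  proof
    show "subspace ?K" by (rule K)
    show "dim ?K > 0" using dK by simp
    show "R \<ge> 0" by (rule R)
    show "pullback N d f \<in> borel_measurable borel" by (rule pullback_borel[OF N f])
    show "continuous_on ?K (pullback N d f)" by (rule pullback_continuous[OF N f])
    show "\<exists>C. \<forall>y\<in>?K. norm (pullback N d f y) \<le> C * (1 + (norm y)\<^sup>2) powr (- real M)" for M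
    proof -
      define m where "m = 2 * (real M + 1)"
      have "m > 0" by (simp add: m_def)
      from C[OF this] obtain C where C: "\<And>\<eta>. \<eta> \<in> sphere 0 1 - {N} \<Longrightarrow> (1 - \<eta> \<bullet> N) powr (real d - m / 2) * norm (f \<eta>) \<le> C" by blast
      show ?thesis
      proof (intro exI ballI)
        fix y assume "y \<in> ?K"
        then have y: "y \<bullet> N = 0" by simp
        let ?C = "C * 2 powr (real d - (real d - m / 2))"
        have p: "1 \<le> 1 + (norm y)\<^sup>2" by simp
        have b: "norm (pullback N d f y) \<le> ?C * (1 + (norm y)\<^sup>2) powr (- (real d - (real d - m / 2)))"
          by (rule pullback_bound[OF N y C])
        have C0: "?C \<ge> 0"
        proof -
          have "0 \<le> ?C * (1 + (norm y)\<^sup>2) powr (- (real d - (real d - m / 2)))" using b norm_ge_zero order_trans by blast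
          moreover have "(1 + (norm y)\<^sup>2) powr (- (real d - (real d - m / 2))) > 0" using p by (metis powr_gt_zero not_one_le_zero)
          moreover have "a \<ge> 0" if "0 \<le> a * b" "b > 0" for a b :: real
            using that by (simp add: zero_le_mult_iff)
          ultimately show ?thesis by blast
        qed
        have "(1 + (norm y)\<^sup>2) powr (- (real d - (real d - m / 2))) \<le> (1 + (norm y)\<^sup>2) powr (- real M)"
          by (rule powr_mono) (use p in \<open>auto simp: m_def\<close>)
        with b C0 show "norm (pullback N d f y) \<le> ?C * (1 + (norm y)\<^sup>2) powr (- real M)"
          by (meson mult_left_mono order_trans)
      qed
    qed
    show "(\<integral>z. pullback N d f (s *\<^sub>R u + z) \<partial>subspace_lborel {y\<in>?K. y \<bullet> u = 0}) = 0"
      if u: "u \<in> ?K" "norm u = 1" and s: "s > R" for u s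
    proof (rule zero)
      show "pole_slice N {y\<in>?K. y \<bullet> u = 0} (s *\<^sub>R u)"
        using pole_slice_hyperplane[OF N K, of 0 u s] u by simp
      show "dim {y\<in>?K. y \<bullet> u = 0} = d" using dim_subspace_orthogonal_part[OF K u(2,1)] dK by simp
      show "R < norm (s *\<^sub>R u)" using u s R by simp
    qed
  qed
  show ?thesis using vanishes_outside_ball[of x] x by simp
qed

section \<open>Almost all planes through the pole\<close>

text \<open>
  Already the term with index 0 spreads the sum: given the other terms, \<open>t\<^sub>0 v\<^sub>0\<close> avoids a
  translate of \<open>M\<close> almost everywhere by \<open>polar_null\<close>.
\<close>

lemma nn_integral_random_combination_null:
  fixes M :: "'a::euclidean_space set" and k :: nat
  assumes [measurable]: "M \<in> sets borel" and null: "emeasure lborel M = 0" and k: "k > 0"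
  shows "(\<integral>\<^sup>+v. \<integral>\<^sup>+t. indicator M (\<Sum>i<k. t i *\<^sub>R v i) \<partial>PiM {..<k} (\<lambda>_. lborel) \<partial>PiM {..<k} (\<lambda>_. surface_measure UNIV)) = 0"
proof -
  let ?\<sigma> = "surface_measure (UNIV :: 'a set)"
  interpret fin: finite_measure ?\<sigma> by (rule finite_surface_sphere)
  interpret A: product_sigma_finite "\<lambda>_::nat. ?\<sigma>" by standard
  interpret B: product_sigma_finite "\<lambda>_::nat. lborel :: real measure" by (rule lborel_product_sigma_finite)
  \<comment> \<open>index 0 is singled out\<close>
  define J where "J = {1..<k}"
  have J: "finite J" "0 \<notin> J" "{..<k} = insert 0 J" using k by (auto simp: J_def)
  let ?PJ = "PiM J (\<lambda>_. lborel :: real measure)"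
  interpret PJ: sigma_finite_measure ?PJ by (rule B.sigma_finite[OF J(1)])
  interpret PI: sigma_finite_measure "PiM (insert 0 J) (\<lambda>_. lborel :: real measure)" by (rule B.sigma_finite) (simp add: J)
  interpret PQ: pair_sigma_finite ?\<sigma> ?PJ by standard
  have sum: "(\<Sum>i\<in>insert 0 J. (t(0 := s)) i *\<^sub>R (v(0 := w)) i) = s *\<^sub>R w + (\<Sum>i\<in>J. t i *\<^sub>R v i)"
    for t :: "nat \<Rightarrow> real" and v :: "nat \<Rightarrow> 'a" and s w
  proof -
    have "(\<Sum>i\<in>J. (t(0 := s)) i *\<^sub>R (v(0 := w)) i) = (\<Sum>i\<in>J. t i *\<^sub>R v i)"
      using J(2) by (intro sum.cong) auto
    then show ?thesis using J by simp
  qed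
  have mt: "(\<lambda>t. \<Sum>i\<in>insert 0 J. t i *\<^sub>R v i) \<in> borel_measurable (PiM (insert 0 J) (\<lambda>_. lborel :: real measure))" for v :: "nat \<Rightarrow> 'a"
    by measurable
  have "(\<integral>\<^sup>+v. \<integral>\<^sup>+t. indicator M (\<Sum>i<k. t i *\<^sub>R v i) \<partial>PiM {..<k} (\<lambda>_. lborel) \<partial>PiM {..<k} (\<lambda>_. ?\<sigma>))
    = (\<integral>\<^sup>+v. \<integral>\<^sup>+w. \<integral>\<^sup>+t. indicator M (\<Sum>i\<in>insert 0 J. t i *\<^sub>R (v(0 := w)) i) \<partial>PiM (insert 0 J) (\<lambda>_. lborel) \<partial>?\<sigma> \<partial>PiM J (\<lambda>_. ?\<sigma>))"
    unfolding J(3) by (rule A.product_nn_integral_insert[OF J(1,2)]) measurable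
  also have "\<dots> = (\<integral>\<^sup>+v. \<integral>\<^sup>+w. \<integral>\<^sup>+t. \<integral>\<^sup>+s. indicator M (s *\<^sub>R w + (\<Sum>i\<in>J. t i *\<^sub>R v i)) \<partial>lborel \<partial>?PJ \<partial>?\<sigma> \<partial>PiM J (\<lambda>_. ?\<sigma>))"
  proof (intro nn_integral_cong)
    fix v w
    have "(\<integral>\<^sup>+t. indicator M (\<Sum>i\<in>insert 0 J. t i *\<^sub>R (v(0 := w)) i) \<partial>PiM (insert 0 J) (\<lambda>_. lborel))
      = (\<integral>\<^sup>+t. \<integral>\<^sup>+s. indicator M (\<Sum>i\<in>insert 0 J. (t(0 := s)) i *\<^sub>R (v(0 := w)) i) \<partial>lborel \<partial>?PJ)"
      by (rule B.product_nn_integral_insert[OF J(1,2)]) (intro measurable_compose[OF mt] borel_measurable_indicator, simp)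
    then show "(\<integral>\<^sup>+t. indicator M (\<Sum>i\<in>insert 0 J. t i *\<^sub>R (v(0 := w)) i) \<partial>PiM (insert 0 J) (\<lambda>_. lborel))
      = (\<integral>\<^sup>+t. \<integral>\<^sup>+s. indicator M (s *\<^sub>R w + (\<Sum>i\<in>J. t i *\<^sub>R v i)) \<partial>lborel \<partial>?PJ)"
      unfolding sum .
  qed
  also have "\<dots> = (\<integral>\<^sup>+v. 0 \<partial>PiM J (\<lambda>_. ?\<sigma>))"
  proof (intro nn_integral_cong)
    fix v :: "nat \<Rightarrow> 'a"
    have "(\<integral>\<^sup>+w. \<integral>\<^sup>+t. \<integral>\<^sup>+s. indicator M (s *\<^sub>R w + (\<Sum>i\<in>J. t i *\<^sub>R v i)) \<partial>lborel \<partial>?PJ \<partial>?\<sigma>)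
      = (\<integral>\<^sup>+t. \<integral>\<^sup>+w. \<integral>\<^sup>+s. indicator M (s *\<^sub>R w + (\<Sum>i\<in>J. t i *\<^sub>R v i)) \<partial>lborel \<partial>?\<sigma> \<partial>?PJ)"
      by (rule PQ.Fubini'[symmetric]) measurable
    also have "\<dots> = (\<integral>\<^sup>+t. 0 \<partial>?PJ)"
    proof (rule nn_integral_cong)
      fix t :: "nat \<Rightarrow> real"
      define a where "a = (\<Sum>i\<in>J. t i *\<^sub>R v i)"
      let ?M = "(\<lambda>x. a + x) -` M"
      have [measurable]: "?M \<in> sets borel" using measurable_sets[of "\<lambda>x. a + x" borel borel M] by simp
      have "emeasure lborel M = emeasure (distr lborel borel ((+) a)) M" by (simp add: lborel_distr_plus)
      also have "\<dots> = emeasure lborel ?M" by (subst emeasure_distr) auto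
      finally have "emeasure lborel ?M = 0" using null by simp
      from polar_null[OF \<open>?M \<in> sets borel\<close> this]
      show "(\<integral>\<^sup>+w. \<integral>\<^sup>+s. indicator M (s *\<^sub>R w + (\<Sum>i\<in>J. t i *\<^sub>R v i)) \<partial>lborel \<partial>?\<sigma>) = 0"
        by (simp add: a_def[symmetric] indicator_def add.commute)
    qed
    finally show "(\<integral>\<^sup>+w. \<integral>\<^sup>+t. \<integral>\<^sup>+s. indicator M (s *\<^sub>R w + (\<Sum>i\<in>J. t i *\<^sub>R v i)) \<partial>lborel \<partial>?PJ \<partial>?\<sigma>) = 0" by simp
  qed
  finally show ?thesis by simp
qed

text \<open>
  A subspace is closed, and rational combinations are dense in a span.  Only countably many
  conditions are involved, which makes linear dependence a measurable event.
\<close>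

lemma span_rational_approximation:
  fixes v :: "nat \<Rightarrow> 'a::euclidean_space"
  shows "x \<in> span (v ` {..<j}) \<longleftrightarrow> (\<forall>n. \<exists>q\<in>PiE {..<j} (\<lambda>_. \<rat>). norm (x - (\<Sum>i<j. q i *\<^sub>R v i)) < 1 / real (Suc n))"
proof
  assume "x \<in> span (v ` {..<j})"
  then obtain c where c: "x = (\<Sum>i<j. c i *\<^sub>R v i)" using span_image_combination[of "{..<j}" x v] by auto
  show "\<forall>n. \<exists>q\<in>PiE {..<j} (\<lambda>_. \<rat>). norm (x - (\<Sum>i<j. q i *\<^sub>R v i)) < 1 / real (Suc n)"
  proof
    fix n
    define e where "e = 1 / real (Suc n)"
    define K where "K = 1 + (\<Sum>i<j. norm (v i))"
    have K: "K > 0" unfolding K_def by (intro add_pos_nonneg sum_nonneg) auto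
    have e: "e > 0" by (simp add: e_def)
    have "\<exists>r\<in>\<rat>. c i - e / K < r \<and> r < c i + e / K" for i
      by (rule Rats_dense_in_real) (use e K in \<open>simp add: field_simps\<close>)
    then obtain r where r: "\<And>i. r i \<in> \<rat>" "\<And>i. \<bar>c i - r i\<bar> < e / K" by (metis abs_diff_less_iff abs_minus_commute)
    let ?q = "\<lambda>i\<in>{..<j}. r i"
    have "x - (\<Sum>i<j. ?q i *\<^sub>R v i) = (\<Sum>i<j. (c i - r i) *\<^sub>R v i)"
      unfolding c by (simp add: sum_subtractf[symmetric] scaleR_diff_left)
    then have "norm (x - (\<Sum>i<j. ?q i *\<^sub>R v i)) \<le> (\<Sum>i<j. norm ((c i - r i) *\<^sub>R v i))" by (simp only: norm_sum)
    also have "\<dots> \<le> (\<Sum>i<j. e / K * norm (v i))"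
      unfolding norm_scaleR real_norm_def by (intro sum_mono mult_right_mono less_imp_le[OF r(2)] norm_ge_zero)
    also have "\<dots> = e / K * (K - 1)" by (simp add: K_def sum_distrib_left)
    also have "\<dots> < e" using e K by (simp add: field_simps)
    finally show "\<exists>q\<in>PiE {..<j} (\<lambda>_. \<rat>). norm (x - (\<Sum>i<j. q i *\<^sub>R v i)) < 1 / real (Suc n)"
      unfolding e_def using r(1) by (intro bexI[of _ ?q]) auto
  qed
next
  assume h: "\<forall>n. \<exists>q\<in>PiE {..<j} (\<lambda>_. \<rat>). norm (x - (\<Sum>i<j. q i *\<^sub>R v i)) < 1 / real (Suc n)"
  have "x \<in> closure (span (v ` {..<j}))"
    unfolding closure_approachable
  proof (intro allI impI)
    fix e :: real assume "e > 0"
    then obtain n where n: "1 / real (Suc n) < e" using reals_Archimedean[of e] by (auto simp: inverse_eq_divide)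
    obtain q where q: "norm (x - (\<Sum>i<j. q i *\<^sub>R v i)) < 1 / real (Suc n)" using h by blast
    show "\<exists>y\<in>span (v ` {..<j}). dist y x < e"
    proof (intro bexI[of _ "\<Sum>i<j. q i *\<^sub>R v i"])
      show "dist (\<Sum>i<j. q i *\<^sub>R v i) x < e" using q n by (simp add: dist_norm norm_minus_commute)
    qed (intro span_sum span_mul span_base, auto)
  qed
  then show "x \<in> span (v ` {..<j})" by simp
qed

lemma dim_image_lessThan:
  fixes v :: "nat \<Rightarrow> 'a::euclidean_space"
  shows "dim (v ` {..<k}) \<le> k" "dim (v ` {..<k}) = k \<longleftrightarrow> (\<forall>j<k. v j \<notin> span (v ` {..<j}))"
proof -
  have "dim (v ` {..<k}) \<le> k \<and> (dim (v ` {..<k}) = k \<longleftrightarrow> (\<forall>j<k. v j \<notin> span (v ` {..<j})))"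
  proof (induction k)
    case (Suc k)
    have "dim (v ` {..<Suc k}) = (if v k \<in> span (v ` {..<k}) then dim (v ` {..<k}) else dim (v ` {..<k}) + 1)"
      by (simp add: lessThan_Suc dim_insert)
    then show ?case using Suc by (auto simp: less_Suc_eq)
  qed simp
  then show "dim (v ` {..<k}) \<le> k" "dim (v ` {..<k}) = k \<longleftrightarrow> (\<forall>j<k. v j \<notin> span (v ` {..<j}))" by auto
qed

lemma span_membership_measurable:
  fixes P :: "(nat \<Rightarrow> 'a::euclidean_space) measure"
  assumes j: "j < k" and P: "sets P = sets (PiM {..<k} (\<lambda>_. borel))"
  shows "{v \<in> space P. v j \<in> span (v ` {..<j})} \<in> sets P"
proof -
  have comp: "(\<lambda>v. v i) \<in> borel_measurable P" if "i < k" for i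
    using measurable_component_singleton[of i "{..<k}" "\<lambda>_. borel :: 'a measure"] that
    by (simp add: measurable_cong_sets[OF P refl])
  have C: "countable (PiE {..<j} (\<lambda>_. \<rat> :: real set))" by (intro countable_PiE countable_rat) auto
  have "{v \<in> space P. v j \<in> span (v ` {..<j})}
    = (\<Inter>n. \<Union>q\<in>PiE {..<j} (\<lambda>_. \<rat>). {v \<in> space P. norm (v j - (\<Sum>i<j. q i *\<^sub>R v i)) < 1 / real (Suc n)})"
    unfolding span_rational_approximation by auto
  also have "\<dots> \<in> sets P"
  proof -
    have A: "{v \<in> space P. norm (v j - (\<Sum>i<j. q i *\<^sub>R v i)) < 1 / real (Suc n)} \<in> sets P" for n and q :: "nat \<Rightarrow> real"
    proof -
      have "(\<lambda>v. \<Sum>i<j. q i *\<^sub>R v i) \<in> borel_measurable P"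
        by (rule borel_measurable_sum, rule borel_measurable_scaleR, rule borel_measurable_const, rule comp) (use j in auto)
      from borel_measurable_diff[OF comp[OF j] this]
      have "(\<lambda>v. norm (v j - (\<Sum>i<j. q i *\<^sub>R v i))) \<in> borel_measurable P"
        by (rule measurable_compose[OF _ borel_measurable_norm])
      then show ?thesis by (rule borel_measurable_less) simp
    qed
    have "(\<Union>q\<in>PiE {..<j} (\<lambda>_. \<rat>). {v \<in> space P. norm (v j - (\<Sum>i<j. q i *\<^sub>R v i)) < 1 / real (Suc n)}) \<in> sets P" for n
      by (intro sets.countable_UN'' C A)
    then show ?thesis by (intro sets.countable_INT) auto
  qed
  finally show ?thesis .
qed

lemma inner_north_pole: "x \<bullet> north_pole = snd x"
  by (simp add: north_pole_def inner_prod_def)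

lemma norm_north_pole: "norm (north_pole :: (real^'n) \<times> real) = 1"
  by (simp add: north_pole_def norm_prod_def)

lemma pole_plane_in_slice_planes:
  fixes U :: "((real^'n) \<times> real) set"
  assumes "pole_slice north_pole U p" "Suc (dim U) = k"
  shows "pole_plane north_pole U p \<in> slice_planes k"
proof -
  interpret pole_slice north_pole U p by fact
  have "p \<in> {x. snd x = 0}" using p_N by (simp add: inner_north_pole)
  then have "pole_plane north_pole U p \<inter> {x. snd x = 0} \<noteq> {}" using p_in_plane by blast
  then show ?thesis
    using affine_plane aff_dim_plane N_in_plane assms(2) by (simp add: slice_planes_def)
qed

lemma slice_planes_pole_plane:
  fixes \<tau> :: "((real^'n) \<times> real) set"
  assumes "\<tau> \<in> slice_planes k"
  obtains U p where "pole_slice north_pole U p" "\<tau> = pole_plane north_pole U p" "Suc (dim U) = k"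
proof -
  from assms obtain x where x: "affine \<tau>" "aff_dim \<tau> = int k" "north_pole \<in> \<tau>" "x \<in> \<tau>" "snd x = 0"
    by (auto simp: slice_planes_def)
  have "x \<bullet> north_pole = 0" using x by (simp add: inner_north_pole)
  from pole_plane_exists[OF norm_north_pole x(1,3,4) this]
  obtain U p where "pole_slice north_pole U p" "\<tau> = pole_plane north_pole U p" "aff_dim \<tau> = int (dim U) + 1" by metis
  then show ?thesis using that[of U p] x(2) by simp
qed

lemma pole_plane_far_iff:
  fixes U :: "((real^'n) \<times> real) set"
  assumes "pole_slice north_pole U p" "Suc (dim U) = k" "-1 < b" "b < 1"
  shows "pole_plane north_pole U p \<in> far_planes k b \<longleftrightarrow> norm p > sqrt ((1 + b) / (1 - b))"
proof -
  interpret pole_slice north_pole U p by fact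
  show ?thesis
    using pole_plane_in_slice_planes[OF assms(1,2)] distance_threshold[OF assms(3,4), of "norm p"]
    by (simp add: far_planes_def infdist_plane)
qed

lemma spanned_plane_in_slice_planes_iff:
  fixes v :: "nat \<Rightarrow> (real^'n) \<times> real"
  shows "spanned_plane k v \<in> slice_planes k \<longleftrightarrow> (\<forall>j<k. v j \<notin> span (v ` {..<j})) \<and> (\<exists>i<k. snd (v i) \<noteq> 0)"
proof -
  let ?S = "span (v ` {..<k})"
  have a: "affine (spanned_plane k v)" unfolding spanned_plane_def
    by (simp add: affine_translation[symmetric] subspace_imp_affine)
  have d: "aff_dim (spanned_plane k v) = int (dim (v ` {..<k}))"
    unfolding spanned_plane_def by (simp add: aff_dim_translation_eq aff_dim_subspace)
  have n: "north_pole \<in> spanned_plane k v"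
    unfolding spanned_plane_def by (rule image_eqI[of _ _ 0]) (auto simp: span_zero)
  have m: "spanned_plane k v \<inter> {x. snd x = 0} \<noteq> {} \<longleftrightarrow> (\<exists>i<k. snd (v i) \<noteq> 0)"
  proof
    assume "spanned_plane k v \<inter> {x. snd x = 0} \<noteq> {}"
    then obtain u where u: "u \<in> ?S" "snd (north_pole + u) = 0" unfolding spanned_plane_def by auto
    show "\<exists>i<k. snd (v i) \<noteq> 0"
    proof (rule ccontr)
      assume "\<not> ?thesis"
      then have "v ` {..<k} \<subseteq> {x. snd x = 0}" by auto
      moreover have "subspace {x :: (real^'n) \<times> real. snd x = 0}" by (auto simp: subspace_def)
      ultimately have "?S \<subseteq> {x. snd x = 0}" by (rule span_minimal)
      then show False using u by (auto simp: north_pole_def)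
    qed
  next
    assume "\<exists>i<k. snd (v i) \<noteq> 0"
    then obtain i where i: "i < k" "snd (v i) \<noteq> 0" by blast
    let ?u = "(- 1 / snd (v i)) *\<^sub>R v i"
    have "?u \<in> ?S" using i by (intro span_mul span_base) auto
    moreover have "snd (north_pole + ?u) = 0" using i by (simp add: north_pole_def)
    ultimately show "spanned_plane k v \<inter> {x. snd x = 0} \<noteq> {}" unfolding spanned_plane_def by blast
  qed
  show ?thesis
    unfolding slice_planes_def using a d n m dim_image_lessThan(2)[of v k] by auto
qed

lemma spanned_plane_slice_measurable:
  fixes P :: "(nat \<Rightarrow> (real^'n) \<times> real) measure"
  assumes P: "sets P = sets (PiM {..<k} (\<lambda>_. borel))"
  shows "{v \<in> space P. spanned_plane k v \<in> slice_planes k} \<in> sets P"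
proof -
  have comp: "(\<lambda>v. snd (v i)) \<in> borel_measurable P" if "i < k" for i
  proof -
    have c: "(\<lambda>v. v i) \<in> borel_measurable P"
      using measurable_component_singleton[of i "{..<k}" "\<lambda>_. borel :: ((real^'n) \<times> real) measure"] that
      by (simp add: measurable_cong_sets[OF P refl])
    have "(snd :: (real^'n) \<times> real \<Rightarrow> real) \<in> borel_measurable borel"
      by (intro borel_measurable_continuous_onI continuous_intros)
    from measurable_compose[OF c this] show ?thesis .
  qed
  have "{v \<in> space P. spanned_plane k v \<in> slice_planes k}
     = (space P \<inter> (\<Inter>j\<in>{..<k}. space P - {v \<in> space P. v j \<in> span (v ` {..<j})})) \<inter> (\<Union>i\<in>{..<k}. {v \<in> space P. snd (v i) \<noteq> 0})"
    unfolding spanned_plane_in_slice_planes_iff by auto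
  also have "\<dots> \<in> sets P"
  proof (rule sets.Int)
    show "space P \<inter> (\<Inter>j\<in>{..<k}. space P - {v \<in> space P. v j \<in> span (v ` {..<j})}) \<in> sets P"
    proof (cases "k = 0")
      case False
      then show ?thesis
        by (intro sets.Int sets.top sets.finite_INT sets.compl_sets span_membership_measurable[OF _ P]) auto
    qed simp
    have "{v \<in> space P. snd (v i) \<noteq> 0} \<in> sets P" if "i \<in> {..<k}" for i
      using borel_measurable_neq[OF comp, of i "\<lambda>_. 0"] that by simp
    then show "(\<Union>i\<in>{..<k}. {v \<in> space P. snd (v i) \<noteq> 0}) \<in> sets P" by (intro sets.finite_UN) auto
  qed
  finally show ?thesis .
qed

text \<open>
  The exceptional planes form a set of the largest sigma-algebra for which the random plane is
  measurable if their preimage is measurable.  By \<open>combination_null_iff\<close> the preimage can be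
  described by an integral over the coefficients \<open>t\<close>, which depends measurably on \<open>v\<close>,
  instead of one with respect to an orthonormal basis of the span.
\<close>

lemma AE_slice_planes:
  fixes C :: "((real^'n) \<times> real) set"
  assumes k: "k > 0" and [measurable]: "C \<in> sets borel" and null: "emeasure lborel C = 0"
  shows "AE \<tau> in slice_planes_measure k. \<tau> \<in> slice_planes k \<and> emeasure (subspace_lborel ((\<lambda>x. x - north_pole) ` \<tau>)) C = 0"
proof -
  define P where "P = PiM {..<k} (\<lambda>_. surface_measure (UNIV :: ((real^'n) \<times> real) set))"
  have sP: "sets P = sets (PiM {..<k} (\<lambda>_. borel))" unfolding P_def by (rule sets_PiM_cong) auto
  define \<A> where "\<A> = {\<A>. spanned_plane k -` \<A> \<inter> space P \<in> sets P}"
  define D where "D = distr P (sigma UNIV \<A>) (spanned_plane k)"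
  have eq: "slice_planes_measure k = restrict_space D (slice_planes k)"
    by (simp add: slice_planes_measure_def Let_def P_def[symmetric] \<A>_def D_def)
  have meas: "spanned_plane k \<in> P \<rightarrow>\<^sub>M sigma UNIV \<A>"
    by (rule measurable_measure_of) (auto simp: \<A>_def)
  have setsD: "B \<in> sets D" if "B \<in> \<A>" for B
    using that by (simp add: D_def sets_measure_of sigma_sets.Basic)
  have spaceD: "space D = UNIV" by (simp add: D_def space_measure_of)
  have diff: "(\<lambda>x. x - north_pole) ` spanned_plane k v = span (v ` {..<k})" for v :: "nat \<Rightarrow> (real^'n) \<times> real"
    by (simp add: spanned_plane_def image_image)
  have S: "{v \<in> space P. spanned_plane k v \<in> slice_planes k} \<in> sets P"
    by (rule spanned_plane_slice_measurable[OF sP])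
  then have SA: "slice_planes k \<in> \<A>" by (simp add: \<A>_def vimage_def Int_def conj_commute)
  define \<B> where "\<B> = {\<tau> \<in> slice_planes k. emeasure (subspace_lborel ((\<lambda>x. x - north_pole) ` \<tau>)) C \<noteq> 0}"
  interpret B: product_sigma_finite "\<lambda>_::nat. lborel :: real measure" by (rule lborel_product_sigma_finite)
  interpret Q: sigma_finite_measure "PiM {..<k} (\<lambda>_. lborel :: real measure)" by (rule B.sigma_finite) simp
  let ?I = "\<lambda>v. \<integral>\<^sup>+t. indicator C (\<Sum>i<k. t i *\<^sub>R v i) \<partial>PiM {..<k} (\<lambda>_. lborel :: real measure)"
  have [measurable]: "?I \<in> borel_measurable P" unfolding P_def by measurable
  have nz: "emeasure (subspace_lborel (span (v ` {..<k}))) C \<noteq> 0 \<longleftrightarrow> ?I v \<noteq> 0" for v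
  proof -
    have "?I v = emeasure (combination_lborel {..<k} v) C"
      by (subst nn_integral_indicator[symmetric], simp, subst nn_integral_combination_lborel) auto
    then show ?thesis using combination_null_iff[of "{..<k}" C v] by simp
  qed
  have pre: "spanned_plane k -` \<B> \<inter> space P = {v \<in> space P. spanned_plane k v \<in> slice_planes k} \<inter> {v \<in> space P. ?I v \<noteq> 0}"
    unfolding \<B>_def using nz by (auto simp: diff)
  have preS: "spanned_plane k -` \<B> \<inter> space P \<in> sets P"
    unfolding pre by (rule sets.Int[OF S]) measurable
  then have BA: "\<B> \<in> \<A>" by (simp add: \<A>_def)
  have "(\<integral>\<^sup>+v. ?I v \<partial>P) = 0"
    unfolding P_def by (rule nn_integral_random_combination_null[OF _ null k]) simp
  then have "AE v in P. ?I v = 0" by (simp add: nn_integral_0_iff_AE)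
  then have "AE v in P. v \<notin> spanned_plane k -` \<B> \<inter> space P" by eventually_elim (simp add: pre)
  then have "emeasure P (spanned_plane k -` \<B> \<inter> space P) = 0"
    using preS by (subst AE_iff_measurable[OF preS, symmetric]) auto
  then have "emeasure D \<B> = 0"
    unfolding D_def using setsD[OF BA] by (subst emeasure_distr[OF meas]) (auto simp: D_def)
  then have "\<B> \<in> null_sets D" using setsD[OF BA] by (simp add: null_sets_def)
  then have "AE \<tau> in D. \<tau> \<notin> \<B>" by (rule AE_not_in)
  moreover have "slice_planes k \<inter> space D \<in> sets D" using setsD[OF SA] by (simp add: spaceD)
  ultimately show ?thesis
    unfolding eq by (subst AE_restrict_space_iff) (auto simp: \<B>_def elim!: eventually_mono)
qed

text \<open>
  The function \<open>f\<close> vanishes on the cap outside a null set \<open>Z\<close>, the slices of distant planes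
  lie in the cap up to null sets, and almost all slices meet \<open>Z\<close> in a null set.
\<close>

lemma slice_transform_vanishing:
  fixes f :: "(real^'n) \<times> real \<Rightarrow> complex"
  assumes k: "2 \<le> k" and b: "-1 < b" "b < 1"
    and f: "AE \<eta> in completion (surface_measure UNIV). \<eta> \<in> cap b \<longrightarrow> f \<eta> = 0"
  shows "AE \<tau> in slice_planes_measure k. \<tau> \<in> far_planes k b \<longrightarrow> slice_converges f \<tau> \<and> slice_transform f \<tau> = 0"
proof -
  let ?N = "north_pole :: (real^'n) \<times> real"
  let ?\<sigma> = "surface_measure (UNIV :: ((real^'n) \<times> real) set)"
  have "AE \<eta> in ?\<sigma>. \<eta> \<in> cap b \<longrightarrow> f \<eta> = 0" using f by (simp only: AE_completion_iff)
  then obtain Z where Z: "{\<eta> \<in> space ?\<sigma>. \<not> (\<eta> \<in> cap b \<longrightarrow> f \<eta> = 0)} \<subseteq> Z" "emeasure ?\<sigma> Z = 0" "Z \<in> sets ?\<sigma>"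
    by (rule AE_E)
  have [measurable]: "Z \<in> sets borel" using Z(3) by simp
  define C where "C = {u. second_point ?N u \<in> Z}"
  have [measurable]: "C \<in> sets borel"
    using measurable_sets[of "second_point ?N" borel borel Z] second_point_measurable[of "\<lambda>x. x" borel ?N]
    by (simp add: C_def vimage_def)
  have ind: "indicator C u = (indicator Z (second_point ?N u) :: ennreal)" for u by (simp add: C_def indicator_def)
  let ?K = "{y. y \<bullet> ?N = 0}"
  note W = pole_slice_whole_space[where 'a = "(real^'n) \<times> real", OF norm_north_pole]
  have dE: "DIM((real^'n) \<times> real) = Suc (dim ?K)" by (rule dim_orthogonal_complement_line[OF norm_north_pole])
  interpret K: pole_slice ?N ?K 0 by (rule W(1))
  have "DIM((real^'n) \<times> real) = CARD('n) + 1" by simp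
  then have dK: "dim ?K > 0" using dE zero_less_card_finite[where 'a='n] by linarith
  have "emeasure lborel C = 0"
    using K.cone_null_iff[OF dK, of Z] Z(2) unfolding W(2,3) ind[symmetric] subspace_lborel_UNIV by simp
  from AE_slice_planes[OF _ _ this, of k] k
  have "AE \<tau> in slice_planes_measure k. \<tau> \<in> slice_planes k \<and> emeasure (subspace_lborel ((\<lambda>x. x - ?N) ` \<tau>)) C = 0" by simp
  then show ?thesis
  proof eventually_elim
    case (elim \<tau>)
    show ?case
    proof
      assume far: "\<tau> \<in> far_planes k b"
      obtain U p where U: "pole_slice ?N U p" "\<tau> = pole_plane ?N U p" "Suc (dim U) = k"
        using slice_planes_pole_plane elim by blast
      interpret T: pole_slice ?N U p by fact
      have dU: "dim U > 0" using U(3) k by simp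
      have "(\<lambda>x. x - ?N) ` \<tau> = T.V" unfolding U(2) pole_plane_def T.V_def by (simp add: image_image)
      then have "emeasure (surface_measure \<tau>) Z = 0"
        using T.cone_null_iff[OF dU, of Z] elim unfolding U(2) ind[symmetric] by simp
      then have "Z \<in> null_sets (surface_measure \<tau>)" by (simp add: null_sets_def)
      then have nZ: "AE \<eta> in surface_measure \<tau>. \<eta> \<notin> Z" by (rule AE_not_in)
      have "AE \<eta> in surface_measure \<tau>. \<eta> \<in> cap b"
        unfolding U(2)
      proof (rule T.surface_AE[OF dU])
        fix z assume z: "z \<in> U"
        note o = T.foot_orth[OF z] and st = inverse_stereographic[OF norm_north_pole T.foot_orth[OF z]]
        have "norm p > sqrt ((1 + b) / (1 - b))" using far U pole_plane_far_iff[OF U(1,3) b] by simp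
        moreover have "norm p \<le> norm (p + z)"
          by (rule power2_le_imp_le) (use T.norm_foot[OF z] in simp_all)
        ultimately have r: "norm (p + z) > sqrt ((1 + b) / (1 - b))" by simp
        let ?e = "second_point ?N (p + z - ?N)"
        have pos: "1 + (norm (p + z))\<^sup>2 > 0" by (simp add: add_pos_nonneg)
        have "?e \<bullet> ?N > b \<longleftrightarrow> norm (p + z) > sqrt ((1 + b) / (1 - b))"
          by (rule cap_threshold[OF b]) (use st(2) pos in simp_all)
        then show "?e \<in> cap b" using r st(1) by (simp add: cap_def inner_north_pole)
      next
        have "closed (sphere (0 :: (real^'n) \<times> real) 1)" "open {x :: (real^'n) \<times> real. b < snd x}"
          by (auto intro!: open_Collect_less continuous_intros)
        then have "cap b \<in> sets (borel :: ((real^'n) \<times> real) measure)"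
          unfolding cap_def by (simp add: Collect_conj_eq)
        then show "Measurable.pred borel (\<lambda>\<eta>. \<eta> \<in> (cap b :: ((real^'n) \<times> real) set))" by simp
      qed
      with nZ have "AE \<eta> in surface_measure \<tau>. f \<eta> = 0" by eventually_elim (use Z(1) in auto)
      from completion_AE_borel[OF borel_measurable_const this]
      show "slice_converges f \<tau> \<and> slice_transform f \<tau> = 0"
        unfolding slice_converges_def slice_transform_def by simp
    qed
  qed
qed

section \<open>Functions of critical growth\<close>

definition stereo :: "'a::euclidean_space \<Rightarrow> 'a \<Rightarrow> 'a" where
  "stereo N \<eta> = N + (1 / (1 - \<eta> \<bullet> N)) *\<^sub>R (\<eta> - N)"

lemma stereo_inverse:
  fixes N :: "'a::euclidean_space"
  assumes N: "norm N = 1" and x: "x \<bullet> N = 0"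
  shows "stereo N (second_point N (x - N)) = x"
proof -
  have NN: "N \<bullet> N = 1" using N by (simp add: dot_square_norm)
  have pos: "1 + x \<bullet> x \<noteq> 0" by (metis add_pos_nonneg inner_ge_zero less_irrefl zero_less_one)
  have xx: "(x - N) \<bullet> (x - N) = 1 + x \<bullet> x" using NN x by (simp add: inner_diff inner_commute)
  have "N \<bullet> (x - N) = - 1" using NN x by (simp add: inner_diff_right inner_commute)
  then have e: "second_point N (x - N) = N + (2 / (1 + x \<bullet> x)) *\<^sub>R (x - N)"
    unfolding second_point_def xx by simp
  have "1 - second_point N (x - N) \<bullet> N = 2 / (1 + x \<bullet> x)"
    using inverse_stereographic(2)[OF N x] by (simp add: power2_norm_eq_inner)
  then have "stereo N (second_point N (x - N)) = N + (1 / (2 / (1 + x \<bullet> x)) * (2 / (1 + x \<bullet> x))) *\<^sub>R (x - N)"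
    unfolding stereo_def e by simp
  also have "1 / (2 / (1 + x \<bullet> x)) * (2 / (1 + x \<bullet> x)) = 1" using pos by simp
  finally show ?thesis by simp
qed

lemma stereo_measurable [measurable]: "stereo N \<in> borel_measurable borel"
  unfolding stereo_def by measurable

lemma punctured_sphere_pos:
  fixes N :: "'a::euclidean_space"
  assumes "norm N = 1" "\<eta> \<in> sphere 0 1 - {N}"
  shows "1 - \<eta> \<bullet> N > 0"
  using stereographic[OF assms(1), of \<eta>] assms(2) by auto

lemma stereo_continuous:
  fixes N :: "'a::euclidean_space"
  assumes N: "norm N = 1"
  shows "continuous_on (sphere 0 1 - {N}) (stereo N)"
  unfolding stereo_def using punctured_sphere_pos[OF N] by (intro continuous_intros) force+

context pole_slice
begin

text \<open>
  For \<open>g = 1\<close> this is the radial function of the critical growth; a bounded factor \<open>g\<close>, given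
  in stereographic coordinates, preserves the growth condition.
\<close>

definition critical :: "('a \<Rightarrow> real) \<Rightarrow> 'a \<Rightarrow> complex" where
  "critical g \<eta> = complex_of_real ((1 - \<eta> \<bullet> N) powr (- (real (dim U) / 2)) * g (stereo N \<eta>))"

lemma critical_continuous:
  assumes g: "continuous_on UNIV g"
  shows "continuous_on (sphere 0 1 - {N}) (critical g)"
  unfolding critical_def
proof (intro continuous_intros)
  show "continuous_on (sphere 0 1 - {N}) (\<lambda>\<eta>. g (stereo N \<eta>))"
    by (rule continuous_on_compose2[OF g stereo_continuous[OF norm_N]]) simp
  show "\<forall>x\<in>sphere 0 1 - {N}. 1 - x \<bullet> N \<noteq> 0" using punctured_sphere_pos[OF norm_N] by force
qed

lemma critical_bound:
  assumes e: "\<eta> \<in> sphere 0 1 - {N}" and g: "\<And>x. \<bar>g x\<bar> \<le> 1"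
  shows "(1 - \<eta> \<bullet> N) powr (real (dim U) / 2) * norm (critical g \<eta>) \<le> 1"
proof -
  let ?t = "1 - \<eta> \<bullet> N"
  have t: "?t > 0" by (rule punctured_sphere_pos[OF norm_N e])
  have "?t powr (real (dim U) / 2) * norm (critical g \<eta>) = (?t powr (real (dim U) / 2) * ?t powr (- (real (dim U) / 2))) * \<bar>g (stereo N \<eta>)\<bar>"
    unfolding critical_def norm_of_real by (simp add: abs_mult)
  also have "?t powr (real (dim U) / 2) * ?t powr (- (real (dim U) / 2)) = 1"
    using t by (simp flip: powr_add)
  finally show ?thesis using g by simp
qed

text \<open>
  Over the trace of the plane the integrand is a multiple of \<open>(A + |z|\<^sup>2) powr (- dim U / 2)\<close>.
\<close>

lemma critical_diverges:
  assumes d: "dim U > 0" and g: "continuous_on UNIV g" "\<And>z. z \<in> U \<Longrightarrow> g (p + z) = 1"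
  shows "\<not> integrable (completion (surface_measure (pole_plane N U p))) (critical g)"
proof
  assume "integrable (completion (surface_measure (pole_plane N U p))) (critical g)"
  then have i: "integrable (subspace_lborel U) (\<lambda>z. pullback N (dim U) (critical g) (p + z))"
    using slice_integral(1)[OF d critical_continuous[OF g(1)]] by simp
  let ?d = "real (dim U)"
  let ?A = "1 + (norm p)\<^sup>2"
  have A: "?A > 0" by (simp add: add_pos_nonneg)
  have n: "norm (pullback N (dim U) (critical g) (p + z)) = 2 powr (?d / 2) * (?A + (norm z)\<^sup>2) powr (- (?d / 2))" if z: "z \<in> U" for z
  proof -
    define t where "t = 2 / (1 + (norm (p + z))\<^sup>2)"
    have p1: "1 + (norm (p + z))\<^sup>2 = ?A + (norm z)\<^sup>2" using norm_foot[OF z] by simp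
    have pos: "?A + (norm z)\<^sup>2 > 0" using A by (simp add: add_pos_nonneg)
    have t: "t > 0" unfolding t_def p1 using pos by simp
    have s: "1 - second_point N (p + z - N) \<bullet> N = t"
      unfolding t_def by (rule inverse_stereographic(2)[OF norm_N foot_orth[OF z]])
    have "norm (pullback N (dim U) (critical g) (p + z)) = t ^ dim U * t powr (- (?d / 2))"
      using t foot_orth[OF z] unfolding pullback_def critical_def s stereo_inverse[OF norm_N foot_orth[OF z]] g(2)[OF z] t_def[symmetric]
      by (simp add: norm_mult norm_power)
    also have "\<dots> = t powr (?d / 2)" using t by (simp flip: powr_realpow powr_add)
    also have "\<dots> = 2 powr (?d / 2) * (?A + (norm z)\<^sup>2) powr (- (?d / 2))"
      unfolding t_def p1 using pos by (simp add: powr_divide powr_minus_divide)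
    finally show ?thesis .
  qed
  have "(\<integral>\<^sup>+z. ennreal (norm (pullback N (dim U) (critical g) (p + z))) \<partial>subspace_lborel U)
    = (\<integral>\<^sup>+z. ennreal (2 powr (?d / 2)) * ennreal ((?A + (norm z)\<^sup>2) powr (- (?d / 2))) \<partial>subspace_lborel U)"
  proof (rule nn_integral_cong_AE)
    show "AE z in subspace_lborel U. ennreal (norm (pullback N (dim U) (critical g) (p + z))) = ennreal (2 powr (?d / 2)) * ennreal ((?A + (norm z)\<^sup>2) powr (- (?d / 2)))"
      using AE_subspace_lborel_in[OF subU] by eventually_elim (simp only: n ennreal_mult powr_ge_zero)
  qed
  also have "\<dots> = ennreal (2 powr (?d / 2)) * \<infinity>"
    by (subst nn_integral_cmult) (use nn_integral_inverse_power_infinite[OF subU A d] in simp_all)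
  also have "\<dots> = \<infinity>" by (simp add: ennreal_mult_eq_top_iff)
  finally show False using i unfolding integrable_iff_bounded by simp
qed

lemma infdist_subspace_ge:
  assumes u: "u \<in> U" and w: "\<And>a. a \<in> U \<Longrightarrow> w \<bullet> a = 0"
  shows "norm w \<le> infdist (u + w) U"
proof -
  have "norm w \<le> dist (u + w) a" if "a \<in> U" for a
  proof -
    have "u - a \<in> U" using u that subU by (simp add: subspace_diff)
    then have "(norm ((u - a) + w))\<^sup>2 = (norm (u - a))\<^sup>2 + (norm w)\<^sup>2"
      by (intro norm_add_Pythagorean) (use w in \<open>auto simp: orthogonal_def inner_commute[of _ w]\<close>)
    then have "(norm w)\<^sup>2 \<le> (norm ((u - a) + w))\<^sup>2" by simp
    then have "norm w \<le> norm ((u - a) + w)" by (rule power2_le_imp_le) simp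
    then show ?thesis by (simp add: dist_norm algebra_simps)
  qed
  moreover have "U \<noteq> {}" using subspace_0[OF subU] by auto
  ultimately show ?thesis by (simp add: infdist_notempty cINF_greatest)
qed

text \<open>
  A Gaussian in the distance from the affine plane \<open>p + U\<close>.
\<close>

definition tube :: "'a \<Rightarrow> real" where "tube x = exp (- (infdist (x - p) U)\<^sup>2)"

lemma tube_props: "continuous_on UNIV tube" "\<bar>tube x\<bar> \<le> 1" "tube x \<ge> 0" "z \<in> U \<Longrightarrow> tube (p + z) = 1"
  unfolding tube_def by (auto intro!: continuous_intros)

lemma tube_measurable [measurable]: "tube \<in> borel_measurable borel"
  by (rule borel_measurable_continuous_onI[OF tube_props(1)])

text \<open>
  In the decomposition \<open>u + w\<close> along \<open>U\<close> and its complement, the power is dominated by that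
  of \<open>1 + |u|\<^sup>2\<close>, which is integrable over \<open>U\<close> since its exponent exceeds the critical one of
  \<open>U\<close>, and the Gaussian is integrable over the complement.
\<close>

lemma nn_integral_tube_finite:
  assumes d: "dim U < dim {y. y \<bullet> N = 0}"
  shows "(\<integral>\<^sup>+x. ennreal ((1 + (norm x)\<^sup>2) powr (- (real (dim {y. y \<bullet> N = 0}) / 2)) * tube x) \<partial>subspace_lborel {y. y \<bullet> N = 0}) < \<infinity>"
proof -
  let ?K = "{y. y \<bullet> N = 0}"
  let ?n = "real (dim ?K)"
  define W where "W = {y. y \<bullet> N = 0 \<and> (\<forall>u\<in>U. y \<bullet> u = 0)}"
  have W: "subspace W" by (auto simp: W_def subspace_def inner_add_left)
  have pW: "p \<in> W" using p_N p_U by (auto simp: W_def inner_commute)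
  have UW: "x \<bullet> y = 0" if "x \<in> U" "y \<in> W" for x y using that by (auto simp: W_def inner_commute)
  have K: "?K = {x + y |x y. x \<in> U \<and> y \<in> W}"
  proof (intro set_eqI iffI)
    fix x assume x: "x \<in> ?K"
    obtain y z where yz: "y \<in> span U" "\<And>w. w \<in> span U \<Longrightarrow> orthogonal z w" "x = y + z"
      using orthogonal_subspace_decomp_exists by blast
    have "y \<in> U" using yz(1) span_eq_iff[THEN iffD2, OF subU] by simp
    moreover have "z \<in> W"
    proof -
      have "z \<bullet> N = 0" using x yz(3) U_N[OF \<open>y \<in> U\<close>] by (simp add: inner_add_left)
      then show ?thesis using yz(2) by (auto simp: W_def orthogonal_def span_base)
    qed
    ultimately show "x \<in> {x + y |x y. x \<in> U \<and> y \<in> W}" using yz(3) by blast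
  qed (use U_N in \<open>auto simp: W_def inner_add_left\<close>)
  let ?h = "\<lambda>x. ennreal ((1 + (norm x)\<^sup>2) powr (- (?n / 2)) * tube x)"
  have "(\<integral>\<^sup>+x. ?h x \<partial>subspace_lborel ?K) = (\<integral>\<^sup>+u. \<integral>\<^sup>+w. ?h (u + w) \<partial>subspace_lborel W \<partial>subspace_lborel U)"
    unfolding K by (rule nn_integral_subspace_split[OF subU W UW]) measurable
  also have "\<dots> \<le> (\<integral>\<^sup>+u. \<integral>\<^sup>+w. ennreal ((1 + (norm u)\<^sup>2) powr (- (?n / 2))) * ennreal (exp (- 1 * (norm (- p + w))\<^sup>2)) \<partial>subspace_lborel W \<partial>subspace_lborel U)"
  proof (rule nn_integral_mono_AE)
    show "AE u in subspace_lborel U. (\<integral>\<^sup>+w. ?h (u + w) \<partial>subspace_lborel W)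
      \<le> (\<integral>\<^sup>+w. ennreal ((1 + (norm u)\<^sup>2) powr (- (?n / 2))) * ennreal (exp (- 1 * (norm (- p + w))\<^sup>2)) \<partial>subspace_lborel W)"
      using AE_subspace_lborel_in[OF subU]
    proof eventually_elim
      case (elim u)
      show ?case
      proof (rule nn_integral_mono_AE)
        show "AE w in subspace_lborel W. ?h (u + w) \<le> ennreal ((1 + (norm u)\<^sup>2) powr (- (?n / 2))) * ennreal (exp (- 1 * (norm (- p + w))\<^sup>2))"
          using AE_subspace_lborel_in[OF W]
        proof eventually_elim
          case (elim w)
          have pw: "- p + w \<in> W" using subspace_diff[OF W elim pW] by simp
          have "norm (- p + w) \<le> infdist (u + (- p + w)) U"
            by (rule infdist_subspace_ge[OF \<open>u \<in> U\<close>]) (use pw in \<open>auto simp: W_def\<close>)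
          then have "(norm (- p + w))\<^sup>2 \<le> (infdist (u + w - p) U)\<^sup>2" by (intro power_mono) (auto simp: algebra_simps)
          then have t: "tube (u + w) \<le> exp (- 1 * (norm (- p + w))\<^sup>2)" by (simp add: tube_def)
          have "(norm (u + w))\<^sup>2 = (norm u)\<^sup>2 + (norm w)\<^sup>2"
            by (rule norm_add_Pythagorean) (use UW[OF \<open>u \<in> U\<close> elim] in \<open>simp add: orthogonal_def\<close>)
          moreover have "1 + (norm u)\<^sup>2 > 0" by (simp add: add_pos_nonneg)
          ultimately have "(1 + (norm (u + w))\<^sup>2) powr (- (?n / 2)) \<le> (1 + (norm u)\<^sup>2) powr (- (?n / 2))"
            by (intro powr_mono2') auto
          then have "(1 + (norm (u + w))\<^sup>2) powr (- (?n / 2)) * tube (u + w) \<le> (1 + (norm u)\<^sup>2) powr (- (?n / 2)) * exp (- 1 * (norm (- p + w))\<^sup>2)"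
            by (rule mult_mono[OF _ t]) (auto simp: tube_props)
          then show ?case by (simp only: ennreal_mult[symmetric] powr_ge_zero exp_ge_zero ennreal_leI)
        qed
      qed
    qed
  qed
  also have "\<dots> = (\<integral>\<^sup>+u. ennreal ((1 + (norm u)\<^sup>2) powr (- (?n / 2))) \<partial>subspace_lborel U) * ennreal (sqrt (pi / 1) ^ dim W)"
  proof -
    have mp: "- p \<in> W" using subspace_neg[OF W pW] .
    have "(\<integral>\<^sup>+w. ennreal (exp (- 1 * (norm (- p + w))\<^sup>2)) \<partial>subspace_lborel W) = (\<integral>\<^sup>+w. ennreal (exp (- 1 * (norm w)\<^sup>2)) \<partial>distr (subspace_lborel W) borel (\<lambda>w. - p + w))"
      by (subst nn_integral_distr) auto
    also have "\<dots> = ennreal (sqrt (pi / 1) ^ dim W)"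
      unfolding subspace_lborel_translate[OF W mp] by (rule nn_integral_gaussian_subspace[OF W]) simp
    finally have g: "(\<integral>\<^sup>+w. ennreal (exp (- 1 * (norm (- p + w))\<^sup>2)) \<partial>subspace_lborel W) = ennreal (sqrt (pi / 1) ^ dim W)" .
    have "(\<integral>\<^sup>+w. ennreal ((1 + (norm u)\<^sup>2) powr (- (?n / 2))) * ennreal (exp (- 1 * (norm (- p + w))\<^sup>2)) \<partial>subspace_lborel W)
       = ennreal ((1 + (norm u)\<^sup>2) powr (- (?n / 2))) * ennreal (sqrt (pi / 1) ^ dim W)" for u :: 'a
      unfolding g[symmetric] by (rule nn_integral_cmult) measurable
    then show ?thesis by (simp only:) (rule nn_integral_multc, measurable)
  qed
  also have "\<dots> < \<infinity>"
    using nn_integral_inverse_power_finite[OF subU, of 1 "?n / 2"] d by (simp add: ennreal_mult_less_top)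
  finally show ?thesis .
qed

lemma critical_tube_integrable:
  assumes d: "dim U < dim {y. y \<bullet> N = 0}"
  shows "critical tube \<in> borel_measurable borel"
    and "integrable (surface_measure UNIV) (\<lambda>\<eta>. norm (critical tube \<eta>) / (1 - \<eta> \<bullet> N) powr ((real (dim {y. y \<bullet> N = 0}) - real (dim U)) / 2))"
proof -
  let ?K = "{y. y \<bullet> N = 0}"
  let ?n = "real (dim ?K)" and ?d = "real (dim U)"
  show [measurable]: "critical tube \<in> borel_measurable borel" unfolding critical_def by measurable
  note W = pole_slice_whole_space[OF norm_N]
  have sK: "subspace ?K" by (rule subspace_hyperplane)
  interpret K: pole_slice N ?K 0 by (rule W(1))
  have dK: "dim ?K > 0" using d by simp
  let ?g = "\<lambda>\<eta>. norm (critical tube \<eta>) / (1 - \<eta> \<bullet> N) powr ((?n - ?d) / 2)"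
  show "integrable (surface_measure UNIV) ?g"
  proof (rule integrableI_bounded)
    have "(\<integral>\<^sup>+\<eta>. ennreal (norm (?g \<eta>)) \<partial>surface_measure UNIV)
      = (\<integral>\<^sup>+x. ennreal ((2 / (1 + (norm (0 + x))\<^sup>2)) ^ dim ?K) * ennreal (norm (?g (second_point N (0 + x - N)))) \<partial>subspace_lborel ?K)"
      unfolding W(3)[symmetric] K.surface_measure_pole_plane[OF dK]
      by (subst nn_integral_distr, simp, simp, subst nn_integral_density) auto
    also have "\<dots> = (\<integral>\<^sup>+x. ennreal (2 powr (?n / 2)) * ennreal ((1 + (norm x)\<^sup>2) powr (- (?n / 2)) * tube x) \<partial>subspace_lborel ?K)"
    proof (rule nn_integral_cong_AE)
      show "AE x in subspace_lborel ?K. ennreal ((2 / (1 + (norm (0 + x))\<^sup>2)) ^ dim ?K) * ennreal (norm (?g (second_point N (0 + x - N))))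
        = ennreal (2 powr (?n / 2)) * ennreal ((1 + (norm x)\<^sup>2) powr (- (?n / 2)) * tube x)"
        using AE_subspace_lborel_in[OF sK]
      proof eventually_elim
        case (elim x)
        then have x: "x \<bullet> N = 0" by simp
        define t where "t = 2 / (1 + (norm x)\<^sup>2)"
        have pos: "1 + (norm x)\<^sup>2 > 0" by (simp add: add_pos_nonneg)
        have t: "t > 0" unfolding t_def using pos by simp
        have s: "1 - second_point N (0 + x - N) \<bullet> N = t"
          unfolding t_def using inverse_stereographic(2)[OF norm_N x] by simp
        have si: "stereo N (second_point N (0 + x - N)) = x" using stereo_inverse[OF norm_N x] by simp
        have "norm (?g (second_point N (0 + x - N))) = t powr (- (?d / 2)) * tube x / t powr ((?n - ?d) / 2)"
          unfolding s critical_def si using t tube_props(3)[of x] by (simp add: norm_mult)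
        also have "\<dots> = t powr (- (?d / 2) - (?n - ?d) / 2) * tube x" by (simp add: powr_diff)
        also have "- (?d / 2) - (?n - ?d) / 2 = - (?n / 2)" by (simp add: field_simps)
        finally have g: "norm (?g (second_point N (0 + x - N))) = t powr (- (?n / 2)) * tube x" .
        have "t ^ dim ?K * (t powr (- (?n / 2)) * tube x) = (t powr ?n * t powr (- (?n / 2))) * tube x"
          using t by (simp add: powr_realpow)
        also have "t powr ?n * t powr (- (?n / 2)) = t powr (?n / 2)" by (simp flip: powr_add)
        also have "t powr (?n / 2) = 2 powr (?n / 2) * (1 + (norm x)\<^sup>2) powr (- (?n / 2))"
          unfolding t_def using pos by (simp add: powr_divide powr_minus_divide)
        finally have e: "t ^ dim ?K * (t powr (- (?n / 2)) * tube x) = 2 powr (?n / 2) * ((1 + (norm x)\<^sup>2) powr (- (?n / 2)) * tube x)" by simp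
        have "ennreal (t ^ dim ?K) * ennreal (t powr (- (?n / 2)) * tube x) = ennreal (2 powr (?n / 2)) * ennreal ((1 + (norm x)\<^sup>2) powr (- (?n / 2)) * tube x)"
          using e t tube_props(3)[of x] by (simp flip: ennreal_mult)
        then show ?case unfolding g by (simp only: add_0 t_def)
      qed
    qed
    also have "\<dots> = ennreal (2 powr (?n / 2)) * (\<integral>\<^sup>+x. ennreal ((1 + (norm x)\<^sup>2) powr (- (?n / 2)) * tube x) \<partial>subspace_lborel ?K)"
      by (rule nn_integral_cmult) measurable
    also have "\<dots> < \<infinity>" using nn_integral_tube_finite[OF d] by (simp add: ennreal_mult_less_top)
    finally show "(\<integral>\<^sup>+\<eta>. ennreal (norm (?g \<eta>)) \<partial>surface_measure UNIV) < \<infinity>" .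
  qed measurable
qed

end

section \<open>The support theorem for spherical slices\<close>

lemma DIM_prod_real: "DIM((real^'n) \<times> real) = CARD('n) + 1"
  by simp

lemma weighted_bounded_iff:
  fixes f :: "(real^'n) \<times> real \<Rightarrow> complex"
  shows "weighted_bounded \<mu> f \<longleftrightarrow> (\<exists>C. \<forall>\<eta>\<in>sphere 0 1 - {north_pole}. (1 - \<eta> \<bullet> north_pole) powr \<mu> * norm (f \<eta>) \<le> C)"
  by (simp add: weighted_bounded_def bdd_above_def inner_north_pole)

text \<open>
  The translation of the support property into \<open>\<real>\<^sup>n\<close>.  The exclusion of the pole is what makes
  every remaining point of the cap the image of a point of \<open>\<real>\<^sup>n\<close>.
\<close>

lemma support_property_from_pullback:
  fixes f :: "(real^'n) \<times> real \<Rightarrow> complex"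
  assumes k: "2 \<le> k" and b: "-1 < b" "b < 1" and f: "continuous_on (sphere 0 1 - {north_pole}) f"
    and main: "\<And>x. (\<And>U p. pole_slice north_pole U p \<Longrightarrow> dim U = k - 1 \<Longrightarrow> norm p > sqrt ((1 + b) / (1 - b)) \<Longrightarrow>
        (\<integral>z. pullback north_pole (k - 1) f (p + z) \<partial>subspace_lborel U) = 0) \<Longrightarrow>
      x \<bullet> north_pole = 0 \<Longrightarrow> norm x > sqrt ((1 + b) / (1 - b)) \<Longrightarrow> pullback north_pole (k - 1) f x = 0"
  shows "support_property k b f"
  unfolding support_property_def
proof (intro impI ballI)
  let ?N = "north_pole :: (real^'n) \<times> real"
  assume h: "\<forall>\<tau>\<in>far_planes k b. slice_transform f \<tau> = 0"
  have zero: "(\<integral>z. pullback ?N (k - 1) f (p + z) \<partial>subspace_lborel U) = 0"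
    if U: "pole_slice ?N U p" "dim U = k - 1" "norm p > sqrt ((1 + b) / (1 - b))" for U p
  proof -
    interpret T: pole_slice ?N U p by fact
    have dk: "Suc (dim U) = k" "dim U > 0" using U(2) k by auto
    have "pole_plane ?N U p \<in> far_planes k b" using pole_plane_far_iff[OF U(1) dk(1) b] U(3) by simp
    then have "slice_transform f (pole_plane ?N U p) = 0" using h by blast
    then show ?thesis using T.slice_integral(2)[OF dk(2) f] U(2) by (simp add: slice_transform_def)
  qed
  fix \<eta> :: "(real^'n) \<times> real" assume e: "\<eta> \<in> cap b - {?N}"
  then have e1: "norm \<eta> = 1" "\<eta> \<noteq> ?N" "\<eta> \<bullet> ?N > b" by (auto simp: cap_def inner_north_pole)
  obtain x where x: "x \<bullet> ?N = 0" "second_point ?N (x - ?N) = \<eta>" "1 + (norm x)\<^sup>2 = 2 / (1 - \<eta> \<bullet> ?N)" "1 - \<eta> \<bullet> ?N > 0"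
    using stereographic[OF norm_north_pole e1(1,2)] by blast
  have "norm x > sqrt ((1 + b) / (1 - b))" using cap_threshold[OF b x(3,4) norm_ge_zero] e1(3) by simp
  from main[OF zero x(1) this] have "(2 / (1 + (norm x)\<^sup>2)) ^ (k - 1) *\<^sub>R f \<eta> = 0"
    using x(1,2) by (simp add: pullback_def)
  moreover have "2 / (1 + (norm x)\<^sup>2) \<noteq> 0" unfolding x(3) using x(4) by simp
  ultimately show "f \<eta> = 0" by simp
qed

text \<open>
  The first function is the same for all planes because it depends on the dimension of the
  trace only.  For the second one a distant plane is chosen first.
\<close>

lemma decay_sharpness:
  assumes k: "2 \<le> k" "k < CARD('n::finite)" and b: "-1 < b" "b < 1"
  shows "decay_sharp TYPE('n) k b"
proof -
  let ?N = "north_pole :: (real^'n) \<times> real"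
  let ?S = "sphere 0 1 - {?N}"
  let ?K = "{y. y \<bullet> ?N = 0}"
  let ?R = "sqrt ((1 + b) / (1 - b))"
  note N = norm_north_pole[where 'n='n]
  have dK: "dim ?K = CARD('n)" using dim_orthogonal_complement_line[OF N] DIM_prod_real[where 'n='n] by simp
  have sK: "subspace ?K" by (rule subspace_hyperplane)
  have "Suc (k - 1) \<le> dim ?K" using k dK by simp
  then obtain H where H: "subspace H" "H \<subseteq> span ?K" "dim H = Suc (k - 1)" by (rule choose_subspace_of_subspace)
  have HK: "y \<bullet> ?N = 0" if "y \<in> H" for y
    using H(2) span_eq_iff[THEN iffD2, OF sK] that by blast
  obtain u where u: "u \<in> H" "norm u = 1" using subspace_unit_exists[OF H(1)] H(3) by auto
  define U where "U = {y\<in>H. y \<bullet> u = 0}"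
  define p where "p = (?R + 1) *\<^sub>R u"
  have dU: "Suc (dim U) = k" "dim U = k - 1"
    using dim_subspace_orthogonal_part[OF H(1) u(2,1)] H(3) k by (auto simp: U_def)
  have ps: "pole_slice ?N U p"
    unfolding U_def p_def using pole_slice_hyperplane[OF N H(1) HK, of 0 u "?R + 1"] u by simp
  have R: "?R \<ge> 0" using b by simp
  have "norm p > ?R" unfolding p_def using u R by simp
  then have far: "pole_plane ?N U p \<in> far_planes k b" using pole_plane_far_iff[OF ps dU(1) b] by simp
  interpret T: pole_slice ?N U p by fact
  have e: "(real k - 1) / 2 = real (dim U) / 2" using dU k by simp
  have dpos: "dim U > 0" using dU k by simp
  have bound: "weighted_bounded ((real k - 1) / 2) (T.critical g)" if "\<And>x. \<bar>g x\<bar> \<le> 1" for g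
    unfolding weighted_bounded_iff e using T.critical_bound that by blast
  have part1: "\<exists>f :: (real^'n) \<times> real \<Rightarrow> complex.
        continuous_on ?S f \<and> weighted_bounded ((real k - 1) / 2) f \<and> (\<forall>\<tau>\<in>slice_planes k. \<not> slice_converges f \<tau>)"
  proof (intro exI conjI ballI)
    let ?f = "T.critical (\<lambda>_. 1)"
    show "continuous_on ?S ?f" by (rule T.critical_continuous) simp
    show "weighted_bounded ((real k - 1) / 2) ?f" by (rule bound) simp
    fix \<tau> :: "((real^'n) \<times> real) set" assume "\<tau> \<in> slice_planes k"
    then obtain U' p' where U': "pole_slice ?N U' p'" "\<tau> = pole_plane ?N U' p'" "Suc (dim U') = k"
      by (rule slice_planes_pole_plane)
    interpret T': pole_slice ?N U' p' by fact
    have "dim U' = dim U" using U'(3) dU(1) by simp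
    then have "?f = T'.critical (\<lambda>_. 1)" by (simp add: fun_eq_iff T.critical_def T'.critical_def)
    moreover have "\<not> integrable (completion (surface_measure \<tau>)) (T'.critical (\<lambda>_. 1))"
      unfolding U'(2) by (rule T'.critical_diverges) (use U'(3) k in auto)
    ultimately show "\<not> slice_converges ?f \<tau>" by (simp add: slice_converges_def)
  qed
  have part2: "\<exists>f :: (real^'n) \<times> real \<Rightarrow> complex. slice_integrability k f \<and>
        continuous_on ?S f \<and> weighted_bounded ((real k - 1) / 2) f \<and> (\<exists>\<tau>\<in>far_planes k b. \<not> slice_converges f \<tau>)"
  proof (intro exI conjI bexI)
    let ?f = "T.critical T.tube"
    show "continuous_on ?S ?f" by (rule T.critical_continuous[OF T.tube_props(1)])
    show "weighted_bounded ((real k - 1) / 2) ?f" by (rule bound[OF T.tube_props(2)])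
    show "pole_plane ?N U p \<in> far_planes k b" by (rule far)
    show "\<not> slice_converges ?f (pole_plane ?N U p)"
      unfolding slice_converges_def by (rule T.critical_diverges[OF dpos T.tube_props(1,4)])
    show "slice_integrability k ?f"
      unfolding slice_integrability_def
    proof (intro conjI allI impI)
      have dlt: "dim U < dim ?K" using dU dK k by simp
      note ct = T.critical_tube_integrable[OF dlt]
      show "?f \<in> borel_measurable (completion (surface_measure UNIV))"
        by (rule measurable_completion) (use ct(1) in simp)
      fix \<epsilon> :: real assume "0 < \<epsilon> \<and> \<epsilon> \<le> 2"
      let ?A = "{\<eta> \<in> sphere 0 1. snd \<eta> > 1 - \<epsilon>} :: ((real^'n) \<times> real) set"
      let ?g = "\<lambda>\<eta>. norm (?f \<eta>) / (1 - snd \<eta>) powr ((real CARD('n) + 1 - real k) / 2)"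
      have "real (dim ?K) - real (dim U) = real CARD('n) + 1 - real k" using dK dU k by simp
      with ct(2) have i: "integrable (surface_measure UNIV) ?g" by (simp only: inner_north_pole)
      have A: "?A \<in> sets (surface_measure UNIV)"
      proof -
        have "open {\<eta> :: (real^'n) \<times> real. snd \<eta> > 1 - \<epsilon>}" by (intro open_Collect_less continuous_intros)
        then have "sphere 0 1 \<inter> {\<eta> :: (real^'n) \<times> real. snd \<eta> > 1 - \<epsilon>} \<in> sets borel" by (intro sets.Int) auto
        then show ?thesis by (simp add: Int_def)
      qed
      have "integrable (surface_measure UNIV) (\<lambda>\<eta>. indicator ?A \<eta> *\<^sub>R ?g \<eta>)"
        by (rule integrable_mult_indicator[OF A i])
      moreover from this have "(\<lambda>\<eta>. indicator ?A \<eta> *\<^sub>R ?g \<eta>) \<in> borel_measurable (surface_measure UNIV)"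
        by (rule borel_measurable_integrable)
      ultimately show "set_integrable (completion (surface_measure UNIV)) ?A ?g"
        unfolding set_integrable_def by (simp only: integrable_completion)
    qed
  qed
  show ?thesis unfolding decay_sharp_def using part1 part2 by blast
qed

theorem theorem4p4:
  fixes k :: nat and b :: real
  assumes "CARD('n::finite) \<ge> 2" and "2 \<le> k" and "k \<le> CARD('n)" and "-1 < b" and "b < 1"
  shows
    "(\<forall>f :: (real^'n) \<times> real \<Rightarrow> complex. slice_integrability k f \<longrightarrow>
        ((AE \<eta> in completion (surface_measure UNIV). \<eta> \<in> cap b \<longrightarrow> f \<eta> = 0) \<longrightarrow>
           (AE \<tau> in slice_planes_measure k. \<tau> \<in> far_planes k b \<longrightarrow>
              slice_converges f \<tau> \<and> slice_transform f \<tau> = 0)) \<and>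
        (continuous_on (sphere 0 1 - {north_pole}) f \<and>
           (\<forall>m::real. m > 0 \<longrightarrow> weighted_bounded (real k - 1 - m / 2) f) \<longrightarrow>
           support_property k b f) \<and>
        (k < CARD('n) \<and> continuous_on (sphere 0 1 - {north_pole}) f \<and>
           (\<exists>\<mu>. \<mu> < (real k - 1) / 2 \<and> weighted_bounded \<mu> f) \<longrightarrow>
           support_property k b f))
     \<and> (k < CARD('n) \<longrightarrow> decay_sharp TYPE('n) k b)"
proof -
  note k = assms(2,3) and b = assms(4,5)
  let ?N = "north_pole :: (real^'n) \<times> real"
  have R: "sqrt ((1 + b) / (1 - b)) \<ge> 0" using b by simp
  have low: "support_property k b f"
    if kn: "k < CARD('n)" and f: "continuous_on (sphere 0 1 - {?N}) f"
      and mu: "\<mu> < (real k - 1) / 2" "weighted_bounded \<mu> f" for f :: "(real^'n) \<times> real \<Rightarrow> complex" and \<mu>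
  proof (rule support_property_from_pullback[OF k(1) b f])
    obtain C where C: "\<And>\<eta>. \<eta> \<in> sphere 0 1 - {?N} \<Longrightarrow> (1 - \<eta> \<bullet> ?N) powr \<mu> * norm (f \<eta>) \<le> C"
      using mu(2) unfolding weighted_bounded_iff by blast
    fix x :: "(real^'n) \<times> real"
    assume z: "\<And>U p. pole_slice ?N U p \<Longrightarrow> dim U = k - 1 \<Longrightarrow> norm p > sqrt ((1 + b) / (1 - b)) \<Longrightarrow>
        (\<integral>z. pullback ?N (k - 1) f (p + z) \<partial>subspace_lborel U) = 0"
      and x: "x \<bullet> ?N = 0" "norm x > sqrt ((1 + b) / (1 - b))"
    show "pullback ?N (k - 1) f x = 0"
      by (rule support_low_dimension[OF norm_north_pole _ _ R f C _ z x])
         (use kn k mu(1) in \<open>simp_all add: of_nat_diff\<close>)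
  qed
  have high: "support_property k b f"
    if kn: "k = CARD('n)" and f: "continuous_on (sphere 0 1 - {?N}) f"
      and wb: "\<And>m. m > 0 \<Longrightarrow> weighted_bounded (real k - 1 - m / 2) f" for f :: "(real^'n) \<times> real \<Rightarrow> complex"
  proof (rule support_property_from_pullback[OF k(1) b f])
    fix x :: "(real^'n) \<times> real"
    assume z: "\<And>U p. pole_slice ?N U p \<Longrightarrow> dim U = k - 1 \<Longrightarrow> norm p > sqrt ((1 + b) / (1 - b)) \<Longrightarrow>
        (\<integral>z. pullback ?N (k - 1) f (p + z) \<partial>subspace_lborel U) = 0"
      and x: "x \<bullet> ?N = 0" "norm x > sqrt ((1 + b) / (1 - b))"
    show "pullback ?N (k - 1) f x = 0"
    proof (rule support_hyperplanes[OF norm_north_pole _ R f _ z x])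
      show "k - 1 + 2 = DIM((real^'n) \<times> real)" using kn k by simp
      show "\<exists>C. \<forall>\<eta>\<in>sphere 0 1 - {?N}. (1 - \<eta> \<bullet> ?N) powr (real (k - 1) - m / 2) * norm (f \<eta>) \<le> C" if "m > 0" for m
        using wb[OF that] k unfolding weighted_bounded_iff by (simp add: of_nat_diff)
    qed
  qed
  have A: "support_property k b f"
    if f: "continuous_on (sphere 0 1 - {?N}) f"
      and wb: "\<And>m. m > 0 \<Longrightarrow> weighted_bounded (real k - 1 - m / 2) f" for f :: "(real^'n) \<times> real \<Rightarrow> complex"
  proof (cases "k = CARD('n)")
    case True
    then show ?thesis by (rule high[OF _ f wb])
  next
    case False
    \<comment> \<open>any \<open>m > k - 1\<close> would do\<close>
    show ?thesis
      by (rule low[OF _ f, of "real k - 1 - 2 * real k / 2"]) (use False k wb[of "2 * real k"] in auto)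
  qed
  have i: "AE \<tau> in slice_planes_measure k. \<tau> \<in> far_planes k b \<longrightarrow> slice_converges f \<tau> \<and> slice_transform f \<tau> = 0"
    if "AE \<eta> in completion (surface_measure UNIV). \<eta> \<in> cap b \<longrightarrow> f \<eta> = 0" for f :: "(real^'n) \<times> real \<Rightarrow> complex"
    by (rule slice_transform_vanishing[OF k(1) b that])
  show ?thesis
  proof (intro conjI allI impI)
    fix f :: "(real^'n) \<times> real \<Rightarrow> complex"
    show "AE \<tau> in slice_planes_measure k. \<tau> \<in> far_planes k b \<longrightarrow> slice_converges f \<tau> \<and> slice_transform f \<tau> = 0"
      if "AE \<eta> in completion (surface_measure UNIV). \<eta> \<in> cap b \<longrightarrow> f \<eta> = 0"
      using that by (rule i)
    show "support_property k b f"
      if "continuous_on (sphere 0 1 - {?N}) f \<and> (\<forall>m::real. m > 0 \<longrightarrow> weighted_bounded (real k - 1 - m / 2) f)"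
      using that by (intro A) auto
    show "support_property k b f"
      if "k < CARD('n) \<and> continuous_on (sphere 0 1 - {?N}) f \<and> (\<exists>\<mu>. \<mu> < (real k - 1) / 2 \<and> weighted_bounded \<mu> f)"
      using that low by blast
    show "decay_sharp TYPE('n) k b" if "k < CARD('n)" using decay_sharpness[OF k(1) that b] .
  qed
qed

end
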